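(* Suppose that $\Omega\subset\mathbb{C}^d$ is a hyperbolic domain that satisfies BSP (in particular, $\Omega$ can be any bounded domain). Then $\Omega$ is a visibility domain if and only if it is a local visibility domain; and $\Omega$ is a weak visibility domain if and only if it is a local weak visibility domain.
   Context: For a domain $\Omega\subset\mathbb{C}^d$, $\mathsf{k}_\Omega$ is the Kobayashi (pseudo)distance and $\kappa_\Omega(z;v)$ the Kobayashi--Royden (pseudo)metric; $\Omega$ is hyperbolic if $\mathsf{k}_\Omega$ is a distance. BSP (boundary separation property): $\Omega$ satisfies BSP (with respect to $\mathsf{k}_\Omega$) if for all $p,q\in\partial\Omega$ with $p\ne q$, $\liminf_{(z,w)\to(p,q),\,z,w\in\Omega}\mathsf{k}_\Omega(z,w)>0$. Almost-geodesics: for $\lambda\ge1,\kappa\ge0$ and an interval $I\subset\mathbb{R}$, a map $\sigma:I\to\Omega$ is a $(\lambda,\kappa)$-almost-geodesic (for $\mathsf{k}_\Omega$) if (i) $\frac1\lambda|s-t|-\kappa\le \mathsf{k}_\Omega(\sigma(s),\sigma(t))\le\lambda|s-t|+\kappa$ for all $s,t\in I$; (ii) $\sigma$ is absolutely continuous and $\kappa_\Omega(\sigma(t);\sigma'(t))\le\lambda$ for a.e. $t\in I$. End compactification: if $\Omega$ is bounded, $\overline{\Omega}^{End}:=\overline{\Omega}$. If $\Omega$ is unbounded, fix an exhaustion $(K_j)_{j\ge1}$ of $\overline\Omega$ by compact sets with $K_j$ contained in the interior (in $\overline\Omega$) of $K_{j+1}$. An end of $\overline\Omega$ is a sequence $(F_j)_{j\ge1}$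 with $F_j$ a connected component of $\overline\Omega\setminus K_j$ and $F_{j+1}\subset F_j$. As a set, $\overline{\Omega}^{End}$ is $\overline\Omega$ together with all ends. Points of $\overline\Omega$ have their Euclidean neighbourhoods in $\overline\Omega$ as neighbourhood basis; an end $(F_j)_j$ has the neighbourhood basis $(\widehat F_j)_j$, where $\widehat F_j$ is $F_j$ together with all ends $(G_\nu)_\nu$ with $G_\nu=F_\nu$ for $\nu=1,\dots,j$. (Up to natural homeomorphism this does not depend on the exhaustion.) $\partial\overline{\Omega}^{End}:=\overline{\Omega}^{End}\setminus\Omega$. Visibility: distinct $\zeta,\eta\in\partial\overline{\Omega}^{End}$ satisfy the $(\lambda,\kappa)$-visibility property with respect to $\mathsf{k}_\Omega$ if there exist neighbourhoods $V_\zeta$, $V_\eta$ of $\zeta,\eta$ in $\overline{\Omega}^{End}$ with $\overline{V_\zeta}\cap\overline{V_\eta}=\emptyset$ and a compact $K\subset\Omega$ such that every $(\lambda,\kappa)$-almost-geodesic $\sigma:[0,T]\to\Omega$ for $\mathsf{k}_\Omega$ with $\sigma(0)\in V_\zeta$, $\sigma(T)\in V_\eta$ satisfies $\sigma([0,T])\cap K\ne\emptyset$. The pair satisfies the $\lambda$-visibility property if it satisfies the $(\lambda,\kappa)$-visibility property for every $\kappa>0$; the visibility property if it satisfies the $\lambda$-visibility property for every $\lambda\ge1$; the weak visibility property if it satisfies the $1$-visibility property. $\Omega$ is a visibility domain (resp. weak visibility domain) if every pair of distinct points of $\partial\overline{\Omega}^{End}$ satisfies the visibility (resp. weak visibility)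 property with respect to $\mathsf{k}_\Omega$. Local visibility: a hyperbolic domain $\Omega$ is a local (weak) visibility domain at $p\in\partial\Omega$ if for every sequence $(x_n)_{n\ge1}$ in $\Omega$ converging to $p$ there exist a subdomain $U$ of $\Omega$ and a subsequence $(x_{k_n})_{n\ge1}$ such that $p\in(\partial U\cap\partial\Omega)\setminus\overline{\partial U\cap\Omega}$, $x_{k_n}\in U$ for all $n$, and every two distinct points of $(\partial U\cap\partial\Omega)\setminus\overline{\partial U\cap\Omega}$ possess the (weak) visibility property with respect to $\mathsf{k}_U$. $\Omega$ is a local (weak) visibility domain if this holds at every $p\in\partial\Omega$. *)

theory Defs
  imports "HOL-Analysis.Analysis"
begin

section \<open>The Kobayashi distance and the Kobayashi--Royden metric\<close>

definition is_domain :: "'a::topological_space set \<Rightarrow> bool" where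
  "is_domain \<Omega> \<longleftrightarrow> open \<Omega> \<and> connected \<Omega> \<and> \<Omega> \<noteq> {}"

definition holo_discs :: "(complex ^ 'd) set \<Rightarrow> (complex \<Rightarrow> complex ^ 'd) set" where
  "holo_discs \<Omega> =
     {\<phi>. (\<forall>i. (\<lambda>\<zeta>. \<phi> \<zeta> $ i) holomorphic_on ball 0 1) \<and> \<phi> ` ball 0 1 \<subseteq> \<Omega>}"

text \<open>Normalised so that the infinitesimal metric on the unit disc is
  \<open>\<bar>d\<zeta>\<bar> / (1 - \<bar>\<zeta>\<bar>\<^sup>2)\<close>, in agreement with \<open>kobayashi_royden\<close> below.\<close>

definition poincare_dist :: "complex \<Rightarrow> complex \<Rightarrow> real" where
  "poincare_dist a b = artanh (norm ((a - b) / (1 - cnj a * b)))"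

definition disc_chain ::
  "(complex ^ 'd) set \<Rightarrow> complex ^ 'd \<Rightarrow> complex ^ 'd \<Rightarrow> nat \<Rightarrow>
   (nat \<Rightarrow> complex \<Rightarrow> complex ^ 'd) \<Rightarrow> (nat \<Rightarrow> complex) \<Rightarrow> (nat \<Rightarrow> complex) \<Rightarrow> bool" where
  "disc_chain \<Omega> z w n \<phi> a b \<longleftrightarrow>
     (\<forall>j\<le>n. \<phi> j \<in> holo_discs \<Omega> \<and> a j \<in> ball 0 1 \<and> b j \<in> ball 0 1) \<and>
     \<phi> 0 (a 0) = z \<and> (\<forall>j<n. \<phi> j (b j) = \<phi> (Suc j) (a (Suc j))) \<and> \<phi> n (b n) = w"

text \<open>Off \<open>\<Omega> \<times> \<Omega>\<close> there are no chains and the infimum of the empty set of reals is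
  unspecified; the value \<open>0\<close> there is only a convention.\<close>

definition kobayashi_dist :: "(complex ^ 'd) set \<Rightarrow> complex ^ 'd \<Rightarrow> complex ^ 'd \<Rightarrow> real" where
  "kobayashi_dist \<Omega> z w =
     (if z \<in> \<Omega> \<and> w \<in> \<Omega>
      then Inf {(\<Sum>j\<le>n. poincare_dist (a j) (b j)) | n \<phi> a b. disc_chain \<Omega> z w n \<phi> a b}
      else 0)"

definition kobayashi_royden :: "(complex ^ 'd) set \<Rightarrow> complex ^ 'd \<Rightarrow> complex ^ 'd \<Rightarrow> real" where
  "kobayashi_royden \<Omega> z v =
     Inf {norm \<alpha> | \<alpha> \<phi>. \<phi> \<in> holo_discs \<Omega> \<and> \<phi> 0 = z \<and>
                          (\<forall>i. \<alpha> * deriv (\<lambda>\<zeta>. \<phi> \<zeta> $ i) 0 = v $ i)}"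

definition kobayashi_hyperbolic :: "(complex ^ 'd) set \<Rightarrow> bool" where
  "kobayashi_hyperbolic \<Omega> \<longleftrightarrow> Metric_space \<Omega> (kobayashi_dist \<Omega>)"

text \<open>For open \<open>\<Omega>\<close> a pair of boundary points is not in \<open>\<Omega> \<times> \<Omega>\<close>, so the puncturing in the
  filter \<open>at\<close> has no effect.\<close>

definition BSP :: "(complex ^ 'd) set \<Rightarrow> bool" where
  "BSP \<Omega> \<longleftrightarrow>
     (\<forall>p \<in> frontier \<Omega>. \<forall>q \<in> frontier \<Omega>. p \<noteq> q \<longrightarrow>
        Liminf (at (p, q) within \<Omega> \<times> \<Omega>) (\<lambda>(z, w). ereal (kobayashi_dist \<Omega> z w)) > 0)"


section \<open>Almost-geodesics\<close>

definition abs_continuous_on :: "real set \<Rightarrow> (real \<Rightarrow> 'a::real_normed_vector) \<Rightarrow> bool" where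
  "abs_continuous_on I f \<longleftrightarrow>
     (\<forall>\<epsilon>>0. \<exists>\<delta>>0. \<forall>(n::nat) a b.
        (\<forall>i<n. a i \<in> I \<and> b i \<in> I \<and> a i \<le> b i) \<and>
        disjoint_family_on (\<lambda>i. {a i <..< b i}) {..<n} \<and>
        (\<Sum>i<n. b i - a i) < \<delta> \<longrightarrow>
        (\<Sum>i<n. norm (f (b i) - f (a i))) < \<epsilon>)"

text \<open>An absolutely continuous curve is differentiable almost everywhere, so demanding the
  existence of the derivative in the last clause is no restriction.\<close>

definition almost_geodesic ::
  "(complex ^ 'd) set \<Rightarrow> real \<Rightarrow> real \<Rightarrow> real set \<Rightarrow> (real \<Rightarrow> complex ^ 'd) \<Rightarrow> bool" where
  "almost_geodesic \<Omega> l c I \<sigma> \<longleftrightarrow>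
     is_interval I \<and> \<sigma> ` I \<subseteq> \<Omega> \<and>
     (\<forall>s\<in>I. \<forall>t\<in>I. 1 / l * \<bar>s - t\<bar> - c \<le> kobayashi_dist \<Omega> (\<sigma> s) (\<sigma> t) \<and>
                   kobayashi_dist \<Omega> (\<sigma> s) (\<sigma> t) \<le> l * \<bar>s - t\<bar> + c) \<and>
     abs_continuous_on I \<sigma> \<and>
     (AE t in lebesgue_on I. \<exists>v. (\<sigma> has_vector_derivative v) (at t within I) \<and>
                                 kobayashi_royden \<Omega> (\<sigma> t) v \<le> l)"


section \<open>The end compactification\<close>

definition exhaustion :: "'a::real_normed_vector set \<Rightarrow> nat \<Rightarrow> 'a set" where
  "exhaustion \<Omega> j = closure \<Omega> \<inter> cball 0 (real j)"

lemma exhaustion_compact: "compact (exhaustion (\<Omega> :: 'a::euclidean_space set) j)"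
  by (simp add: exhaustion_def closed_Int_compact)

lemma exhaustion_interior:
  "exhaustion \<Omega> j \<subseteq> top_of_set (closure \<Omega>) interior_of exhaustion \<Omega> (Suc j)"
proof -
  have "exhaustion \<Omega> j \<subseteq> closure \<Omega> \<inter> ball 0 (real (Suc j))"
    by (auto simp: exhaustion_def)
  also have "\<dots> \<subseteq> top_of_set (closure \<Omega>) interior_of exhaustion \<Omega> (Suc j)"
    by (rule interior_of_maximal) (auto simp: exhaustion_def openin_open_Int)
  finally show "exhaustion \<Omega> j \<subseteq> top_of_set (closure \<Omega>) interior_of exhaustion \<Omega> (Suc j)" .
qed

lemma exhaustion_Union: "(\<Union>j. exhaustion \<Omega> j) = closure \<Omega>"
  by (auto simp: exhaustion_def intro: real_arch_simple)

datatype 'a end_point = Pt 'a | End "nat \<Rightarrow> 'a set"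

definition ends :: "'a::real_normed_vector set \<Rightarrow> (nat \<Rightarrow> 'a set) set" where
  "ends \<Omega> =
     (if bounded \<Omega> then {}
      else {F. \<forall>j. F j \<in> components (closure \<Omega> - exhaustion \<Omega> j) \<and> F (Suc j) \<subseteq> F j})"

definition end_compactification :: "'a::real_normed_vector set \<Rightarrow> 'a end_point set" where
  "end_compactification \<Omega> = Pt ` closure \<Omega> \<union> End ` ends \<Omega>"

definition end_boundary :: "'a::real_normed_vector set \<Rightarrow> 'a end_point set" where
  "end_boundary \<Omega> = end_compactification \<Omega> - Pt ` \<Omega>"

definition end_hat :: "'a::real_normed_vector set \<Rightarrow> (nat \<Rightarrow> 'a set) \<Rightarrow> nat \<Rightarrow> 'a end_point set" where
  "end_hat \<Omega> F j = Pt ` F j \<union> End ` {G \<in> ends \<Omega>. \<forall>\<nu>\<le>j. G \<nu> = F \<nu>}"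

text \<open>If \<open>closure \<Omega>\<close> is not locally connected, a component of
  \<open>closure \<Omega> - exhaustion \<Omega> j\<close> need not be relatively open, and then the prescribed
  neighbourhood bases are not those of a topology.  To have exactly these bases for every
  \<open>\<Omega>\<close>, the neighbourhood system is used directly, and the closure of a set consists of the points
  all of whose neighbourhoods meet it.\<close>

definition end_nhd :: "'a::real_normed_vector set \<Rightarrow> 'a end_point \<Rightarrow> 'a end_point set \<Rightarrow> bool" where
  "end_nhd \<Omega> \<xi> V \<longleftrightarrow> V \<subseteq> end_compactification \<Omega> \<and>
     (case \<xi> of
        Pt x \<Rightarrow> x \<in> closure \<Omega> \<and> (\<exists>e>0. Pt ` (ball x e \<inter> closure \<Omega>) \<subseteq> V)
      | End F \<Rightarrow> F \<in> ends \<Omega> \<and> (\<exists>j. end_hat \<Omega> F j \<subseteq> V))"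

definition end_closure :: "'a::real_normed_vector set \<Rightarrow> 'a end_point set \<Rightarrow> 'a end_point set" where
  "end_closure \<Omega> V = {\<xi> \<in> end_compactification \<Omega>. \<forall>N. end_nhd \<Omega> \<xi> N \<longrightarrow> N \<inter> V \<noteq> {}}"


section \<open>Visibility\<close>

definition visible_pair_const ::
  "(complex ^ 'd) set \<Rightarrow> real \<Rightarrow> real \<Rightarrow> (complex ^ 'd) end_point \<Rightarrow> (complex ^ 'd) end_point \<Rightarrow> bool"
  where
  "visible_pair_const \<Omega> l c \<zeta> \<eta> \<longleftrightarrow>
     (\<exists>V W K. end_nhd \<Omega> \<zeta> V \<and> end_nhd \<Omega> \<eta> W \<and> end_closure \<Omega> V \<inter> end_closure \<Omega> W = {} \<and>
        compact K \<and> K \<subseteq> \<Omega> \<and>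
        (\<forall>T\<ge>0. \<forall>\<sigma>. almost_geodesic \<Omega> l c {0..T} \<sigma> \<and> Pt (\<sigma> 0) \<in> V \<and> Pt (\<sigma> T) \<in> W \<longrightarrow>
                   \<sigma> ` {0..T} \<inter> K \<noteq> {}))"

definition lambda_visible_pair ::
  "(complex ^ 'd) set \<Rightarrow> real \<Rightarrow> (complex ^ 'd) end_point \<Rightarrow> (complex ^ 'd) end_point \<Rightarrow> bool" where
  "lambda_visible_pair \<Omega> l \<zeta> \<eta> \<longleftrightarrow> (\<forall>c>0. visible_pair_const \<Omega> l c \<zeta> \<eta>)"

definition visible_pair ::
  "(complex ^ 'd) set \<Rightarrow> (complex ^ 'd) end_point \<Rightarrow> (complex ^ 'd) end_point \<Rightarrow> bool" where
  "visible_pair \<Omega> \<zeta> \<eta> \<longleftrightarrow> (\<forall>l\<ge>1. lambda_visible_pair \<Omega> l \<zeta> \<eta>)"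

definition weakly_visible_pair ::
  "(complex ^ 'd) set \<Rightarrow> (complex ^ 'd) end_point \<Rightarrow> (complex ^ 'd) end_point \<Rightarrow> bool" where
  "weakly_visible_pair \<Omega> \<zeta> \<eta> \<longleftrightarrow> lambda_visible_pair \<Omega> 1 \<zeta> \<eta>"

definition visibility_domain :: "(complex ^ 'd) set \<Rightarrow> bool" where
  "visibility_domain \<Omega> \<longleftrightarrow>
     (\<forall>\<zeta> \<in> end_boundary \<Omega>. \<forall>\<eta> \<in> end_boundary \<Omega>. \<zeta> \<noteq> \<eta> \<longrightarrow> visible_pair \<Omega> \<zeta> \<eta>)"

definition weak_visibility_domain :: "(complex ^ 'd) set \<Rightarrow> bool" where
  "weak_visibility_domain \<Omega> \<longleftrightarrow>
     (\<forall>\<zeta> \<in> end_boundary \<Omega>. \<forall>\<eta> \<in> end_boundary \<Omega>. \<zeta> \<noteq> \<eta> \<longrightarrow> weakly_visible_pair \<Omega> \<zeta> \<eta>)"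

definition shared_boundary :: "'a::topological_space set \<Rightarrow> 'a set \<Rightarrow> 'a set" where
  "shared_boundary U \<Omega> = (frontier U \<inter> frontier \<Omega>) - closure (frontier U \<inter> \<Omega>)"

definition local_visibility_domain :: "(complex ^ 'd) set \<Rightarrow> bool" where
  "local_visibility_domain \<Omega> \<longleftrightarrow>
     (\<forall>p \<in> frontier \<Omega>. \<forall>x::nat \<Rightarrow> complex ^ 'd. (\<forall>n. x n \<in> \<Omega>) \<and> x \<longlonglongrightarrow> p \<longrightarrow>
        (\<exists>U (r::nat \<Rightarrow> nat). is_domain U \<and> U \<subseteq> \<Omega> \<and> strict_mono r \<and>
           p \<in> shared_boundary U \<Omega> \<and> (\<forall>n. x (r n) \<in> U) \<and>
           (\<forall>q \<in> shared_boundary U \<Omega>. \<forall>q' \<in> shared_boundary U \<Omega>. q \<noteq> q' \<longrightarrow>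
              visible_pair U (Pt q) (Pt q'))))"

definition local_weak_visibility_domain :: "(complex ^ 'd) set \<Rightarrow> bool" where
  "local_weak_visibility_domain \<Omega> \<longleftrightarrow>
     (\<forall>p \<in> frontier \<Omega>. \<forall>x::nat \<Rightarrow> complex ^ 'd. (\<forall>n. x n \<in> \<Omega>) \<and> x \<longlonglongrightarrow> p \<longrightarrow>
        (\<exists>U (r::nat \<Rightarrow> nat). is_domain U \<and> U \<subseteq> \<Omega> \<and> strict_mono r \<and>
           p \<in> shared_boundary U \<Omega> \<and> (\<forall>n. x (r n) \<in> U) \<and>
           (\<forall>q \<in> shared_boundary U \<Omega>. \<forall>q' \<in> shared_boundary U \<Omega>. q \<noteq> q' \<longrightarrow>
              weakly_visible_pair U (Pt q) (Pt q'))))"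

end

theory Submission
  imports Defs "HOL-Complex_Analysis.Riemann_Mapping"
begin

text \<open>For the passage from local to global visibility, let almost-geodesics of \<open>\<Omega>\<close> leave every compact
  set although their endpoints converge to distinct boundary points or ends.  They accumulate at some
  \<open>p \<in> frontier \<Omega>\<close>; take the domain \<open>U\<close> given by local visibility at \<open>p\<close> and subarcs inside \<open>U\<close> joining points near \<open>p\<close> to a small sphere around \<open>p\<close>.  Royden localization gives
  \<open>\<kappa>\<^sub>U \<le> coth (\<delta>(z)) \<kappa>\<^sub>\<Omega>\<close>, where \<open>\<delta>(z)\<close> is the Kobayashi distance of \<open>z\<close> to \<open>\<Omega> - U\<close> in \<open>\<Omega>\<close>, and BSP
  bounds \<open>\<delta>\<close> below near \<open>p\<close>.  Hence the subarcs are almost-geodesics of \<open>U\<close> with a larger \<open>\<lambda>\<close>, which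
  contradicts visibility in \<open>U\<close>.

  For \<open>\<lambda> = 1\<close> no loss in \<open>\<lambda>\<close> is allowed.  Applied to nearly shortest paths from \<open>z\<close> to \<open>\<Omega> - U\<close>, visibility
  in \<open>U\<close> first yields \<open>\<delta>(z) \<ge> k(z, o) - C\<close> for a base point \<open>o\<close>.  So \<open>\<delta>\<close> grows linearly along an
  almost-geodesic, away from its point closest to \<open>o\<close>, and the excess of speed \<open>coth \<delta> - 1\<close> is integrable with
  a uniform bound: a reparametrization makes the subarcs \<open>(1, \<kappa>')\<close>-almost-geodesics of \<open>U\<close>.\<close>

section \<open>Chains of discs and the Kobayashi distance\<close>

text \<open>Passing from \<Omega> to a chart \<open>U\<close> increases both distance and speed.
  Lower estimates along a curve therefore survive unchanged, and the only loss is in the speed.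
  Upper estimates come from integrating the speed, so this has to be done for curves that are merely
  absolutely continuous. If all \<lambda> are available, a constant loss is absorbed in \<lambda>;
  for \<lambda> = 1 only an integrable excess over 1 can be afforded. The growth of \<delta> looks
  circular, since it rests on visibility in \<open>U\<close> for curves whose speed in
  \<open>U\<close> is itself governed by \<delta>. Nearly shortest paths to
  \<open>\<Omega> - U\<close> break the circle: by its own minimality, such a path of duration l has
  at time t distance at least l - t - 2 from \<open>\<Omega> - U\<close>, so its excess of speed is
  integrable before anything is known about \<delta>.\<close>

lemma holo_discs_compose:
  assumes "\<phi> \<in> holo_discs \<Omega>" and "f holomorphic_on ball 0 1" and "f ` ball 0 1 \<subseteq> ball 0 1"
  shows "(\<lambda>\<zeta>. \<phi> (f \<zeta>)) \<in> holo_discs \<Omega>"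
proof -
  have "(\<lambda>\<zeta>. \<phi> (f \<zeta>) $ i) holomorphic_on ball 0 1" for i
    using holomorphic_on_compose_gen[OF assms(2) _ assms(3), of "\<lambda>\<zeta>. \<phi> \<zeta> $ i"] assms(1)
    by (simp add: holo_discs_def o_def)
  then show ?thesis
    using assms(1,3) by (fastforce simp: holo_discs_def)
qed

lemma holo_discs_mono: "U \<subseteq> \<Omega> \<Longrightarrow> \<phi> \<in> holo_discs U \<Longrightarrow> \<phi> \<in> holo_discs \<Omega>"
  by (auto simp: holo_discs_def)

lemma holo_discs_in: "\<phi> \<in> holo_discs \<Omega> \<Longrightarrow> norm \<zeta> < 1 \<Longrightarrow> \<phi> \<zeta> \<in> \<Omega>"
  by (auto simp: holo_discs_def)

lemma holo_discs_deriv: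
  assumes "\<phi> \<in> holo_discs \<Omega>" and "norm \<zeta> < 1"
  shows "((\<lambda>\<zeta>. \<phi> \<zeta> $ i) has_field_derivative deriv (\<lambda>\<zeta>. \<phi> \<zeta> $ i) \<zeta>) (at \<zeta>)"
  using assms holomorphic_derivI[of "\<lambda>\<zeta>. \<phi> \<zeta> $ i" "ball 0 1" \<zeta>] by (auto simp: holo_discs_def)

lemma norm_vector_scalar_mult: "norm (c *s x) = norm c * norm (x :: complex ^ 'd)"
  by (simp add: norm_vec_def norm_mult L2_set_right_distrib)

lemma linear_disc_in_holo_discs:
  assumes "ball z r \<subseteq> \<Omega>" and "0 < r" and "norm v \<le> r"
  shows "(\<lambda>\<zeta>. z + \<zeta> *s v) \<in> holo_discs \<Omega>"
proof -
  have "z + \<zeta> *s v \<in> \<Omega>" if "norm \<zeta> < 1" for \<zeta>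
  proof -
    have "norm \<zeta> * norm v \<le> norm \<zeta> * r"
      using assms(3) by (intro mult_left_mono) auto
    also have "\<dots> < r" using that \<open>0 < r\<close> by simp
    finally have "z + \<zeta> *s v \<in> ball z r"
      by (simp add: dist_norm norm_vector_scalar_mult)
    then show ?thesis using assms(1) by auto
  qed
  then show ?thesis
    by (auto simp: holo_discs_def intro!: holomorphic_intros)
qed

section \<open>Disc automorphisms and the hyperbolic tangent\<close>

definition mob :: "complex \<Rightarrow> complex \<Rightarrow> complex" where
  "mob a = Moebius_function 0 (- a)"

lemma mob_eq: "mob a z = (z + a) / (1 + cnj a * z)"
  by (simp add: mob_def Moebius_function_simple)

lemma mob_0 [simp]: "mob a 0 = a"
  by (simp add: mob_eq)

lemma mob_holomorphic: "norm a < 1 \<Longrightarrow> mob a holomorphic_on ball 0 1"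
  by (simp add: mob_def Moebius_function_holomorphic)

lemma mob_ball: "norm a < 1 \<Longrightarrow> norm z < 1 \<Longrightarrow> norm (mob a z) < 1"
  by (simp add: mob_def Moebius_function_norm_lt_1)

lemma mob_inverse: "norm a < 1 \<Longrightarrow> norm z < 1 \<Longrightarrow> mob a (mob (- a) z) = z"
  by (simp add: mob_def Moebius_function_compose)

lemma norm_of_real_tanh: "0 \<le> t \<Longrightarrow> norm (of_real (tanh t) :: complex) < 1"
  by (simp add: tanh_real_lt_1)

lemma tanh_artanh_real:
  assumes "0 \<le> x" "x < (1::real)"
  shows "tanh (artanh x) = x"
proof -
  have "(1 + x) / (1 - x) > 0" using assms by simp
  have "artanh x = ln ((1 + x) / (1 - x)) / 2" by (simp add: artanh_def)
  then have "- (2 * artanh x) = - ln ((1 + x) / (1 - x))" by simp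
  then have E: "exp (- 2 * artanh x) = (1 - x) / (1 + x)"
    using \<open>(1 + x) / (1 - x) > 0\<close> by (simp only: mult_minus_left exp_minus exp_ln) simp
  have "tanh (artanh x) = (1 - (1 - x) / (1 + x)) / (1 + (1 - x) / (1 + x))"
    unfolding tanh_real_altdef E ..
  also have "\<dots> = ((2 * x) / (1 + x)) / (2 / (1 + x))"
    using assms by (intro arg_cong2[of _ _ _ _ "(/)"]) (simp_all add: field_simps)
  also have "\<dots> = x" using assms by simp
  finally show ?thesis .
qed

text \<open>The real number \<open>d\<close> is the total Poincare length of a chain of discs from \<open>z\<close> to \<open>w\<close>,
  each disc being normalised to start at its centre and to end on the positive real axis.\<close>
inductive reach :: "(complex ^ 'd) set \<Rightarrow> complex ^ 'd \<Rightarrow> complex ^ 'd \<Rightarrow> real \<Rightarrow> bool" for \<Omega> z where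
  reach_refl: "z \<in> \<Omega> \<Longrightarrow> reach \<Omega> z z 0"
| reach_step: "reach \<Omega> z (\<phi> 0) d \<Longrightarrow> \<phi> \<in> holo_discs \<Omega> \<Longrightarrow> 0 \<le> t \<Longrightarrow>
    reach \<Omega> z (\<phi> (of_real (tanh t))) (d + t)"

lemma reach_nonneg: "reach \<Omega> z w d \<Longrightarrow> 0 \<le> d"
  by (induction rule: reach.induct) auto

lemma reach_mem: "reach \<Omega> z w d \<Longrightarrow> z \<in> \<Omega> \<and> w \<in> \<Omega>"
  by (induction rule: reach.induct) (auto intro: holo_discs_in simp: tanh_real_lt_1)

lemma reach_trans: "reach \<Omega> w x e \<Longrightarrow> reach \<Omega> z w d \<Longrightarrow> reach \<Omega> z x (d + e)"
proof (induction rule: reach.induct)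
  case (reach_step \<phi> e t)
  then show ?case
    using reach.reach_step[of \<Omega> z \<phi> "d + e" t] by (simp add: add.assoc)
qed simp

lemma reach_mono: "reach U z w d \<Longrightarrow> U \<subseteq> \<Omega> \<Longrightarrow> reach \<Omega> z w d"
  by (induction rule: reach.induct) (auto intro: reach.intros holo_discs_mono)

lemma reach_disc:
  assumes "\<phi> \<in> holo_discs \<Omega>" and "0 \<le> t"
  shows "reach \<Omega> (\<phi> 0) (\<phi> (of_real (tanh t))) t"
  using reach_step[OF reach_refl assms] holo_discs_in[OF assms(1), of 0] by simp

text \<open>A rotation followed by \<open>mob a\<close> carries 0 to \<open>a\<close> and the real
  number \<open>norm c\<close> to \<open>b\<close>; precomposing with it brings any two points of a
  disc into the normal form of \<open>reach\<close>.\<close>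

lemma reach_disc_points:
  assumes \<phi>: "\<phi> \<in> holo_discs \<Omega>" and a: "norm a < 1" and b: "norm b < 1"
  shows "reach \<Omega> (\<phi> a) (\<phi> b) (poincare_dist a b)" "0 \<le> poincare_dist a b"
proof -
  define c where "c = mob (- a) b"
  have c1: "norm c < 1" using a b by (simp add: c_def mob_ball)
  have pd: "poincare_dist a b = artanh (norm c)"
    by (simp add: c_def poincare_dist_def mob_eq norm_divide norm_minus_commute)
  \<comment> \<open>The rotation has to be unimodular, but \<open>sgn 0\<close> is 0, hence the
    separate case.\<close>
  define u where "u = (if c = 0 then 1 else sgn c)"
  have u: "norm u = 1" "u * of_real (norm c) = c"
    by (auto simp: u_def norm_sgn complex_sgn_def scaleR_conv_of_real norm_mult norm_inverse)
  define \<psi> where "\<psi> = (\<lambda>\<zeta>. \<phi> (mob a (u * \<zeta>)))"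
  have "(\<lambda>\<zeta>. mob a (u * \<zeta>)) holomorphic_on ball 0 1"
  proof (rule holomorphic_on_compose_gen[OF _ mob_holomorphic[OF a], unfolded o_def])
    show "(\<lambda>\<zeta>. u * \<zeta>) ` ball 0 1 \<subseteq> ball 0 1" by (auto simp: norm_mult u)
  qed (intro holomorphic_intros)
  then have \<psi>: "\<psi> \<in> holo_discs \<Omega>"
    unfolding \<psi>_def using a by (intro holo_discs_compose[OF \<phi>]) (auto simp: mob_ball norm_mult u)
  have 0: "0 \<le> artanh (norm c)"
  proof -
    have "tanh (artanh (norm c)) = norm c" by (simp add: c1 tanh_artanh_real)
    then have "0 \<le> tanh (artanh (norm c))" by simp
    then show ?thesis by simp
  qed
  have "\<psi> 0 = \<phi> a" "\<psi> (of_real (tanh (artanh (norm c)))) = \<phi> b"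
    using a b c1 by (simp_all add: \<psi>_def tanh_artanh_real u c_def[symmetric])
       (simp add: c_def mob_inverse)
  with reach_disc[OF \<psi> 0] show "reach \<Omega> (\<phi> a) (\<phi> b) (poincare_dist a b)" by (simp add: pd)
  show "0 \<le> poincare_dist a b" using 0 pd by simp
qed

lemma poincare_dist_0: "0 \<le> t \<Longrightarrow> poincare_dist 0 (of_real (tanh t)) = t"
  by (simp add: poincare_dist_def artanh_tanh_real)

lemma poincare_dist_commute: "poincare_dist a b = poincare_dist b a"
proof -
  have "norm (1 - cnj a * b) = norm (cnj (1 - cnj a * b))" by (simp only: complex_mod_cnj)
  then have "norm (1 - cnj a * b) = norm (1 - cnj b * a)" by (simp add: mult.commute)
  then show ?thesis by (simp add: poincare_dist_def norm_divide norm_minus_commute)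
qed

text \<open>Each disc is recentred at its end point and traversed backwards; the Poincare distance
  is symmetric.\<close>

lemma reach_sym: "reach \<Omega> z w d \<Longrightarrow> reach \<Omega> w z d"
proof (induction rule: reach.induct)
  case (reach_step \<phi> d t)
  have "reach \<Omega> (\<phi> (of_real (tanh t))) (\<phi> 0) t"
    using reach_disc_points(1)[OF reach_step(2), of "of_real (tanh t)" 0] norm_of_real_tanh[OF reach_step(3)]
      poincare_dist_commute[of 0 "of_real (tanh t)"] poincare_dist_0[OF reach_step(3)] by simp
  from reach_trans[OF reach_step.IH this] show ?case by (simp add: add.commute)
qed (rule reach.intros)

lemma disc_chain_imp_reach:
  assumes "disc_chain \<Omega> z w n \<phi> a b"
  shows "reach \<Omega> z w (\<Sum>j\<le>n. poincare_dist (a j) (b j))"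
proof -
  have A: "\<phi> j \<in> holo_discs \<Omega>" "norm (a j) < 1" "norm (b j) < 1" if "j \<le> n" for j
    using assms that by (auto simp: disc_chain_def)
  have "reach \<Omega> z (\<phi> m (b m)) (\<Sum>j\<le>m. poincare_dist (a j) (b j))" if "m \<le> n" for m
    using that
  proof (induction m)
    case 0
    then show ?case using reach_disc_points(1)[OF A[of 0]] assms by (simp add: disc_chain_def)
  next
    case (Suc m)
    have "\<phi> m (b m) = \<phi> (Suc m) (a (Suc m))" using assms Suc.prems by (auto simp: disc_chain_def)
    then show ?case
      using reach_trans[OF reach_disc_points(1)[OF A[of "Suc m"]]] Suc by simp
  qed
  from this[of n] show ?thesis using assms by (simp add: disc_chain_def)
qed

lemma reach_imp_disc_chain:
  assumes "reach \<Omega> z w d"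
  shows "\<exists>n \<phi> a b. disc_chain \<Omega> z w n \<phi> a b \<and> d = (\<Sum>j\<le>n. poincare_dist (a j) (b j))"
  using assms
proof (induction rule: reach.induct)
  case reach_refl
  have "(\<lambda>\<zeta>. z) \<in> holo_discs \<Omega>" using reach_refl by (auto simp: holo_discs_def)
  then show ?case
    by (intro exI[of _ 0] exI[of _ "\<lambda>_ _. z"] exI[of _ "\<lambda>_. 0"])
      (auto simp: disc_chain_def poincare_dist_def)
next
  case (reach_step \<psi> d t)
  then obtain n \<phi> a b where *: "disc_chain \<Omega> z (\<psi> 0) n \<phi> a b"
     and d: "d = (\<Sum>j\<le>n. poincare_dist (a j) (b j))" by blast
  let ?\<phi> = "\<phi>(Suc n := \<psi>)" and ?a = "a(Suc n := 0)" and ?b = "b(Suc n := of_real (tanh t))"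
  have "disc_chain \<Omega> z (\<psi> (of_real (tanh t))) (Suc n) ?\<phi> ?a ?b"
    using * reach_step(2) norm_of_real_tanh[OF reach_step(3)]
    by (auto simp: disc_chain_def le_Suc_eq less_Suc_eq)
  moreover have "d + t = (\<Sum>j\<le>Suc n. poincare_dist (?a j) (?b j))"
    using poincare_dist_0[OF reach_step(3)] by (simp add: d)
  ultimately show ?case by blast
qed

text \<open>Both descriptions of chains yield the same set of lengths. The inductive one serves from
  here on, since facts about chains then follow by rule induction.\<close>

lemma kobayashi_dist_eq_Inf_reach:
  assumes "z \<in> \<Omega>" "w \<in> \<Omega>"
  shows "kobayashi_dist \<Omega> z w = Inf {d. reach \<Omega> z w d}"
proof -
  have "{(\<Sum>j\<le>n. poincare_dist (a j) (b j)) | n \<phi> a b. disc_chain \<Omega> z w n \<phi> a b} = {d. reach \<Omega> z w d}"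
    using disc_chain_imp_reach reach_imp_disc_chain by blast
  then show ?thesis using assms by (simp add: kobayashi_dist_def)
qed

lemma bdd_below_reach: "bdd_below {d. reach \<Omega> z w d}"
  by (rule bdd_belowI[of _ 0]) (auto dest: reach_nonneg)

lemma kobayashi_dist_le_reach: "reach \<Omega> z w d \<Longrightarrow> kobayashi_dist \<Omega> z w \<le> d"
  using reach_mem[of \<Omega> z w d] cInf_lower[OF _ bdd_below_reach, of d \<Omega> z w]
  by (simp add: kobayashi_dist_eq_Inf_reach)

text \<open>The second-order bound keeps the leading coefficient 1, as the infinitesimal comparison
  of distance and speed demands; the cruder linear one serves the local Lipschitz estimates.\<close>

lemma artanh_bounds:
  assumes "0 \<le> x" "x \<le> (1/2::real)"
  shows "artanh x \<le> x + x\<^sup>2" "artanh x \<le> 2 * x" "0 \<le> artanh x"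
proof -
  have "artanh x = (ln (1 + x) - ln (1 - x)) / 2"
    using assms by (simp add: artanh_def ln_div)
  moreover have "ln (1 + x) \<le> x" using assms by (simp add: ln_add_one_self_le_self)
  moreover have "- x - 2 * x\<^sup>2 \<le> ln (1 - x)" using assms by (intro ln_one_minus_pos_lower_bound)
  moreover have "x\<^sup>2 \<le> x * (1/2)" using assms mult_left_mono[of x "1/2" x] by (simp add: power2_eq_square)
  moreover have "0 \<le> ln (1 + x)" "ln (1 - x) \<le> 0" using assms by auto
  ultimately have *: "artanh x = (ln (1 + x) - ln (1 - x)) / 2" "ln (1 + x) \<le> x"
    "- x - 2 * x\<^sup>2 \<le> ln (1 - x)" "x\<^sup>2 \<le> x * (1/2)" "0 \<le> ln (1 + x)" "ln (1 - x) \<le> 0" by auto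
  have arith: "(a::real) \<le> x + q" "0 \<le> p \<Longrightarrow> r \<le> 0 \<Longrightarrow> 0 \<le> a"
    if "a = (p - r) / 2" "p \<le> x" "- x - 2 * q \<le> r" for a p r q
    using that by auto
  show "artanh x \<le> x + x\<^sup>2" by (rule arith(1)[OF *(1,2,3)])
  also have "x + x\<^sup>2 \<le> 2 * x" using *(4) assms by simp
  finally show "artanh x \<le> 2 * x" .
  show "0 \<le> artanh x" by (rule arith(2)[OF *(1,2,3,5,6)])
qed

text \<open>One affine disc in the direction of \<open>w - z\<close> suffices. Staying within half
  the radius keeps its parameter in [0, 1/2], where artanh is at most twice its argument.\<close>

lemma reach_ball:
  assumes "ball z r \<subseteq> \<Omega>" and "0 < r" and "norm (w - z) \<le> r / 2"
  shows "\<exists>d. d \<le> 2 / r * norm (w - z) \<and> reach \<Omega> z w d"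
proof (cases "w = z")
  case True
  then show ?thesis using assms by (auto intro!: exI[of _ 0] reach_refl)
next
  case False
  define s where "s = norm (w - z) / r"
  define v where "v = of_real (inverse s) *s (w - z)"
  have s: "0 < s" "s \<le> 1/2" using assms False by (auto simp: s_def field_simps)
  have "norm v \<le> r" 
    using s assms False unfolding v_def norm_vector_scalar_mult by (simp add: s_def norm_inverse norm_divide)
  from reach_disc[OF linear_disc_in_holo_discs[OF assms(1,2) this] artanh_bounds(3)[of s]] s
  have "reach \<Omega> z (z + of_real s *s v) (artanh s)" by (simp add: tanh_artanh_real)
  moreover have "z + of_real s *s v = w" using s by (simp add: v_def vector_smult_assoc)
  moreover have "artanh s \<le> 2 / r * norm (w - z)" using artanh_bounds(2)[of s] s by (simp add: s_def)
  ultimately show ?thesis by auto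
qed

text \<open>Being joined by a chain is an equivalence relation with open classes, so connectedness
  leaves a single class. On a domain the infimum defining the distance is thus never taken over the
  empty set.\<close>

lemma ex_reach:
  assumes "is_domain \<Omega>" "z \<in> \<Omega>" "w \<in> \<Omega>"
  shows "\<exists>d. reach \<Omega> z w d"
proof (rule connected_equivalence_relation[of \<Omega>])
  show "connected \<Omega>" using assms by (simp add: is_domain_def)
  fix x assume "x \<in> \<Omega>"
  then obtain r where r: "0 < r" "ball x r \<subseteq> \<Omega>"
    using assms by (auto simp: is_domain_def open_contains_ball)
  have "ball x (r/2) \<subseteq> \<Omega>" using r by (force simp: subset_iff)
  moreover have "\<exists>d. reach \<Omega> x y d" if "y \<in> ball x (r/2)" for y
    using reach_ball[OF r(2,1), of y] that by (auto simp: dist_norm norm_minus_commute)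
  ultimately show "\<exists>T. openin (top_of_set \<Omega>) T \<and> x \<in> T \<and> (\<forall>y\<in>T. \<exists>d. reach \<Omega> x y d)"
    using r by (intro exI[of _ "ball x (r/2)"] conjI open_subset) auto
next
  fix x y assume "\<exists>d. reach \<Omega> x y d"
  then show "\<exists>d. reach \<Omega> y x d" using reach_sym by blast
next
  fix x y u assume "\<exists>d. reach \<Omega> x y d" "\<exists>d. reach \<Omega> y u d"
  then show "\<exists>d. reach \<Omega> x u d" using reach_trans by blast
qed (use assms in auto)

lemma kobayashi_dist_lt_reach:
  assumes "is_domain \<Omega>" "z \<in> \<Omega>" "w \<in> \<Omega>" "kobayashi_dist \<Omega> z w < e"
  shows "\<exists>d<e. reach \<Omega> z w d"
proof -
  have "{d. reach \<Omega> z w d} \<noteq> {}" using ex_reach[OF assms(1-3)] by auto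
  then show ?thesis
    using assms(4) cInf_lessD[of "{d. reach \<Omega> z w d}" e]
    by (auto simp: kobayashi_dist_eq_Inf_reach assms)
qed

lemma kobayashi_dist_nonneg: "is_domain \<Omega> \<Longrightarrow> 0 \<le> kobayashi_dist \<Omega> z w"
  using kobayashi_dist_lt_reach[of \<Omega> z w 0] reach_nonneg[of \<Omega> z w]
  by (cases "z \<in> \<Omega> \<and> w \<in> \<Omega>") (force simp: kobayashi_dist_def)+

lemma kobayashi_dist_commute: "kobayashi_dist \<Omega> z w = kobayashi_dist \<Omega> w z"
proof (cases "z \<in> \<Omega> \<and> w \<in> \<Omega>")
  case True
  have "{d. reach \<Omega> z w d} = {d. reach \<Omega> w z d}" using reach_sym by blast
  then show ?thesis using True by (simp add: kobayashi_dist_eq_Inf_reach)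
qed (auto simp: kobayashi_dist_def)

lemma kobayashi_dist_refl: "is_domain \<Omega> \<Longrightarrow> kobayashi_dist \<Omega> z z = 0"
  using kobayashi_dist_le_reach[OF reach_refl, of z \<Omega>] kobayashi_dist_nonneg[of \<Omega> z z]
  by (cases "z \<in> \<Omega>") (auto simp: kobayashi_dist_def[of \<Omega> z z])

lemma kobayashi_dist_triangle:
  assumes "is_domain \<Omega>" "x \<in> \<Omega>" "y \<in> \<Omega>" "z \<in> \<Omega>"
  shows "kobayashi_dist \<Omega> x z \<le> kobayashi_dist \<Omega> x y + kobayashi_dist \<Omega> y z"
proof (rule field_le_epsilon)
  fix e :: real assume "0 < e"
  then obtain d d' where "d < kobayashi_dist \<Omega> x y + e/2" "reach \<Omega> x y d"
    "d' < kobayashi_dist \<Omega> y z + e/2" "reach \<Omega> y z d'"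
    using kobayashi_dist_lt_reach[OF assms(1-3), of "kobayashi_dist \<Omega> x y + e/2"]
      kobayashi_dist_lt_reach[OF assms(1,3,4), of "kobayashi_dist \<Omega> y z + e/2"] by auto
  then show "kobayashi_dist \<Omega> x z \<le> kobayashi_dist \<Omega> x y + kobayashi_dist \<Omega> y z + e"
    using kobayashi_dist_le_reach[OF reach_trans, of \<Omega> y z d' x d] by linarith
qed

lemma kobayashi_dist_mono:
  assumes "is_domain U" "U \<subseteq> \<Omega>" "z \<in> U" "w \<in> U"
  shows "kobayashi_dist \<Omega> z w \<le> kobayashi_dist U z w"
proof (rule field_le_epsilon)
  fix e :: real assume "0 < e"
  then obtain d where "d < kobayashi_dist U z w + e" "reach U z w d"
    using kobayashi_dist_lt_reach[OF assms(1,3,4), of "kobayashi_dist U z w + e"] by auto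
  then show "kobayashi_dist \<Omega> z w \<le> kobayashi_dist U z w + e"
    using kobayashi_dist_le_reach[OF reach_mono[OF _ assms(2)]] by fastforce
qed

lemma kobayashi_dist_le_ball:
  assumes "ball z r \<subseteq> \<Omega>" and "0 < r" and "norm (w - z) \<le> r / 2"
  shows "kobayashi_dist \<Omega> z w \<le> 2 / r * norm (w - z)"
  using reach_ball[OF assms] kobayashi_dist_le_reach[of \<Omega> z w] by fastforce

lemma kobayashi_dist_disc_le:
  assumes "\<phi> \<in> holo_discs \<Omega>" "norm \<zeta> < 1"
  shows "kobayashi_dist \<Omega> (\<phi> 0) (\<phi> \<zeta>) \<le> artanh (norm \<zeta>)"
  using reach_disc_points(1)[OF assms(1) _ assms(2), of 0]
  by (auto dest!: kobayashi_dist_le_reach simp: poincare_dist_def)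

text \<open>Along a compact set the radius of inscribed balls can be chosen uniformly. This controls
  the Kobayashi distance where nothing is known about the speed of a curve.\<close>

lemma kobayashi_dist_locally_lipschitz:
  assumes "is_domain \<Omega>" "compact C" "C \<subseteq> \<Omega>"
  shows "\<exists>r>0. \<exists>L\<ge>0. \<forall>z\<in>C. \<forall>w. norm (w - z) \<le> r \<longrightarrow> w \<in> \<Omega> \<and> kobayashi_dist \<Omega> z w \<le> L * norm (w - z)"
proof -
  obtain r where r: "0 < r" "\<And>x. x \<in> C \<Longrightarrow> ball x r \<subseteq> \<Omega>"
  proof (cases "C = {}")
    case True
    then show ?thesis using that[of 1] by simp
  next
    case False
    obtain e where "0 < e" "(\<Union>x\<in>C. cball x e) \<subseteq> \<Omega>"
      using compact_subset_open_imp_cball_epsilon_subset[OF assms(2)] assms(1,3)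
      unfolding is_domain_def by blast
    then show ?thesis using that[of e] ball_subset_cball by blast
  qed
  have "w \<in> \<Omega> \<and> kobayashi_dist \<Omega> z w \<le> 2 / r * norm (w - z)" if "z \<in> C" "norm (w - z) \<le> r/2" for z w
  proof
    have "w \<in> ball z r" using that r(1) by (auto simp: dist_norm norm_minus_commute)
    then show "w \<in> \<Omega>" using r(2)[OF that(1)] by auto
    show "kobayashi_dist \<Omega> z w \<le> 2 / r * norm (w - z)"
      by (rule kobayashi_dist_le_ball) (use r that in auto)
  qed
  then show ?thesis
    using r(1) by (intro exI[of _ "r/2"] conjI exI[of _ "2/r"]) auto
qed

section \<open>The Kobayashi--Royden metric and curves of bounded speed\<close>

definition royden_disc :: "(complex ^ 'd) set \<Rightarrow> complex ^ 'd \<Rightarrow> complex ^ 'd \<Rightarrow> complex \<Rightarrow> (complex \<Rightarrow> complex ^ 'd) \<Rightarrow> bool"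
  where "royden_disc \<Omega> z v \<alpha> \<phi> \<longleftrightarrow>
    \<phi> \<in> holo_discs \<Omega> \<and> \<phi> 0 = z \<and> (\<forall>i. \<alpha> * deriv (\<lambda>\<zeta>. \<phi> \<zeta> $ i) 0 = v $ i)"

lemma kobayashi_royden_eq: "kobayashi_royden \<Omega> z v = Inf {norm \<alpha> | \<alpha> \<phi>. royden_disc \<Omega> z v \<alpha> \<phi>}"
  by (simp add: kobayashi_royden_def royden_disc_def)

lemma kobayashi_royden_le: "royden_disc \<Omega> z v \<alpha> \<phi> \<Longrightarrow> kobayashi_royden \<Omega> z v \<le> norm \<alpha>"
  unfolding kobayashi_royden_eq by (rule cInf_lower) (auto intro!: bdd_belowI[of _ 0])

lemma ex_royden_disc:
  assumes "open \<Omega>" "z \<in> \<Omega>"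
  shows "\<exists>\<alpha> \<phi>. royden_disc \<Omega> z v \<alpha> \<phi>"
proof -
  obtain r where r: "0 < r" "ball z r \<subseteq> \<Omega>"
    using assms by (auto simp: open_contains_ball)
  \<comment> \<open>The summand 1 covers \<open>v = 0\<close>.\<close>
  define c where "c = r / (norm v + 1)"
  have n: "0 < norm v + 1" by (simp add: add_nonneg_pos)
  have c: "0 < c" using r n by (simp add: c_def)
  have "norm (of_real c *s v) \<le> r"
  proof -
    have "norm (of_real c *s v) = c * norm v" using c by (simp add: norm_vector_scalar_mult)
    also have "\<dots> \<le> c * (norm v + 1)" using c by simp
    also have "\<dots> = r" using n by (simp add: c_def)
    finally show ?thesis .
  qed
  from linear_disc_in_holo_discs[OF r(2,1) this]
  have "(\<lambda>\<zeta>. z + \<zeta> *s (of_real c *s v)) \<in> holo_discs \<Omega>" .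
  moreover have "deriv (\<lambda>\<zeta>. (z + \<zeta> *s (of_real c *s v)) $ i) 0 = of_real c * v $ i" for i
    by (rule DERIV_imp_deriv) (auto intro!: derivative_eq_intros)
  ultimately have "royden_disc \<Omega> z v (inverse (of_real c)) (\<lambda>\<zeta>. z + \<zeta> *s (of_real c *s v))"
    using c by (simp add: royden_disc_def)
  then show ?thesis by blast
qed

lemma kobayashi_royden_less:
  assumes "open \<Omega>" "z \<in> \<Omega>" "kobayashi_royden \<Omega> z v < e"
  shows "\<exists>\<alpha> \<phi>. royden_disc \<Omega> z v \<alpha> \<phi> \<and> norm \<alpha> < e"
  using cInf_lessD[of "{norm \<alpha> | \<alpha> \<phi>. royden_disc \<Omega> z v \<alpha> \<phi>}" e] ex_royden_disc[OF assms(1,2), of v] assms(3)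
  by (auto simp: kobayashi_royden_eq)

lemma kobayashi_royden_greatest:
  assumes "open \<Omega>" "z \<in> \<Omega>" "\<And>\<alpha> \<phi>. royden_disc \<Omega> z v \<alpha> \<phi> \<Longrightarrow> e \<le> norm \<alpha>"
  shows "e \<le> kobayashi_royden \<Omega> z v"
  unfolding kobayashi_royden_eq
  by (rule cInf_greatest) (use ex_royden_disc[OF assms(1,2), of v] assms(3) in auto)

lemma kobayashi_royden_scaleR:
  assumes "open \<Omega>" "z \<in> \<Omega>" "0 < c"
  shows "kobayashi_royden \<Omega> z (c *\<^sub>R v) \<le> c * kobayashi_royden \<Omega> z v"
proof -
  have "kobayashi_royden \<Omega> z (c *\<^sub>R v) / c \<le> norm \<alpha>" if "royden_disc \<Omega> z v \<alpha> \<phi>" for \<alpha> \<phi>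
  proof -
    have "royden_disc \<Omega> z (c *\<^sub>R v) (of_real c * \<alpha>) \<phi>"
      using that by (simp add: royden_disc_def mult.assoc scaleR_conv_of_real[where 'a=complex])
    from kobayashi_royden_le[OF this] show ?thesis using assms(3) by (simp add: norm_mult field_simps)
  qed
  from kobayashi_royden_greatest[OF assms(1,2) this] show ?thesis
    using assms(3) by (simp add: field_simps)
qed

text \<open>Discs do not increase distances, so a disc centred at \<open>z\<close> stays in
  \<open>U\<close> up to Poincare radius \<open>D\<close>. Restricted to Euclidean radius
  \<open>tanh D\<close> and rescaled, it becomes a disc of \<open>U\<close> whose derivative is
  smaller by exactly that factor.\<close>

lemma kobayashi_royden_localization:
  assumes "open \<Omega>" "U \<subseteq> \<Omega>" "z \<in> U" "0 < D" and far: "\<And>w. w \<in> \<Omega> - U \<Longrightarrow> D \<le> kobayashi_dist \<Omega> z w"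
  shows "kobayashi_royden U z v \<le> kobayashi_royden \<Omega> z v / tanh D"
proof -
  have t: "0 < tanh D" "tanh D < 1" using assms by (auto simp: tanh_real_lt_1)
  have "tanh D * kobayashi_royden U z v \<le> norm \<alpha>" if \<phi>: "royden_disc \<Omega> z v \<alpha> \<phi>" for \<alpha> \<phi>
  proof -
    define \<psi> where "\<psi> = (\<lambda>\<zeta>. \<phi> (of_real (tanh D) * \<zeta>))"
    have lt: "norm (of_real (tanh D) * \<zeta>) < tanh D" if "norm \<zeta> < 1" for \<zeta> :: complex
      using that t by (simp add: norm_mult)
    then have lt1: "norm (of_real (tanh D) * \<zeta>) < 1" if "norm \<zeta> < 1" for \<zeta> :: complex
      using that t by fastforce
    have "\<psi> \<in> holo_discs \<Omega>"
      unfolding \<psi>_def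
    proof (rule holo_discs_compose)
      show "\<phi> \<in> holo_discs \<Omega>" using \<phi> by (simp add: royden_disc_def)
      show "(*) (complex_of_real (tanh D)) ` ball 0 1 \<subseteq> ball 0 1" using lt1 by auto
    qed (intro holomorphic_intros)
    moreover have "\<psi> \<zeta> \<in> U" if "norm \<zeta> < 1" for \<zeta>
    proof (rule ccontr)
      assume "\<psi> \<zeta> \<notin> U"
      moreover have "\<psi> \<zeta> \<in> \<Omega>" using that lt1 \<phi> by (auto simp: \<psi>_def royden_disc_def intro: holo_discs_in)
      ultimately have "D \<le> kobayashi_dist \<Omega> z (\<psi> \<zeta>)" using far by auto
      also have "\<dots> \<le> artanh (norm (of_real (tanh D) * \<zeta>))"
        using kobayashi_dist_disc_le[of \<phi> \<Omega> "of_real (tanh D) * \<zeta>"] \<phi> lt1[OF that]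
        by (simp add: \<psi>_def royden_disc_def)
      finally have "tanh D \<le> tanh (artanh (norm (of_real (tanh D) * \<zeta>)))" by simp
      then show False using lt[OF that] lt1[OF that] by (simp add: tanh_artanh_real)
    qed
    ultimately have \<psi>: "\<psi> \<in> holo_discs U" by (auto simp: holo_discs_def)
    have "deriv (\<lambda>\<zeta>. \<psi> \<zeta> $ i) 0 = deriv (\<lambda>\<zeta>. \<phi> \<zeta> $ i) 0 * of_real (tanh D)" for i
      unfolding \<psi>_def
    proof (rule DERIV_imp_deriv, rule DERIV_chain2[where f = "\<lambda>\<zeta>. \<phi> \<zeta> $ i"])
      show "((\<lambda>\<zeta>. \<phi> \<zeta> $ i) has_field_derivative deriv (\<lambda>\<zeta>. \<phi> \<zeta> $ i) 0) (at (of_real (tanh D) * 0))"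
        using holo_discs_deriv[of \<phi> \<Omega> 0 i] \<phi> by (simp add: royden_disc_def)
    qed (auto intro!: derivative_eq_intros)
    then have "royden_disc U z v (\<alpha> / of_real (tanh D)) \<psi>"
      using \<phi> t \<psi> by (auto simp: royden_disc_def) (simp add: \<psi>_def)
    from kobayashi_royden_le[OF this] show ?thesis using t by (simp add: norm_divide field_simps)
  qed
  from kobayashi_royden_greatest[OF assms(1) _ this] assms(2,3) t show ?thesis
    by (auto simp: field_simps)
qed

lemma has_vector_derivative_vec:
  fixes f :: "real \<Rightarrow> 'a::real_normed_vector ^ 'd"
  assumes "\<And>i. ((\<lambda>s. f s $ i) has_vector_derivative v $ i) (at t)"
  shows "(f has_vector_derivative v) (at t)"
  unfolding has_vector_derivative_def has_derivative_at2
proof (intro conjI bounded_linear_scaleR_left vec_tendstoI)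
  fix i
  show "((\<lambda>s. ((1 / norm (s - t)) *\<^sub>R (f s - (f t + (s - t) *\<^sub>R v))) $ i) \<longlongrightarrow> 0 $ i) (at t)"
    using assms[of i] unfolding has_vector_derivative_def has_derivative_at2 by simp
qed

text \<open>A nearly optimal disc supplies a curve \<open>f\<close> tangent to
  \<open>\<sigma>\<close> at \<open>t\<close>. Inside the disc the distance is at most artanh of the
  parameter, hence to first order \<open>norm \<alpha>\<close> times the elapsed time; passing from
  \<open>f s\<close> to \<open>\<sigma> s\<close> costs a Lipschitz multiple of a term of order o(s
  - t).\<close>

lemma kobayashi_dist_le_speed:
  assumes \<Omega>: "is_domain \<Omega>" and \<sigma>t: "\<sigma> t \<in> \<Omega>" and der: "(\<sigma> has_vector_derivative v) (at t)"
    and m: "kobayashi_royden \<Omega> (\<sigma> t) v < m"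
  shows "\<exists>d>0. \<forall>s. \<bar>s - t\<bar> < d \<longrightarrow> \<sigma> s \<in> \<Omega> \<and> kobayashi_dist \<Omega> (\<sigma> t) (\<sigma> s) \<le> m * \<bar>s - t\<bar>"
proof -
  have op: "open \<Omega>" using \<Omega> by (simp add: is_domain_def)
  obtain \<alpha> \<phi> where \<phi>: "royden_disc \<Omega> (\<sigma> t) v \<alpha> \<phi>" and \<alpha>: "norm \<alpha> < m"
    using kobayashi_royden_less[OF op \<sigma>t m] by blast
  have h\<phi>: "\<phi> \<in> holo_discs \<Omega>" and \<phi>0: "\<phi> 0 = \<sigma> t" using \<phi> by (auto simp: royden_disc_def)
  \<comment> \<open>Half of this surplus pays for the second-order term of artanh, the other half
    for the gap between the two curves.\<close>
  define e where "e = m - norm \<alpha>"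
  have e: "0 < e" using \<alpha> by (simp add: e_def)
  define f where "f s = \<phi> (of_real (s - t) * \<alpha>)" for s
  have ft: "f t = \<sigma> t" by (simp add: f_def \<phi>0)
  have fd: "(f has_vector_derivative v) (at t)"
  proof -
    have "((\<lambda>s. f s $ i) has_vector_derivative v $ i) (at t)" for i
    proof -
      have "((\<lambda>\<zeta>. \<phi> \<zeta> $ i) has_field_derivative deriv (\<lambda>\<zeta>. \<phi> \<zeta> $ i) 0) (at (of_real (t - t) * \<alpha>))"
        using holo_discs_deriv[OF h\<phi>, of 0 i] by simp
      moreover have "((\<lambda>s. of_real (s - t) * \<alpha>) has_vector_derivative \<alpha>) (at t)"
        by (auto intro!: derivative_eq_intros)
      ultimately have "((\<lambda>s. \<phi> (of_real (s - t) * \<alpha>) $ i) has_vector_derivative (\<alpha> * deriv (\<lambda>\<zeta>. \<phi> \<zeta> $ i) 0)) (at t)"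
        using field_vector_diff_chain_at[of "\<lambda>s. of_real (s - t) * \<alpha>" \<alpha> t "\<lambda>\<zeta>. \<phi> \<zeta> $ i"] by (simp add: o_def)
      then show ?thesis using \<phi> by (simp add: f_def royden_disc_def)
    qed
    then show ?thesis by (rule has_vector_derivative_vec)
  qed
  obtain \<rho> where \<rho>: "0 < \<rho>" "cball (\<sigma> t) \<rho> \<subseteq> \<Omega>"
    using op \<sigma>t by (auto simp: open_contains_cball)
  obtain r L where r: "0 < r" "0 \<le> L"
    and L: "\<And>z w. z \<in> cball (\<sigma> t) \<rho> \<Longrightarrow> norm (w - z) \<le> r \<Longrightarrow> w \<in> \<Omega> \<and> kobayashi_dist \<Omega> z w \<le> L * norm (w - z)"
    using kobayashi_dist_locally_lipschitz[OF \<Omega> compact_cball \<rho>(2)] by blast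
  have "((\<lambda>s. \<sigma> s - f s) has_vector_derivative v - v) (at t)"
    by (intro derivative_intros der fd)
  then have "\<exists>d>0. \<forall>s. norm (s - t) < d \<longrightarrow> norm ((\<sigma> s - f s) - (\<sigma> t - f t) - (s - t) *\<^sub>R (v - v)) \<le> e / (2 * (L + 1)) * norm (s - t)"
    using e r(2) unfolding has_vector_derivative_def has_derivative_at_alt
    by (elim conjE allE[of _ "e / (2 * (L + 1))"]) simp
  then obtain d1 where d1: "0 < d1"
    "\<And>s. \<bar>s - t\<bar> < d1 \<Longrightarrow> norm (\<sigma> s - f s) \<le> e / (2 * (L + 1)) * \<bar>s - t\<bar>"
    by (auto simp: ft)
  have "isCont f t" using fd by (rule has_vector_derivative_continuous)
  then obtain d2 where d2: "0 < d2" "\<And>s. \<bar>s - t\<bar> < d2 \<Longrightarrow> f s \<in> cball (\<sigma> t) \<rho>"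
    using \<rho>(1) unfolding continuous_at_eps_delta ft by (fastforce simp: dist_norm norm_minus_commute)
  \<comment> \<open>In order: \<open>\<sigma>\<close> and \<open>f\<close> agree to first order;
    \<open>f s\<close> stays in the compact ball; \<open>\<sigma> s\<close> is within Lipschitz
    range \<open>r\<close> of \<open>f s\<close>; the disc parameter is at most 1/2; its square is
    at most \<open>e / 2\<close> times the elapsed time.\<close>
  define d where "d = Min {d1, d2, r / (e / (2 * (L + 1)) + 1), 1 / (2 * (norm \<alpha> + 1)), e / (2 * ((norm \<alpha>)\<^sup>2 + 1))}"
  have q: "0 < e / (2 * (L + 1)) + 1" using e r(2) by (auto intro!: add_nonneg_pos)
  have n: "0 < norm \<alpha> + 1" "0 < (norm \<alpha>)\<^sup>2 + 1" by (auto intro!: add_nonneg_pos)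
  have d: "0 < d" using d1(1) d2(1) r q e n by (simp add: d_def)
  show ?thesis
  proof (intro exI[of _ d] conjI allI impI)
    fix s assume "\<bar>s - t\<bar> < d"
    then have s: "\<bar>s - t\<bar> < d1" "\<bar>s - t\<bar> < d2" "\<bar>s - t\<bar> < r / (e / (2 * (L + 1)) + 1)"
      "\<bar>s - t\<bar> < 1 / (2 * (norm \<alpha> + 1))" "\<bar>s - t\<bar> < e / (2 * ((norm \<alpha>)\<^sup>2 + 1))"
      by (auto simp: d_def)
    have sr: "norm (\<sigma> s - f s) \<le> r"
    proof -
      have "norm (\<sigma> s - f s) \<le> (e / (2 * (L + 1)) + 1) * \<bar>s - t\<bar>"
        using d1(2)[OF s(1)] by (simp add: algebra_simps)
      also have "\<dots> \<le> r" using s(3) q by (simp add: field_simps)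
      finally show ?thesis .
    qed
    from L[OF d2(2)[OF s(2)] sr] have \<sigma>s: "\<sigma> s \<in> \<Omega>"
      and k1: "kobayashi_dist \<Omega> (f s) (\<sigma> s) \<le> L * norm (\<sigma> s - f s)" by auto
    have "L * norm (\<sigma> s - f s) \<le> (L + 1) * (e / (2 * (L + 1)) * \<bar>s - t\<bar>)"
      using d1(2)[OF s(1)] r(2) by (intro mult_mono) auto
    also have "\<dots> = e / 2 * \<bar>s - t\<bar>" using r(2) by (simp add: field_simps)
    finally have k1': "kobayashi_dist \<Omega> (f s) (\<sigma> s) \<le> e / 2 * \<bar>s - t\<bar>" using k1 by simp
    define x where "x = norm \<alpha> * \<bar>s - t\<bar>"
    have "x \<le> (norm \<alpha> + 1) * \<bar>s - t\<bar>" by (simp add: x_def algebra_simps)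
    also have "\<dots> \<le> 1/2" using s(4) n by (simp add: field_simps)
    finally have x: "0 \<le> x" "x \<le> 1/2" by (auto simp: x_def)
    have nx: "norm (of_real (s - t) * \<alpha>) = x" by (simp add: x_def norm_mult del: of_real_diff)
    have "kobayashi_dist \<Omega> (\<sigma> t) (f s) \<le> artanh x"
      using kobayashi_dist_disc_le[OF h\<phi>, of "of_real (s - t) * \<alpha>"] x \<phi>0 unfolding nx f_def by simp
    also have "\<dots> \<le> x + x\<^sup>2" by (rule artanh_bounds(1)[OF x])
    also have "x\<^sup>2 = ((norm \<alpha>)\<^sup>2 * \<bar>s - t\<bar>) * \<bar>s - t\<bar>" by (simp add: x_def power2_eq_square algebra_simps)
    also have "\<dots> \<le> e / 2 * \<bar>s - t\<bar>"
    proof (rule mult_right_mono)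
      have "(norm \<alpha>)\<^sup>2 * \<bar>s - t\<bar> \<le> ((norm \<alpha>)\<^sup>2 + 1) * \<bar>s - t\<bar>" by (simp add: algebra_simps)
      also have "\<dots> \<le> e / 2" using s(5) n by (simp add: field_simps)
      finally show "(norm \<alpha>)\<^sup>2 * \<bar>s - t\<bar> \<le> e / 2" .
    qed auto
    finally have k2: "kobayashi_dist \<Omega> (\<sigma> t) (f s) \<le> x + e / 2 * \<bar>s - t\<bar>" by simp
    have "f s \<in> \<Omega>" using d2(2)[OF s(2)] \<rho>(2) by auto
    from kobayashi_dist_triangle[OF \<Omega> \<sigma>t this \<sigma>s] k1' k2
    have "kobayashi_dist \<Omega> (\<sigma> t) (\<sigma> s) \<le> x + e / 2 * \<bar>s - t\<bar> + e / 2 * \<bar>s - t\<bar>" by linarith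
    also have "\<dots> = m * \<bar>s - t\<bar>" by (simp add: x_def e_def algebra_simps)
    finally show "kobayashi_dist \<Omega> (\<sigma> t) (\<sigma> s) \<le> m * \<bar>s - t\<bar>" .
    show "\<sigma> s \<in> \<Omega>" by (rule \<sigma>s)
  qed (rule d)
qed

section \<open>Absolutely continuous curves\<close>

lemma abs_continuous_on_subset: "abs_continuous_on I f \<Longrightarrow> J \<subseteq> I \<Longrightarrow> abs_continuous_on J f"
  unfolding abs_continuous_on_def by (meson subsetD)

text \<open>Enumerating a finite index set frees the condition from initial segments of the
  naturals, so that it applies directly to the members of a tagged division.\<close>

lemma abs_continuous_onD:
  assumes "abs_continuous_on I f" "0 < e"
  shows "\<exists>d>0. \<forall>(F :: 'i set) a b. finite F \<longrightarrow> (\<forall>i\<in>F. a i \<in> I \<and> b i \<in> I \<and> a i \<le> b i) \<longrightarrow>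
      disjoint_family_on (\<lambda>i. {a i<..<b i}) F \<longrightarrow> (\<Sum>i\<in>F. b i - a i) < d
      \<longrightarrow> (\<Sum>i\<in>F. norm (f (b i) - f (a i))) < e"
proof -
  obtain d where d: "0 < d" "\<And>(n::nat) a b. \<lbrakk>\<forall>i<n. a i \<in> I \<and> b i \<in> I \<and> a i \<le> b i;
      disjoint_family_on (\<lambda>i. {a i<..<b i}) {..<n}; (\<Sum>i<n. b i - a i) < d\<rbrakk>
      \<Longrightarrow> (\<Sum>i<n. norm (f (b i) - f (a i))) < e"
    using assms(1)[unfolded abs_continuous_on_def, rule_format, OF assms(2)] by (elim exE conjE) blast
  show ?thesis
  proof (intro exI[of _ d] conjI[OF d(1)] allI impI)
    fix F :: "'i set" and a b :: "'i \<Rightarrow> real"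
    assume F: "finite F" "\<forall>i\<in>F. a i \<in> I \<and> b i \<in> I \<and> a i \<le> b i"
      "disjoint_family_on (\<lambda>i. {a i<..<b i}) F" "(\<Sum>i\<in>F. b i - a i) < d"
    obtain h where h: "bij_betw h {..<card F} F"
      using ex_bij_betw_nat_finite[OF F(1)] by (auto simp: atLeast0LessThan)
    have "(\<Sum>i<card F. norm (f (b (h i)) - f (a (h i)))) < e"
    proof (rule d(2))
      show "\<forall>i<card F. a (h i) \<in> I \<and> b (h i) \<in> I \<and> a (h i) \<le> b (h i)"
        using F(2) bij_betwE[OF h] by auto
      show "disjoint_family_on (\<lambda>i. {a (h i)<..<b (h i)}) {..<card F}"
        using F(3) bij_betwE[OF h] bij_betw_imp_inj_on[OF h]
        unfolding disjoint_family_on_def inj_on_def by blast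
      show "(\<Sum>i<card F. b (h i) - a (h i)) < d"
        using F(4) sum.reindex_bij_betw[OF h, of "\<lambda>i. b i - a i"] by simp
    qed
    then show "(\<Sum>i\<in>F. norm (f (b i) - f (a i))) < e"
      using sum.reindex_bij_betw[OF h, of "\<lambda>i. norm (f (b i) - f (a i))"] by simp
  qed
qed

lemma abs_continuous_on_imp_continuous_on:
  assumes "abs_continuous_on I f"
  shows "continuous_on I f"
  unfolding continuous_on_iff
proof safe
  fix x e :: real assume "x \<in> I" "0 < e"
  from abs_continuous_onD[OF assms \<open>0 < e\<close>, where 'i = unit] obtain d where d: "0 < d"
    and d2: "\<forall>(F :: unit set) a b. finite F \<longrightarrow> (\<forall>i\<in>F. a i \<in> I \<and> b i \<in> I \<and> a i \<le> b i) \<longrightarrow>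
      disjoint_family_on (\<lambda>i. {a i<..<b i}) F \<longrightarrow> (\<Sum>i\<in>F. b i - a i) < d
      \<longrightarrow> (\<Sum>i\<in>F. norm (f (b i) - f (a i))) < e" by (elim exE conjE)
  have "dist (f y) (f x) < e" if "y \<in> I" "dist y x < d" for y
    using d2[rule_format, of "{()}" "\<lambda>_. x" "\<lambda>_. y"] d2[rule_format, of "{()}" "\<lambda>_. y" "\<lambda>_. x"]
      that \<open>x \<in> I\<close>
    by (cases "x \<le> y") (simp_all add: dist_norm disjoint_family_on_def norm_minus_commute)
  then show "\<exists>d>0. \<forall>y\<in>I. dist y x < d \<longrightarrow> dist (f y) (f x) < e" using d by blast
qed

lemma lipschitz_on_imp_abs_continuous_on:
  assumes "L-lipschitz_on I f"
  shows "abs_continuous_on I f"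
  unfolding abs_continuous_on_def
proof (intro allI impI)
  fix e :: real assume e: "0 < e"
  have L: "0 \<le> L" using lipschitz_on_nonneg[OF assms] .
  show "\<exists>d>0. \<forall>(n::nat) a b. (\<forall>i<n. a i \<in> I \<and> b i \<in> I \<and> a i \<le> b i) \<and>
        disjoint_family_on (\<lambda>i. {a i <..< b i}) {..<n} \<and> (\<Sum>i<n. b i - a i) < d \<longrightarrow>
        (\<Sum>i<n. norm (f (b i) - f (a i))) < e"
  proof (intro exI[of _ "e / (L + 1)"] conjI allI impI, goal_cases)
    case 1
    then show ?case using e L by simp
  next
    case (2 n a b)
    have "(\<Sum>i<n. norm (f (b i) - f (a i))) \<le> (\<Sum>i<n. L * (b i - a i))"
    proof (rule sum_mono)
      fix i assume "i \<in> {..<n}"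
      then show "norm (f (b i) - f (a i)) \<le> L * (b i - a i)"
        using 2 lipschitz_onD[OF assms, of "b i" "a i"] by (auto simp: dist_norm)
    qed
    also have "\<dots> \<le> (L + 1) * (\<Sum>i<n. b i - a i)"
      unfolding sum_distrib_left using 2 L by (intro sum_mono mult_right_mono) auto
    also have "\<dots> < (L + 1) * (e / (L + 1))" using 2 L by (intro mult_strict_left_mono) auto
    also have "\<dots> = e" using L by simp
    finally show ?case .
  qed
qed

text \<open>A nondecreasing 1-Lipschitz change of time keeps disjoint intervals disjoint and does
  not lengthen them, so the same \<open>d\<close> works. It is meant for the inverse of the
  reparametrization below.\<close>

lemma abs_continuous_on_compose_mono:
  assumes f: "abs_continuous_on I f" and g: "\<And>x y. x \<in> J \<Longrightarrow> y \<in> J \<Longrightarrow> x \<le> y \<Longrightarrow> g x \<le> g y \<and> g y - g x \<le> y - x"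
    and J: "g ` J \<subseteq> I"
  shows "abs_continuous_on J (\<lambda>x. f (g x))"
  unfolding abs_continuous_on_def
proof (intro allI impI)
  fix e :: real assume e: "0 < e"
  then obtain d where d: "0 < d" "\<And>(n::nat) a b. \<lbrakk>\<forall>i<n. a i \<in> I \<and> b i \<in> I \<and> a i \<le> b i;
      disjoint_family_on (\<lambda>i. {a i<..<b i}) {..<n}; (\<Sum>i<n. b i - a i) < d\<rbrakk>
      \<Longrightarrow> (\<Sum>i<n. norm (f (b i) - f (a i))) < e"
    using f[unfolded abs_continuous_on_def, rule_format, OF e] by (elim exE conjE) blast
  show "\<exists>d>0. \<forall>(n::nat) a b. (\<forall>i<n. a i \<in> J \<and> b i \<in> J \<and> a i \<le> b i) \<and>
        disjoint_family_on (\<lambda>i. {a i <..< b i}) {..<n} \<and> (\<Sum>i<n. b i - a i) < d \<longrightarrow>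
        (\<Sum>i<n. norm (f (g (b i)) - f (g (a i)))) < e"
  proof (rule exI[of _ d], intro conjI[OF d(1)] allI impI)
    fix n :: nat and a b :: "nat \<Rightarrow> real"
    assume *: "(\<forall>i<n. a i \<in> J \<and> b i \<in> J \<and> a i \<le> b i) \<and>
        disjoint_family_on (\<lambda>i. {a i <..< b i}) {..<n} \<and> (\<Sum>i<n. b i - a i) < d"
    show "(\<Sum>i<n. norm (f (g (b i)) - f (g (a i)))) < e"
    proof (rule d(2))
      show "\<forall>i<n. g (a i) \<in> I \<and> g (b i) \<in> I \<and> g (a i) \<le> g (b i)"
        using * J g by (auto simp: image_subset_iff)
      have "{g (a i)<..<g (b i)} \<inter> {g (a j)<..<g (b j)} = {}" if "i < n" "j < n" "i \<noteq> j" for i j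
      proof -
        have ab: "a i \<in> J" "b i \<in> J" "a j \<in> J" "b j \<in> J" "a i \<le> b i" "a j \<le> b j" using * that by auto
        have "{a i<..<b i} \<inter> {a j<..<b j} = {}"
          using * that by (auto simp: disjoint_family_on_def)
        \<comment> \<open>Disjoint open intervals are ordered unless one of them is degenerate; that
          case must be kept because \<open>a i = b i\<close> is allowed.\<close>
        then have "\<not> max (a i) (a j) < min (b i) (b j)"
          using dense[of "max (a i) (a j)" "min (b i) (b j)"] by fastforce
        then consider "b i \<le> a j" | "b j \<le> a i" | "a i = b i" | "a j = b j"
          using ab by linarith
        then have "g (b i) \<le> g (a j) \<or> g (b j) \<le> g (a i) \<or> g (a i) = g (b i) \<or> g (a j) = g (b j)"
          using g ab by cases auto
        then show ?thesis by auto
      qed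
      then show "disjoint_family_on (\<lambda>i. {g (a i)<..<g (b i)}) {..<n}"
        by (auto simp: disjoint_family_on_def)
      have "(\<Sum>i<n. g (b i) - g (a i)) \<le> (\<Sum>i<n. b i - a i)"
        using * g by (intro sum_mono) auto
      then show "(\<Sum>i<n. g (b i) - g (a i)) < d" using * by linarith
    qed
  qed
qed

text \<open>The exceptional null set may always be enlarged by the endpoints, so the derivative is only
  prescribed at interior points.\<close>
definition speed_le :: "(complex ^ 'd) set \<Rightarrow> (real \<Rightarrow> real) \<Rightarrow> real \<Rightarrow> real \<Rightarrow> (real \<Rightarrow> complex ^ 'd) \<Rightarrow> bool"
  where "speed_le \<Omega> m a b \<sigma> \<longleftrightarrow> \<sigma> ` {a..b} \<subseteq> \<Omega> \<and> abs_continuous_on {a..b} \<sigma> \<and>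
    (\<exists>N. negligible N \<and> (\<forall>t\<in>{a<..<b} - N. \<exists>v. (\<sigma> has_vector_derivative v) (at t) \<and>
       kobayashi_royden \<Omega> (\<sigma> t) v \<le> m t))"

lemma speed_le_subinterval:
  assumes "speed_le \<Omega> m a b \<sigma>" "a \<le> a'" "b' \<le> b"
  shows "speed_le \<Omega> m a' b' \<sigma>"
proof -
  have "{a'..b'} \<subseteq> {a..b}" "{a'<..<b'} \<subseteq> {a<..<b}" using assms by auto
  then show ?thesis
    using assms(1) abs_continuous_on_subset[of "{a..b}" \<sigma> "{a'..b'}"] unfolding speed_le_def
    by (intro conjI) (blast | fast)+
qed

text \<open>The function \<open>t \<mapsto> k (\<sigma> a) (\<sigma> t)\<close> need not be differentiable.  Its increments are summed over a gauge-fine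
  division: intervals tagged at good points obey the speed bound, the others have small total length and
  are controlled by absolute continuity.\<close>
lemma kobayashi_dist_le_of_speed_le:
  assumes \<Omega>: "is_domain \<Omega>" and sp: "speed_le \<Omega> (\<lambda>_. m) a b \<sigma>" and ab: "a \<le> b" and m: "0 \<le> m"
  shows "kobayashi_dist \<Omega> (\<sigma> a) (\<sigma> b) \<le> m * (b - a)"
proof -
  have \<sigma>: "\<sigma> ` {a..b} \<subseteq> \<Omega>" and ac: "abs_continuous_on {a..b} \<sigma>"
    using sp by (auto simp: speed_le_def)
  obtain N0 where N0: "negligible N0" "\<And>t. t \<in> {a<..<b} - N0 \<Longrightarrow>
      \<exists>v. (\<sigma> has_vector_derivative v) (at t) \<and> kobayashi_royden \<Omega> (\<sigma> t) v \<le> m"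
    using sp by (auto simp: speed_le_def)
  \<comment> \<open>Speed is prescribed at interior points only, so the endpoints count as
    bad.\<close>
  define N where "N = N0 \<union> {a, b}"
  have N: "negligible N" using N0(1) by (simp add: N_def)
  have "compact (\<sigma> ` {a..b})"
    using abs_continuous_on_imp_continuous_on[OF ac] by (intro compact_continuous_image) auto
  from kobayashi_dist_locally_lipschitz[OF \<Omega> this \<sigma>] obtain r L where r: "0 < r" "0 \<le> L"
    and L: "\<And>z w. z \<in> \<sigma> ` {a..b} \<Longrightarrow> norm (w - z) \<le> r \<Longrightarrow> kobayashi_dist \<Omega> z w \<le> L * norm (w - z)"
    by blast
  have main: "kobayashi_dist \<Omega> (\<sigma> a) (\<sigma> b) \<le> (m + e) * (b - a) + e" if e: "0 < e" for e
  proof -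
    \<comment> \<open>At most \<open>r\<close>, so that the Lipschitz bound applies to every single
      bad interval; at most \<open>e / (L + 1)\<close>, so that all of them together contribute at
      most \<open>e\<close>.\<close>
    define e' where "e' = min r (e / (L + 1))"
    have e': "0 < e'" "e' \<le> r" "L * e' \<le> e"
    proof -
      show "0 < e'" "e' \<le> r" using r e by (auto simp: e'_def)
      have "L * e' \<le> (L + 1) * (e / (L + 1))" using r e by (intro mult_mono) (auto simp: e'_def)
      then show "L * e' \<le> e" using r by simp
    qed
    from abs_continuous_onD[OF ac e'(1), where 'i = "real \<times> real set"] obtain d where d: "0 < d"
      and d2: "\<forall>(F :: (real \<times> real set) set) a' b'. finite F \<longrightarrow> (\<forall>i\<in>F. a' i \<in> {a..b} \<and> b' i \<in> {a..b} \<and> a' i \<le> b' i) \<longrightarrow>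
        disjoint_family_on (\<lambda>i. {a' i<..<b' i}) F \<longrightarrow> (\<Sum>i\<in>F. b' i - a' i) < d
        \<longrightarrow> (\<Sum>i\<in>F. norm (\<sigma> (b' i) - \<sigma> (a' i))) < e'" by (elim exE conjE)
    \<comment> \<open>The gauge will force intervals tagged at bad points into this open set, whose
      measure is below the modulus \<open>d\<close> of absolute continuity.\<close>
    obtain T where T: "open T" "N \<subseteq> T" "T - N \<in> lmeasurable" "emeasure lebesgue (T - N) < ennreal d"
      using sets_lebesgue_outer_open[OF _ d, of N] N negligible_imp_sets by blast
    have T': "T \<in> lmeasurable" "measure lebesgue T < d"
    proof -
      have Nm: "N \<in> lmeasurable" "measure lebesgue N = 0"
        using N by (auto simp: negligible_iff_measure)
      have eq: "T = (T - N) \<union> N" using T(2) by blast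
      show "T \<in> lmeasurable" using fmeasurable.Un[OF T(3) Nm(1)] eq by simp
      have "measure lebesgue T \<le> measure lebesgue (T - N) + measure lebesgue N"
        using measure_Un_le[of "T - N" lebesgue N] T(3) Nm(1) eq by (auto dest: fmeasurableD)
      also have "\<dots> < d" using T(3,4) Nm(2) d by (simp add: emeasure_eq_measure2 ennreal_less_iff)
      finally show "measure lebesgue T < d" .
    qed
    have "\<exists>\<delta>>0. \<forall>s. \<bar>s - t\<bar> < \<delta> \<longrightarrow> \<sigma> s \<in> \<Omega> \<and> kobayashi_dist \<Omega> (\<sigma> t) (\<sigma> s) \<le> (m + e) * \<bar>s - t\<bar>"
      if "t \<in> {a..b} - N" for t
    proof -
      have t: "t \<in> {a<..<b} - N0" using that by (auto simp: N_def)
      then obtain v where v: "(\<sigma> has_vector_derivative v) (at t)" "kobayashi_royden \<Omega> (\<sigma> t) v \<le> m"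
        using N0(2) by blast
      then show ?thesis
        using t \<sigma> e by (intro kobayashi_dist_le_speed[OF \<Omega> _ v(1)]) auto
    qed
    then obtain \<delta> where \<delta>: "\<And>t. t \<in> {a..b} - N \<Longrightarrow> 0 < \<delta> t"
      "\<And>t s. t \<in> {a..b} - N \<Longrightarrow> \<bar>s - t\<bar> < \<delta> t \<Longrightarrow> kobayashi_dist \<Omega> (\<sigma> t) (\<sigma> s) \<le> (m + e) * \<bar>s - t\<bar>"
      by metis
    define G where "G t = (if t \<in> N then T else if t \<in> {a..b} then ball t (\<delta> t) else ball t 1)" for t
    have "gauge G" using T(1,2) \<delta>(1) by (auto simp: gauge_def G_def)
    then obtain p where p: "p tagged_division_of {a..b}" "G fine p"
      using fine_division_exists_real by blast
    have fin: "finite p" using p(1) by (rule tagged_division_of_finite)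
    have K: "\<exists>u v. K = {u..v} \<and> Inf K = u \<and> Sup K = v \<and> a \<le> u \<and> u \<le> x \<and> x \<le> v \<and> v \<le> b" if xK: "(x, K) \<in> p" for x K
    proof -
      obtain u v where uv: "K = {u..v}" using tagged_division_ofD(4)[OF p(1) xK] by auto
      moreover have "x \<in> K" "K \<subseteq> {a..b}" using tagged_division_ofD(2,3)[OF p(1) xK] by auto
      ultimately show ?thesis by (intro exI[of _ u] exI[of _ v]) auto
    qed
    \<comment> \<open>The increments of \<open>g\<close> telescope over the division, and by the
      triangle inequality each is at most the distance between the images of the two ends of its
      interval.\<close>
    define g where "g t = kobayashi_dist \<Omega> (\<sigma> a) (\<sigma> t)" for t
    have g: "g v - g u \<le> kobayashi_dist \<Omega> (\<sigma> u) (\<sigma> v)" if "u \<in> {a..b}" "v \<in> {a..b}" for u v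
      using kobayashi_dist_triangle[OF \<Omega>, of "\<sigma> a" "\<sigma> u" "\<sigma> v"] \<sigma> that ab by (simp add: g_def image_subset_iff)
    define B where "B = {(x, K) \<in> p. x \<in> N}"
    have B: "B \<subseteq> p" "finite B" using fin by (auto simp: B_def intro: finite_subset)
    \<comment> \<open>Both ends of the interval are compared with the tag, where the local speed
      bound holds.\<close>
    have good: "g (Sup K) - g (Inf K) \<le> (m + e) * (Sup K - Inf K)" if xK: "(x, K) \<in> p - B" for x K
    proof -
      obtain u v where uv: "K = {u..v}" "Inf K = u" "Sup K = v" "a \<le> u" "u \<le> x" "x \<le> v" "v \<le> b"
        using K[of x K] xK by blast
      have x: "x \<in> {a..b} - N" using xK uv by (auto simp: B_def)
      have "K \<subseteq> G x" using p(2) xK by (auto simp: fine_def)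
      moreover have "u \<in> K" "v \<in> K" using uv by auto
      ultimately have "u \<in> ball x (\<delta> x)" "v \<in> ball x (\<delta> x)" using x by (auto simp: G_def)
      then have "\<bar>u - x\<bar> < \<delta> x" "\<bar>v - x\<bar> < \<delta> x" by (auto simp: dist_real_def abs_minus_commute)
      from \<delta>(2)[OF x this(1)] \<delta>(2)[OF x this(2)]
      have "kobayashi_dist \<Omega> (\<sigma> u) (\<sigma> x) \<le> (m + e) * (x - u)" "kobayashi_dist \<Omega> (\<sigma> x) (\<sigma> v) \<le> (m + e) * (v - x)"
        using uv by (auto simp: kobayashi_dist_commute)
      moreover have "kobayashi_dist \<Omega> (\<sigma> u) (\<sigma> v) \<le> kobayashi_dist \<Omega> (\<sigma> u) (\<sigma> x) + kobayashi_dist \<Omega> (\<sigma> x) (\<sigma> v)"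
        using \<sigma> uv by (intro kobayashi_dist_triangle[OF \<Omega>]) auto
      ultimately have "kobayashi_dist \<Omega> (\<sigma> u) (\<sigma> v) \<le> (m + e) * (v - u)" by (simp add: algebra_simps)
      then show ?thesis using g[of u v] uv by auto
    qed
    have KBI: "Inf (snd i) \<in> {a..b} \<and> Sup (snd i) \<in> {a..b} \<and> Inf (snd i) \<le> Sup (snd i)"
        "{Inf (snd i)<..<Sup (snd i)} = interior (snd i)" if i: "i \<in> p" for i
    proof -
      have "(fst i, snd i) \<in> p" using i by simp
      from K[OF this] obtain u v where uv: "snd i = {u..v}" "Inf (snd i) = u" "Sup (snd i) = v"
        "a \<le> u" "u \<le> fst i" "fst i \<le> v" "v \<le> b" by blast
      show "Inf (snd i) \<in> {a..b} \<and> Sup (snd i) \<in> {a..b} \<and> Inf (snd i) \<le> Sup (snd i)"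
        unfolding uv(2,3) using uv(4-7) by simp
      show "{Inf (snd i)<..<Sup (snd i)} = interior (snd i)"
        unfolding uv(2,3) by (simp add: uv(1) interior_atLeastAtMost_real)
    qed
    note KB = KBI(1) and KI = KBI(2)
    have disj: "disjoint_family_on (\<lambda>i. {Inf (snd i)<..<Sup (snd i)}) B"
      unfolding disjoint_family_on_def
    proof (intro ballI impI)
      fix i j assume ij: "i \<in> B" "j \<in> B" "i \<noteq> j"
      then have p: "i \<in> p" "j \<in> p" using B(1) by auto
      show "{Inf (snd i)<..<Sup (snd i)} \<inter> {Inf (snd j)<..<Sup (snd j)} = {}"
        unfolding KI[OF p(1)] KI[OF p(2)]
        by (rule tagged_division_ofD(5)[OF \<open>p tagged_division_of {a..b}\<close>, of "fst i" "snd i" "fst j" "snd j"])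
           (use p ij(3) in \<open>auto simp: prod_eq_iff\<close>)
    qed
    have small: "(\<Sum>i\<in>B. Sup (snd i) - Inf (snd i)) < d"
    proof -
      have "measure lebesgue {Inf (snd i)<..<Sup (snd i)} = Sup (snd i) - Inf (snd i)" if "i \<in> B" for i
        using KB[of i] subsetD[OF B(1) that] by (simp add: measure_completion)
      then have "(\<Sum>i\<in>B. Sup (snd i) - Inf (snd i)) = (\<Sum>i\<in>B. measure lebesgue {Inf (snd i)<..<Sup (snd i)})"
        by simp
      also have "\<dots> = measure lebesgue (\<Union>i\<in>B. {Inf (snd i)<..<Sup (snd i)})"
      proof (rule measure_finite_Union[symmetric, OF B(2) _ disj])
        fix i assume "i \<in> B"
        then show "emeasure lebesgue {Inf (snd i)<..<Sup (snd i)} \<noteq> \<infinity>"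
          using KB[of i] subsetD[OF B(1), of i] by simp
      qed auto
      also have "\<dots> \<le> measure lebesgue T"
      proof (rule measure_mono_fmeasurable)
        show "(\<Union>i\<in>B. {Inf (snd i)<..<Sup (snd i)}) \<subseteq> T"
        proof safe
          fix x K y assume *: "(x, K) \<in> B" "y \<in> {Inf (snd (x, K))<..<Sup (snd (x, K))}"
          then have xN: "(x, K) \<in> p" "x \<in> N" by (auto simp: B_def)
          from xN(1) have "K \<subseteq> G x" using p(2) by (auto simp: fine_def)
          with xN(2) have "K \<subseteq> T" by (simp add: G_def)
          moreover have "y \<in> interior K" using *(2) unfolding KI[OF xN(1)] by simp
          ultimately show "y \<in> T" using interior_subset[of K] by blast
        qed
      qed (use T' B in auto)
      finally show ?thesis using T'(2) by simp
    qed
    have ACB: "(\<Sum>i\<in>B. norm (\<sigma> (Sup (snd i)) - \<sigma> (Inf (snd i)))) < e'"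
      using KB B(1) by (intro d2[rule_format, OF B(2) _ disj small]) auto
    have bad: "g (Sup (snd i)) - g (Inf (snd i)) \<le> L * norm (\<sigma> (Sup (snd i)) - \<sigma> (Inf (snd i)))" if "i \<in> B" for i
    proof -
      have i: "Inf (snd i) \<in> {a..b}" "Sup (snd i) \<in> {a..b}" using KB[of i] that B by auto
      have "norm (\<sigma> (Sup (snd i)) - \<sigma> (Inf (snd i))) \<le> (\<Sum>i\<in>B. norm (\<sigma> (Sup (snd i)) - \<sigma> (Inf (snd i))))"
        using that B(2) by (intro member_le_sum) auto
      then have "norm (\<sigma> (Sup (snd i)) - \<sigma> (Inf (snd i))) \<le> r" using ACB e' by linarith
      from L[OF _ this] g[OF i] i show ?thesis by force
    qed
    have "g b - g a = (\<Sum>i\<in>p. g (Sup (snd i)) - g (Inf (snd i)))"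
      using additive_tagged_division_1[OF ab p(1), of g] by (simp add: case_prod_unfold)
    also have "\<dots> = (\<Sum>i\<in>B. g (Sup (snd i)) - g (Inf (snd i))) + (\<Sum>i\<in>p - B. g (Sup (snd i)) - g (Inf (snd i)))"
      using sum.subset_diff[OF B(1) fin] by (simp add: add.commute)
    also have "(\<Sum>i\<in>B. g (Sup (snd i)) - g (Inf (snd i))) \<le> L * (\<Sum>i\<in>B. norm (\<sigma> (Sup (snd i)) - \<sigma> (Inf (snd i))))"
      unfolding sum_distrib_left by (intro sum_mono bad)
    also have "\<dots> \<le> L * e'" using ACB r by (intro mult_left_mono) auto
    also have "(\<Sum>i\<in>p - B. g (Sup (snd i)) - g (Inf (snd i))) \<le> (\<Sum>i\<in>p - B. (m + e) * (Sup (snd i) - Inf (snd i)))"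
      using good by (intro sum_mono) auto
    also have "\<dots> \<le> (\<Sum>i\<in>p. (m + e) * (Sup (snd i) - Inf (snd i)))"
      using KB m e fin by (intro sum_mono2) auto
    also have "\<dots> = (m + e) * (b - a)"
      unfolding sum_distrib_left[symmetric]
      using additive_tagged_division_1[OF ab p(1), of "\<lambda>x. x"] by (simp add: case_prod_unfold)
    finally have "g b - g a \<le> e + (m + e) * (b - a)" using e'(3) by simp
    moreover have "g a = 0" by (simp add: g_def kobayashi_dist_refl[OF \<Omega>])
    ultimately show ?thesis by (simp add: g_def)
  qed
  show ?thesis
  proof (rule field_le_epsilon)
    fix e :: real assume e: "0 < e"
    have q: "0 < b - a + 1" using ab by simp
    define e' where "e' = e / (b - a + 1)"
    have "kobayashi_dist \<Omega> (\<sigma> a) (\<sigma> b) \<le> (m + e') * (b - a) + e'"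
      using main[of e'] e q by (simp add: e'_def)
    also have "\<dots> = m * (b - a) + e' * (b - a + 1)" by (simp add: algebra_simps)
    also have "e' * (b - a + 1) = e" using q by (simp add: e'_def)
    finally show "kobayashi_dist \<Omega> (\<sigma> a) (\<sigma> b) \<le> m * (b - a) + e" .
  qed
qed

lemma kobayashi_dist_le_of_speed_le_abs:
  assumes "is_domain \<Omega>" "speed_le \<Omega> (\<lambda>_. m) a b \<sigma>" "0 \<le> m" "s \<in> {a..b}" "t \<in> {a..b}"
  shows "kobayashi_dist \<Omega> (\<sigma> s) (\<sigma> t) \<le> m * \<bar>s - t\<bar>"
proof (cases "s \<le> t")
  case True
  then show ?thesis
    using kobayashi_dist_le_of_speed_le[OF assms(1) speed_le_subinterval[OF assms(2)], of s t] assms(3-5) by auto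
next
  case False
  then show ?thesis
    using kobayashi_dist_le_of_speed_le[OF assms(1) speed_le_subinterval[OF assms(2)], of t s] assms(3-5)
    by (auto simp: kobayashi_dist_commute)
qed

section \<open>Near-minimal paths and boundary separation\<close>

text \<open>\<open>tanh s\<close> is the point at Poincare arc length \<open>s\<close> on the
  radius. Recentring the disc there by \<open>mob\<close> gives a competitor with factor 1, since
  the derivative of this automorphism at 0 equals the derivative of tanh at \<open>s\<close>.
  Continuity of \<open>v\<close> provides a Lipschitz bound on bounded intervals.\<close>

lemma radial_path:
  assumes "open \<Omega>" and \<phi>: "\<phi> \<in> holo_discs \<Omega>"
  obtains v where "\<And>s. ((\<lambda>s. \<phi> (of_real (tanh s))) has_vector_derivative v s) (at s)"
    "\<And>s. kobayashi_royden \<Omega> (\<phi> (of_real (tanh s))) (v s) \<le> 1" "continuous_on UNIV v"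
proof
  define v where "v s = (\<chi> i. deriv (\<lambda>\<zeta>. \<phi> \<zeta> $ i) (of_real (tanh s)) * of_real (1 - (tanh s)\<^sup>2))" for s :: real
  have n: "norm (of_real (tanh s) :: complex) < 1" for s
    using tanh_real_bounds[of s] by (simp add: abs_less_iff)
  show "((\<lambda>s. \<phi> (of_real (tanh s))) has_vector_derivative v s) (at s)" for s
  proof (rule has_vector_derivative_vec)
    fix i
    have "((\<lambda>s. of_real (tanh s) :: complex) has_vector_derivative of_real (1 - (tanh s)\<^sup>2)) (at s)"
      by (rule has_vector_derivative_of_real) (auto intro!: derivative_eq_intros simp: has_real_derivative_iff_has_vector_derivative[symmetric])
    from field_vector_diff_chain_at[OF this holo_discs_deriv[OF \<phi> n, of i s]]
    show "((\<lambda>s. \<phi> (of_real (tanh s)) $ i) has_vector_derivative v s $ i) (at s)"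
      by (simp add: o_def v_def mult.commute)
  qed
  show "kobayashi_royden \<Omega> (\<phi> (of_real (tanh s))) (v s) \<le> 1" for s
  proof -
    let ?a = "of_real (tanh s) :: complex"
    have "(\<lambda>\<zeta>. \<phi> (mob ?a \<zeta>)) \<in> holo_discs \<Omega>"
      by (rule holo_discs_compose[OF \<phi> mob_holomorphic[OF n]]) (use mob_ball[OF n] in auto)
    moreover have "deriv (\<lambda>\<zeta>. \<phi> (mob ?a \<zeta>) $ i) 0 = v s $ i" for i
      unfolding v_def vec_lambda_beta
    proof (rule DERIV_imp_deriv, rule DERIV_chain2[where f = "\<lambda>\<zeta>. \<phi> \<zeta> $ i"])
      show "((\<lambda>\<zeta>. \<phi> \<zeta> $ i) has_field_derivative deriv (\<lambda>\<zeta>. \<phi> \<zeta> $ i) ?a) (at (mob ?a 0))"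
        using holo_discs_deriv[OF \<phi> n, of i s] by simp
      show "(mob ?a has_field_derivative of_real (1 - (tanh s)\<^sup>2)) (at 0)"
        unfolding mob_eq[abs_def] by (auto intro!: derivative_eq_intros simp: power2_eq_square)
    qed
    ultimately have "royden_disc \<Omega> (\<phi> ?a) (v s) 1 (\<lambda>\<zeta>. \<phi> (mob ?a \<zeta>))"
      by (simp add: royden_disc_def)
    from kobayashi_royden_le[OF this] show ?thesis by simp
  qed
  show "continuous_on UNIV v"
    unfolding v_def
  proof (intro continuous_on_vec_lambda continuous_intros)
    fix i
    have "(\<lambda>\<zeta>. \<phi> \<zeta> $ i) holomorphic_on ball 0 1" using \<phi> by (simp add: holo_discs_def)
    then have c: "continuous_on (ball 0 1) (deriv (\<lambda>\<zeta>. \<phi> \<zeta> $ i))"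
      by (intro holomorphic_on_imp_continuous_on holomorphic_deriv) auto
    show "continuous_on UNIV (\<lambda>s. deriv (\<lambda>\<zeta>. \<phi> \<zeta> $ i) (of_real (tanh s)))"
      by (rule continuous_on_compose2[OF c]) (use n in \<open>auto intro!: continuous_intros\<close>)
  qed auto
qed

text \<open>The radial paths of the successive discs are concatenated, so that the duration is the
  length of the chain. The joints form the finite exceptional set, and the Lipschitz bound yields
  absolute continuity.\<close>

lemma ex_unit_path_of_reach:
  assumes "open \<Omega>" "reach \<Omega> z w d"
  shows "\<exists>\<gamma> L N. L-lipschitz_on {0..d} \<gamma> \<and> \<gamma> ` {0..d} \<subseteq> \<Omega> \<and> finite N \<and> \<gamma> 0 = z \<and> \<gamma> d = w \<and>
     (\<forall>t\<in>{0<..<d} - N. \<exists>v. (\<gamma> has_vector_derivative v) (at t) \<and> kobayashi_royden \<Omega> (\<gamma> t) v \<le> 1)"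
  using assms(2)
proof (induction rule: reach.induct)
  case reach_refl
  then show ?case
    by (intro exI[of _ "\<lambda>_. z"] exI[of _ 0] exI[of _ "{}"]) (auto intro: lipschitz_on_constant)
next
  case (reach_step \<phi> d T)
  have d: "0 \<le> d" using reach_step(1) by (rule reach_nonneg)
  obtain \<gamma> L N where \<gamma>: "L-lipschitz_on {0..d} \<gamma>" "\<gamma> ` {0..d} \<subseteq> \<Omega>" "finite N" "\<gamma> 0 = z" "\<gamma> d = \<phi> 0"
     "\<And>t. t \<in> {0<..<d} - N \<Longrightarrow> \<exists>v. (\<gamma> has_vector_derivative v) (at t) \<and> kobayashi_royden \<Omega> (\<gamma> t) v \<le> 1"
    using reach_step.IH by blast
  obtain v where v: "\<And>s. ((\<lambda>s. \<phi> (of_real (tanh s))) has_vector_derivative v s) (at s)"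
    "\<And>s. kobayashi_royden \<Omega> (\<phi> (of_real (tanh s))) (v s) \<le> 1" "continuous_on UNIV v"
    using radial_path[OF assms(1) reach_step(2)] by blast
  define \<eta> where "\<eta> s = \<phi> (of_real (tanh (s - d)))" for s
  have \<eta>d: "(\<eta> has_vector_derivative v (s - d)) (at s)" for s
    unfolding \<eta>_def
  proof -
    have "((\<lambda>s. s - d) has_vector_derivative 1) (at s)" by (auto intro!: derivative_eq_intros)
    from vector_diff_chain_at[OF this v(1)]
    show "((\<lambda>s. \<phi> (of_real (tanh (s - d)))) has_vector_derivative v (s - d)) (at s)"
      by (simp add: o_def)
  qed
  have "bounded (v ` {0..T})"
    using v(3) by (intro compact_imp_bounded compact_continuous_image) (auto intro: continuous_on_subset)
  then obtain B where "\<forall>x\<in>v ` {0..T}. norm x \<le> B" and B0: "0 < B"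
    unfolding bounded_pos by blast
  then have B: "\<And>s. s \<in> {0..T} \<Longrightarrow> norm (v s) \<le> B" by blast
  have "B-lipschitz_on {d..d+T} \<eta>"
  proof (rule bounded_derivative_imp_lipschitz)
    fix s assume s: "s \<in> {d..d+T}"
    show "(\<eta> has_derivative (\<lambda>h. h *\<^sub>R v (s - d))) (at s within {d..d + T})"
      using \<eta>d[of s] has_derivative_at_withinI unfolding has_vector_derivative_def by blast
    show "onorm (\<lambda>h. h *\<^sub>R v (s - d)) \<le> B"
      using B[of "s - d"] s B0 by (intro onorm_bound) (auto simp: mult.commute[of "\<bar>_\<bar>"] intro!: mult_right_mono)
  qed (use B0 in auto)
  then have \<eta>: "(max L B)-lipschitz_on {d..d+T} \<eta>" by (rule lipschitz_on_mono) auto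
  define \<rho> where "\<rho> s = (if s \<le> d then \<gamma> s else \<eta> s)" for s
  have \<rho>0: "\<rho> 0 = z" using d \<gamma>(4) by (simp add: \<rho>_def)
  have \<rho>T: "\<rho> (d + T) = \<phi> (of_real (tanh T))"
    using \<gamma>(5) reach_step(3) by (auto simp: \<rho>_def \<eta>_def)
  have "(max L B)-lipschitz_on {0..d+T} \<rho>"
    unfolding \<rho>_def using \<eta> \<gamma>(1,5)
    by (intro lipschitz_on_concat) (auto simp: \<eta>_def intro: lipschitz_on_mono)
  moreover have "\<rho> ` {0..d+T} \<subseteq> \<Omega>"
  proof -
    have "norm (of_real (tanh s) :: complex) < 1" for s
      using tanh_real_bounds[of s] by (simp add: abs_less_iff)
    then have "\<eta> s \<in> \<Omega>" for s
      unfolding \<eta>_def by (rule holo_discs_in[OF reach_step(2)])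
    then show ?thesis using \<gamma>(2) by (auto simp: \<rho>_def)
  qed
  moreover have "finite (insert d N)" using \<gamma>(3) by simp
  moreover have "\<exists>v. (\<rho> has_vector_derivative v) (at t) \<and> kobayashi_royden \<Omega> (\<rho> t) v \<le> 1"
    if t: "t \<in> {0<..<d+T} - insert d N" for t
  proof (cases "t < d")
    case True
    then obtain v where v: "(\<gamma> has_vector_derivative v) (at t)" "kobayashi_royden \<Omega> (\<gamma> t) v \<le> 1"
      using \<gamma>(6)[of t] t by auto
    have "(\<rho> has_vector_derivative v) (at t)"
      by (rule has_vector_derivative_transform_within_open[OF v(1), of "{..<d}"]) (use True in \<open>auto simp: \<rho>_def\<close>)
    then show ?thesis using v(2) True by (auto simp: \<rho>_def)
  next
    case False
    then have td: "d < t" using t by auto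
    have "(\<rho> has_vector_derivative v (t - d)) (at t)"
      by (rule has_vector_derivative_transform_within_open[OF \<eta>d, of "{d<..}"]) (use td in \<open>auto simp: \<rho>_def\<close>)
    moreover have "\<rho> t = \<phi> (of_real (tanh (t - d)))" using td by (simp add: \<rho>_def \<eta>_def)
    ultimately show ?thesis using v(2)[of "t - d"] by auto
  qed
  ultimately show ?case using \<rho>0 \<rho>T by blast
qed

text \<open>Such a path is a (1, e)-almost-geodesic: if a piece exceeded the distance of its end
  points by more than \<open>e\<close>, a detour along nearly shortest chains would beat the
  distance from \<open>z\<close> to \<open>w\<close>.\<close>

lemma ex_near_minimal_path:
  assumes \<Omega>: "is_domain \<Omega>" and z: "z \<in> \<Omega>" and w: "w \<in> \<Omega>" and e: "0 < e"
  obtains \<gamma> l where "0 \<le> l" "l < kobayashi_dist \<Omega> z w + e" "speed_le \<Omega> (\<lambda>_. 1) 0 l \<gamma>" "\<gamma> 0 = z" "\<gamma> l = w"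
    "\<And>s t. s \<in> {0..l} \<Longrightarrow> t \<in> {0..l} \<Longrightarrow> \<bar>s - t\<bar> - e \<le> kobayashi_dist \<Omega> (\<gamma> s) (\<gamma> t)"
proof -
  obtain l where l: "l < kobayashi_dist \<Omega> z w + e" "reach \<Omega> z w l"
    using kobayashi_dist_lt_reach[OF \<Omega> z w, of "kobayashi_dist \<Omega> z w + e"] e by auto
  have l0: "0 \<le> l" using l(2) by (rule reach_nonneg)
  have "open \<Omega>" using \<Omega> by (simp add: is_domain_def)
  from ex_unit_path_of_reach[OF this l(2)] obtain \<gamma> L N where
    \<gamma>: "L-lipschitz_on {0..l} \<gamma>" "\<gamma> ` {0..l} \<subseteq> \<Omega>" "finite N" "\<gamma> 0 = z" "\<gamma> l = w"
     "\<forall>t\<in>{0<..<l} - N. \<exists>v. (\<gamma> has_vector_derivative v) (at t) \<and> kobayashi_royden \<Omega> (\<gamma> t) v \<le> 1"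
    by blast
  have sp: "speed_le \<Omega> (\<lambda>_. 1) 0 l \<gamma>"
    unfolding speed_le_def using \<gamma> lipschitz_on_imp_abs_continuous_on[OF \<gamma>(1)] negligible_finite[OF \<gamma>(3)] by blast
  have k: "kobayashi_dist \<Omega> (\<gamma> s) (\<gamma> t) \<le> t - s" if "0 \<le> s" "s \<le> t" "t \<le> l" for s t
    using kobayashi_dist_le_of_speed_le_abs[OF \<Omega> sp, of s t] that by auto
  have low: "t - s - e \<le> kobayashi_dist \<Omega> (\<gamma> s) (\<gamma> t)" if st: "0 \<le> s" "s \<le> t" "t \<le> l" for s t
  proof -
    have in': "\<gamma> s \<in> \<Omega>" "\<gamma> t \<in> \<Omega>" using \<gamma>(2) st by auto
    have "kobayashi_dist \<Omega> z w \<le> kobayashi_dist \<Omega> z (\<gamma> s) + kobayashi_dist \<Omega> (\<gamma> s) w"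
      by (rule kobayashi_dist_triangle[OF \<Omega> z in'(1) w])
    also have "kobayashi_dist \<Omega> (\<gamma> s) w \<le> kobayashi_dist \<Omega> (\<gamma> s) (\<gamma> t) + kobayashi_dist \<Omega> (\<gamma> t) w"
      by (rule kobayashi_dist_triangle[OF \<Omega> in' w])
    finally show ?thesis using k[of 0 s] k[of t l] st l(1) \<gamma>(4,5) by simp
  qed
  show thesis
  proof (rule that[OF l0 l(1) sp \<gamma>(4,5)])
    fix s t assume "s \<in> {0..l}" "t \<in> {0..l}"
    then show "\<bar>s - t\<bar> - e \<le> kobayashi_dist \<Omega> (\<gamma> s) (\<gamma> t)"
      using low[of s t] low[of t s] by (cases "s \<le> t") (auto simp: kobayashi_dist_commute)
  qed
qed

text \<open>A nearly shortest path from \<open>S\<close> to its complement meets the frontier, and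
  its two pieces have almost the right total length. The lower bounds below use this to replace far
  points by points on a sphere.\<close>

lemma ex_crossing_point:
  assumes \<Omega>: "is_domain \<Omega>" and z: "z \<in> \<Omega> \<inter> S" and w: "w \<in> \<Omega> - S" and e: "0 < e"
  shows "\<exists>x \<in> \<Omega> \<inter> frontier S. kobayashi_dist \<Omega> z x + kobayashi_dist \<Omega> x w < kobayashi_dist \<Omega> z w + e"
proof -
  obtain \<gamma> l where \<gamma>: "0 \<le> l" "l < kobayashi_dist \<Omega> z w + e" "speed_le \<Omega> (\<lambda>_. 1) 0 l \<gamma>" "\<gamma> 0 = z" "\<gamma> l = w"
    using ex_near_minimal_path[OF \<Omega> _ _ e, of z w] z w by blast
  have "continuous_on {0..l} \<gamma>" using \<gamma>(3) by (auto simp: speed_le_def intro: abs_continuous_on_imp_continuous_on)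
  then have "connected (\<gamma> ` {0..l})" by (rule connected_continuous_image) auto
  moreover have "z \<in> \<gamma> ` {0..l}" "w \<in> \<gamma> ` {0..l}" using \<gamma>(1,4,5) by force+
  ultimately have "\<gamma> ` {0..l} \<inter> frontier S \<noteq> {}"
    using z w by (intro connected_Int_frontier) auto
  then obtain t where t: "t \<in> {0..l}" "\<gamma> t \<in> frontier S" by blast
  have "kobayashi_dist \<Omega> z (\<gamma> t) \<le> t" "kobayashi_dist \<Omega> (\<gamma> t) w \<le> l - t"
    using kobayashi_dist_le_of_speed_le_abs[OF \<Omega> \<gamma>(3), of 0 t] kobayashi_dist_le_of_speed_le_abs[OF \<Omega> \<gamma>(3), of t l] t \<gamma> by auto
  moreover have "\<gamma> t \<in> \<Omega>" using \<gamma>(3) t by (auto simp: speed_le_def)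
  ultimately show ?thesis using t \<gamma>(2) by (intro bexI[of _ "\<gamma> t"]) auto
qed

section \<open>Continuity of the distance, and uniform lower bounds from hyperbolicity and
  BSP\<close>

lemma kobayashi_dist_tendsto_0:
  assumes \<Omega>: "is_domain \<Omega>" and x: "x \<in> \<Omega>" and f: "(f \<longlongrightarrow> x) F"
  shows "((\<lambda>n. kobayashi_dist \<Omega> x (f n)) \<longlongrightarrow> 0) F"
proof -
  obtain r where r: "0 < r" "ball x r \<subseteq> \<Omega>"
    using \<Omega> x by (auto simp: is_domain_def open_contains_ball)
  have lim: "((\<lambda>n. 2 / r * norm (f n - x)) \<longlongrightarrow> 2 / r * norm (x - x)) F"
    by (intro tendsto_intros f)
  have "eventually (\<lambda>n. norm (f n - x) \<le> r / 2) F"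
  proof (rule eventually_mono)
    show "eventually (\<lambda>n. dist (f n) x < r / 2) F" 
      by (rule tendstoD[OF f]) (use r in simp)
  qed (simp add: dist_norm)
  then have "eventually (\<lambda>n. kobayashi_dist \<Omega> x (f n) \<le> 2 / r * norm (f n - x)) F"
    by (rule eventually_mono) (rule kobayashi_dist_le_ball[OF r(2,1)])
  then show ?thesis
  proof (rule tendsto_sandwich[rotated])
    show "eventually (\<lambda>n. 0 \<le> kobayashi_dist \<Omega> x (f n)) F" by (simp add: kobayashi_dist_nonneg[OF \<Omega>])
    show "((\<lambda>n. 2 / r * norm (f n - x)) \<longlongrightarrow> 0) F" using lim by simp
  qed (rule tendsto_const)
qed

lemma continuous_on_kobayashi_dist:
  assumes \<Omega>: "is_domain \<Omega>" and z: "z \<in> \<Omega>"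
  shows "continuous_on \<Omega> (kobayashi_dist \<Omega> z)"
  unfolding continuous_on_def
proof
  fix x assume x: "x \<in> \<Omega>"
  have "((\<lambda>y. kobayashi_dist \<Omega> z y - kobayashi_dist \<Omega> z x) \<longlongrightarrow> 0) (at x within \<Omega>)"
  proof (rule tendsto_0_le[where K = 1])
    show "((\<lambda>y. kobayashi_dist \<Omega> x y) \<longlongrightarrow> 0) (at x within \<Omega>)"
      by (rule kobayashi_dist_tendsto_0[OF \<Omega> x tendsto_ident_at])
    show "eventually (\<lambda>y. norm (kobayashi_dist \<Omega> z y - kobayashi_dist \<Omega> z x) \<le> norm (kobayashi_dist \<Omega> x y) * 1) (at x within \<Omega>)"
      unfolding eventually_at_topological
    proof (intro exI[of _ UNIV] conjI ballI impI)
      fix y assume y: "y \<in> \<Omega>"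
      show "norm (kobayashi_dist \<Omega> z y - kobayashi_dist \<Omega> z x) \<le> norm (kobayashi_dist \<Omega> x y) * 1"
        using kobayashi_dist_triangle[OF \<Omega> z x y] kobayashi_dist_triangle[OF \<Omega> z y x]
          kobayashi_dist_commute[of \<Omega> x y] kobayashi_dist_nonneg[OF \<Omega>, of x y] by (simp add: abs_le_iff)
    qed auto
  qed
  then show "((kobayashi_dist \<Omega> z) \<longlongrightarrow> kobayashi_dist \<Omega> z x) (at x within \<Omega>)"
    by (simp add: LIM_zero_iff)
qed

lemma kobayashi_hyperbolic_dist_pos:
  assumes "kobayashi_hyperbolic \<Omega>" "z \<in> \<Omega>" "w \<in> \<Omega>" "z \<noteq> w"
  shows "0 < kobayashi_dist \<Omega> z w"
proof -
  interpret Metric_space \<Omega> "kobayashi_dist \<Omega>" using assms(1) by (simp add: kobayashi_hyperbolic_def)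
  show ?thesis using assms by simp
qed

text \<open>Hyperbolicity gives pointwise positivity only. Continuity makes it uniform on a small
  compact sphere inside \<Omega>, and every path to a far point crosses that sphere.\<close>

lemma kobayashi_dist_bounded_below_off_ball:
  assumes \<Omega>: "is_domain \<Omega>" and hyp: "kobayashi_hyperbolic \<Omega>" and z: "z \<in> \<Omega>" and r: "0 < r"
  shows "\<exists>\<delta>>0. \<forall>w\<in>\<Omega>. r \<le> dist z w \<longrightarrow> \<delta> \<le> kobayashi_dist \<Omega> z w"
proof -
  obtain r' where r': "0 < r'" "cball z r' \<subseteq> \<Omega>"
    using \<Omega> z by (auto simp: is_domain_def open_contains_cball)
  define s where "s = min r' r"
  have s: "0 < s" "s \<le> r" "cball z s \<subseteq> \<Omega>" using r r' by (auto simp: s_def)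
  have sub: "sphere z s \<subseteq> \<Omega>" using s(3) sphere_cball by blast
  have "\<exists>\<delta>>0. \<forall>x\<in>sphere z s. \<delta> \<le> kobayashi_dist \<Omega> z x"
  proof (cases "sphere z s = {}")
    case False
    obtain x where x: "x \<in> sphere z s" "\<And>y. y \<in> sphere z s \<Longrightarrow> kobayashi_dist \<Omega> z x \<le> kobayashi_dist \<Omega> z y"
      using continuous_attains_inf[OF compact_sphere False, of "kobayashi_dist \<Omega> z"]
        continuous_on_subset[OF continuous_on_kobayashi_dist[OF \<Omega> z] sub] by blast
    have "0 < kobayashi_dist \<Omega> z x"
      using x(1) s(1) sub by (intro kobayashi_hyperbolic_dist_pos[OF hyp z]) auto
    then show ?thesis using x(2) by blast
  qed (auto intro: exI[of _ 1])
  then obtain \<delta> where \<delta>: "0 < \<delta>" "\<And>x. x \<in> sphere z s \<Longrightarrow> \<delta> \<le> kobayashi_dist \<Omega> z x" by blast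
  have "\<delta> \<le> kobayashi_dist \<Omega> z w" if w: "w \<in> \<Omega>" "r \<le> dist z w" for w
  proof (rule field_le_epsilon)
    fix e :: real assume e: "0 < e"
    obtain x where x: "x \<in> \<Omega> \<inter> frontier (ball z s)"
        "kobayashi_dist \<Omega> z x + kobayashi_dist \<Omega> x w < kobayashi_dist \<Omega> z w + e"
      using ex_crossing_point[OF \<Omega>, of z "ball z s" w e] z w s e by auto
    have "x \<in> sphere z s" using x(1) s(1) by (auto simp: frontier_ball)
    from \<delta>(2)[OF this] x(2) kobayashi_dist_nonneg[OF \<Omega>, of x w] show "\<delta> \<le> kobayashi_dist \<Omega> z w + e" by linarith
  qed
  then show ?thesis using \<delta>(1) by blast
qed

lemma BSP_sequentially:
  assumes "open \<Omega>" "BSP \<Omega>" "p \<in> frontier \<Omega>" "q \<in> frontier \<Omega>" "p \<noteq> q"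
    and x: "\<And>n. x n \<in> \<Omega>" "x \<longlonglongrightarrow> p" and y: "\<And>n. y n \<in> \<Omega>" "y \<longlonglongrightarrow> q"
  shows "\<exists>\<delta>>0. eventually (\<lambda>n. \<delta> < kobayashi_dist \<Omega> (x n) (y n)) sequentially"
proof -
  have "0 < Liminf (at (p, q) within \<Omega> \<times> \<Omega>) (\<lambda>(z, w). ereal (kobayashi_dist \<Omega> z w))"
    using assms by (auto simp: BSP_def)
  then obtain d where d: "0 < d" "d < Liminf (at (p, q) within \<Omega> \<times> \<Omega>) (\<lambda>(z, w). ereal (kobayashi_dist \<Omega> z w))"
    using dense by blast
  obtain \<delta> where \<delta>: "0 < \<delta>" "ereal \<delta> \<le> d" using d(1) ereal_dense2[of 0 d] by (auto simp: less_imp_le)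
  \<comment> \<open>Hence the pairs never equal \<open>(p, q)\<close>, the point that the filter
    \<open>at\<close> excludes.\<close>
  have "p \<notin> \<Omega>" using assms(1,3) by (simp add: frontier_def interior_open)
  then have "filterlim (\<lambda>n. (x n, y n)) (at (p, q) within \<Omega> \<times> \<Omega>) sequentially"
    using x y tendsto_Pair[OF x(2) y(2)] by (auto simp: filterlim_at intro!: always_eventually)
  from filterlim_iff[THEN iffD1, OF this, rule_format, OF less_LiminfD[OF d(2)]]
  have "eventually (\<lambda>n. d < ereal (kobayashi_dist \<Omega> (x n) (y n))) sequentially" by simp
  then have "eventually (\<lambda>n. \<delta> < kobayashi_dist \<Omega> (x n) (y n)) sequentially"
    by (rule eventually_mono) (use \<delta>(2) in \<open>auto dest: le_less_trans\<close>)
  then show ?thesis using \<delta>(1) by blast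
qed

text \<open>In a sequence of counterexamples, with \<open>w\<close> moved onto the sphere of radius
  \<open>r2\<close>, both points subconverge to distinct limits. A limit inside \<Omega> contradicts
  hyperbolicity; two boundary limits contradict BSP.\<close>

lemma kobayashi_dist_bounded_below_annulus:
  assumes \<Omega>: "is_domain \<Omega>" and hyp: "kobayashi_hyperbolic \<Omega>" and bsp: "BSP \<Omega>" and r: "r1 < r2"
  shows "\<exists>\<delta>>0. \<forall>z\<in>\<Omega> \<inter> cball p r1. \<forall>w\<in>\<Omega> - ball p r2. \<delta> \<le> kobayashi_dist \<Omega> z w"
proof (rule ccontr)
  assume neg: "\<not> ?thesis"
  have op: "open \<Omega>" using \<Omega> by (simp add: is_domain_def)
  \<comment> \<open>One \<open>1 / real (Suc n)\<close> comes from the counterexample, the other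
    from the crossing point.\<close>
  have "\<exists>z\<in>\<Omega> \<inter> cball p r1. \<exists>x\<in>\<Omega> \<inter> sphere p r2. kobayashi_dist \<Omega> z x < 2 / real (Suc n)" for n
  proof -
    have "0 < 1 / real (Suc n)" by simp
    with neg have "\<not> (\<forall>z\<in>\<Omega> \<inter> cball p r1. \<forall>w\<in>\<Omega> - ball p r2. 1 / real (Suc n) \<le> kobayashi_dist \<Omega> z w)"
      by blast
    then obtain z w where z: "z \<in> \<Omega> \<inter> cball p r1" and w: "w \<in> \<Omega> - ball p r2"
      and k: "kobayashi_dist \<Omega> z w < 1 / real (Suc n)"
      unfolding not_le[symmetric] by blast
    obtain x where x: "x \<in> \<Omega> \<inter> frontier (ball p r2)"
        "kobayashi_dist \<Omega> z x + kobayashi_dist \<Omega> x w < kobayashi_dist \<Omega> z w + 1 / real (Suc n)"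
      using ex_crossing_point[OF \<Omega>, of z "ball p r2" w "1 / real (Suc n)"] z w r by auto
    have "0 < r2" 
      using z r by (auto intro: order.strict_trans1[OF zero_le_dist[of p z]])
    then have "x \<in> \<Omega> \<inter> sphere p r2" using x(1) by (auto simp: frontier_ball)
    moreover have "1 / real (Suc n) + 1 / real (Suc n) = 2 / real (Suc n)" by simp
    then have "kobayashi_dist \<Omega> z x < 2 / real (Suc n)"
      using x(2) k kobayashi_dist_nonneg[OF \<Omega>, of x w] by linarith
    ultimately show ?thesis using z by blast
  qed
  then obtain z x where z: "\<And>n. z n \<in> \<Omega> \<inter> cball p r1" and x: "\<And>n. x n \<in> \<Omega> \<inter> sphere p r2"
    and k: "\<And>n. kobayashi_dist \<Omega> (z n) (x n) < 2 / real (Suc n)" by metis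
  have k0: "(\<lambda>n. kobayashi_dist \<Omega> (z n) (x n)) \<longlonglongrightarrow> 0"
  proof (rule tendsto_sandwich[of "\<lambda>_. 0" _ _ "\<lambda>n. 2 / real (Suc n)"])
    show "(\<lambda>n. 2 / real (Suc n)) \<longlonglongrightarrow> 0"
      using tendsto_mult_right_zero[OF LIMSEQ_inverse_real_of_nat, of 2] by (simp add: divide_inverse)
  qed (use k in \<open>auto intro!: always_eventually kobayashi_dist_nonneg[OF \<Omega>] less_imp_le\<close>)
  have "compact (cball p r1 \<times> sphere p r2)" by (intro compact_Times compact_cball compact_sphere)
  then have "seq_compact (cball p r1 \<times> sphere p r2)" by (rule compact_imp_seq_compact)
  moreover have "\<forall>n. (z n, x n) \<in> cball p r1 \<times> sphere p r2" using z x by auto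
  ultimately obtain l f where l: "l \<in> cball p r1 \<times> sphere p r2" and f: "strict_mono (f :: nat \<Rightarrow> nat)"
    and lim: "((\<lambda>n. (z n, x n)) \<circ> f) \<longlonglongrightarrow> l"
    by (rule seq_compactE)
  define a b where "a = fst l" and "b = snd l"
  have za: "(\<lambda>n. z (f n)) \<longlonglongrightarrow> a" and xb: "(\<lambda>n. x (f n)) \<longlonglongrightarrow> b"
    using tendsto_fst[OF lim] tendsto_snd[OF lim] by (auto simp: a_def b_def o_def)
  have ab: "a \<noteq> b" using l r by (auto simp: a_def b_def)
  have kf: "(\<lambda>n. kobayashi_dist \<Omega> (z (f n)) (x (f n))) \<longlonglongrightarrow> 0"
    using LIMSEQ_subseq_LIMSEQ[OF k0 f] by (simp add: o_def)
  \<comment> \<open>The other sequence would converge to \<open>c\<close> in Kobayashi distance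
    while staying away from it in Euclidean distance. The statement is symmetric enough to be
    applied to either limit.\<close>
  have inner: False if c: "c \<in> \<Omega>" and u: "\<And>n. u n \<in> \<Omega>" "u \<longlonglongrightarrow> c" and v: "\<And>n. v n \<in> \<Omega>" "v \<longlonglongrightarrow> d"
      and cd: "c \<noteq> d" and uv: "(\<lambda>n. kobayashi_dist \<Omega> (u n) (v n)) \<longlonglongrightarrow> 0" for c d u v
  proof -
    have "(\<lambda>n. kobayashi_dist \<Omega> c (u n) + kobayashi_dist \<Omega> (u n) (v n)) \<longlonglongrightarrow> 0 + 0"
      by (intro tendsto_add kobayashi_dist_tendsto_0[OF \<Omega> c] u uv)
    then have "(\<lambda>n. kobayashi_dist \<Omega> c (u n) + kobayashi_dist \<Omega> (u n) (v n)) \<longlonglongrightarrow> 0" by simp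
    then have lim0: "(\<lambda>n. kobayashi_dist \<Omega> c (v n)) \<longlonglongrightarrow> 0"
    proof (rule tendsto_sandwich[rotated 3])
      show "eventually (\<lambda>n. 0 \<le> kobayashi_dist \<Omega> c (v n)) sequentially"
        by (simp add: kobayashi_dist_nonneg[OF \<Omega>])
      show "eventually (\<lambda>n. kobayashi_dist \<Omega> c (v n) \<le> kobayashi_dist \<Omega> c (u n) + kobayashi_dist \<Omega> (u n) (v n)) sequentially"
        by (intro always_eventually allI kobayashi_dist_triangle[OF \<Omega> c u(1) v(1)])
    qed auto
    obtain \<delta> where \<delta>: "0 < \<delta>" "\<And>w. w \<in> \<Omega> \<Longrightarrow> dist c d / 2 \<le> dist c w \<Longrightarrow> \<delta> \<le> kobayashi_dist \<Omega> c w"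
      using kobayashi_dist_bounded_below_off_ball[OF \<Omega> hyp c, of "dist c d / 2"] cd by auto
    have "eventually (\<lambda>n. dist (v n) d < dist c d / 2) sequentially"
      using tendstoD[OF v(2), of "dist c d / 2"] cd by auto
    moreover have "eventually (\<lambda>n. kobayashi_dist \<Omega> c (v n) < \<delta>) sequentially"
      using order_tendstoD(2)[OF lim0 \<delta>(1)] .
    ultimately have "eventually (\<lambda>n. False) sequentially"
    proof eventually_elim
      case (elim n)
      have "dist c d \<le> dist c (v n) + dist (v n) d" by (rule dist_triangle)
      then show ?case using \<delta>(2)[OF v(1)[of n]] elim by linarith
    qed
    then show False by simp
  qed
  have "a \<notin> \<Omega>" using inner[OF _ _ za _ xb ab kf] z x by blast
  moreover have "b \<notin> \<Omega>"
    using inner[OF _ _ xb _ za ab[symmetric]] kf z x by (auto simp: kobayashi_dist_commute)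
  moreover have "a \<in> closure \<Omega>" "b \<in> closure \<Omega>"
    using closed_sequentially[OF closed_closure _ za] closed_sequentially[OF closed_closure _ xb] z x closure_subset by blast+
  ultimately have "a \<in> frontier \<Omega>" "b \<in> frontier \<Omega>" using op by (auto simp: frontier_def interior_open)
  from BSP_sequentially[OF op bsp this ab _ za _ xb] z x obtain \<delta> where
    \<delta>: "0 < \<delta>" "eventually (\<lambda>n. \<delta> < kobayashi_dist \<Omega> (z (f n)) (x (f n))) sequentially" by blast
  from order_tendstoD(2)[OF kf \<delta>(1)] \<delta>(2) have "eventually (\<lambda>n. False) sequentially"
    by eventually_elim simp
  then show False by simp
qed

section \<open>Bounded domains\<close>

lemma tanh_le_self: "0 \<le> t \<Longrightarrow> tanh t \<le> (t::real)"
proof -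
  assume "0 \<le> t"
  have "0 - tanh 0 \<le> t - tanh t"
  proof (rule DERIV_nonneg_imp_nondecreasing[OF \<open>0 \<le> t\<close>])
    fix x :: real
    have "((\<lambda>x. x - tanh x) has_real_derivative 1 - (1 - (tanh x)\<^sup>2)) (at x)"
      by (auto intro!: derivative_eq_intros)
    then show "\<exists>y. ((\<lambda>x. x - tanh x) has_real_derivative y) (at x) \<and> 0 \<le> y" by force
  qed
  then show ?thesis by simp
qed

text \<open>The Schwarz lemma in each coordinate bounds the displacement along a disc by a multiple
  of \<open>tanh t\<close>, hence of its length \<open>t\<close>; this adds up along chains.\<close>

lemma norm_diff_le_kobayashi_dist:
  fixes \<Omega> :: "(complex ^ 'd) set"
  assumes \<Omega>: "is_domain \<Omega>" and bd: "bounded \<Omega>"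
  shows "\<exists>C>0. \<forall>z\<in>\<Omega>. \<forall>w\<in>\<Omega>. norm (z - w) \<le> C * kobayashi_dist \<Omega> z w"
proof -
  obtain R where R: "0 < R" "\<Omega> \<subseteq> ball 0 R" using bounded_subset_ballD[OF bd] by blast
  \<comment> \<open>Each coordinate varies by less than \<open>2 * R\<close> on \<Omega>, and the
    norm is at most the sum over the coordinates.\<close>
  define C where "C = real CARD('d) * (2 * R)"
  have C: "0 < C" using R by (simp add: C_def)
  have disc: "norm (\<phi> \<zeta> - \<phi> 0) \<le> C * norm \<zeta>" if \<phi>: "\<phi> \<in> holo_discs \<Omega>" and \<zeta>: "norm \<zeta> < 1" for \<phi> \<zeta>
  proof -
    have comp: "norm (\<phi> \<zeta>' $ i) < R" if "norm \<zeta>' < 1" for \<zeta>' i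
      using holo_discs_in[OF \<phi> that] R(2) Finite_Cartesian_Product.norm_nth_le[of "\<phi> \<zeta>'" i] by fastforce
    have "norm ((\<phi> \<zeta> - \<phi> 0) $ i) \<le> 2 * R * norm \<zeta>" for i
    proof -
      define g where "g \<zeta> = (\<phi> \<zeta> $ i - \<phi> 0 $ i) / of_real (2 * R)" for \<zeta>
      have "norm (g \<zeta>) \<le> norm \<zeta>"
      proof (rule Schwarz_Lemma(1))
        show "g holomorphic_on ball 0 1"
          using \<phi> R unfolding g_def holo_discs_def by (auto intro!: holomorphic_intros)
        show "g 0 = 0" by (simp add: g_def)
        show "norm (g z) < 1" if "norm z < 1" for z
        proof -
          have "norm (\<phi> z $ i - \<phi> 0 $ i) < R + R"
            using norm_triangle_ineq4[of "\<phi> z $ i" "\<phi> 0 $ i"] comp[OF that, of i] comp[of 0 i] by simp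
          then show ?thesis using R by (simp add: g_def norm_divide)
        qed
      qed (rule \<zeta>)
      then show ?thesis using R by (simp add: g_def norm_divide field_simps)
    qed
    then have "(\<Sum>i\<in>UNIV. norm ((\<phi> \<zeta> - \<phi> 0) $ i)) \<le> (\<Sum>i\<in>(UNIV::'d set). 2 * R * norm \<zeta>)"
      by (intro sum_mono)
    moreover have "norm (\<phi> \<zeta> - \<phi> 0) \<le> (\<Sum>i\<in>UNIV. norm ((\<phi> \<zeta> - \<phi> 0) $ i))"
      unfolding norm_vec_def by (rule L2_set_le_sum) auto
    ultimately show ?thesis by (simp add: C_def mult.assoc)
  qed
  have reach: "norm (w - z) \<le> C * d" if "reach \<Omega> z w d" for z w d
    using that
  proof (induction rule: reach.induct)
    case (reach_step \<phi> d t)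
    have "norm (\<phi> (of_real (tanh t)) - \<phi> 0) \<le> C * norm (of_real (tanh t) :: complex)"
      by (rule disc[OF reach_step(2) norm_of_real_tanh[OF reach_step(3)]])
    also have "\<dots> \<le> C * t" using C reach_step(3) tanh_le_self[of t] by simp
    finally have "norm (\<phi> (of_real (tanh t)) - \<phi> 0) \<le> C * t" .
    moreover have "norm (\<phi> (of_real (tanh t)) - z) \<le> norm (\<phi> (of_real (tanh t)) - \<phi> 0) + norm (\<phi> 0 - z)"
      using norm_triangle_ineq[of "\<phi> (of_real (tanh t)) - \<phi> 0" "\<phi> 0 - z"] by simp
    ultimately show ?case using reach_step.IH by (simp add: distrib_left)
  qed simp
  have "norm (z - w) \<le> C * kobayashi_dist \<Omega> z w" if zw: "z \<in> \<Omega>" "w \<in> \<Omega>" for z w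
  proof (rule field_le_epsilon)
    fix e :: real assume e: "0 < e"
    obtain d where d: "d < kobayashi_dist \<Omega> z w + e / C" "reach \<Omega> z w d"
      using kobayashi_dist_lt_reach[OF \<Omega> zw, of "kobayashi_dist \<Omega> z w + e / C"] e C by auto
    have "norm (z - w) \<le> C * d" using reach[OF d(2)] by (simp add: norm_minus_commute)
    also have "\<dots> \<le> C * (kobayashi_dist \<Omega> z w + e / C)" using C d(1) by simp
    also have "\<dots> = C * kobayashi_dist \<Omega> z w + e" using C by (simp add: distrib_left)
    finally show "norm (z - w) \<le> C * kobayashi_dist \<Omega> z w + e" .
  qed
  then show ?thesis using C by blast
qed

lemma bounded_imp_kobayashi_hyperbolic:
  assumes \<Omega>: "is_domain \<Omega>" and bd: "bounded \<Omega>"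
  shows "kobayashi_hyperbolic \<Omega>"
proof -
  obtain C where C: "0 < C" "\<And>z w. z \<in> \<Omega> \<Longrightarrow> w \<in> \<Omega> \<Longrightarrow> norm (z - w) \<le> C * kobayashi_dist \<Omega> z w"
    using norm_diff_le_kobayashi_dist[OF assms] by blast
  show ?thesis
    unfolding kobayashi_hyperbolic_def
  proof
    fix x y z
    show "0 \<le> kobayashi_dist \<Omega> x y" by (rule kobayashi_dist_nonneg[OF \<Omega>])
    show "kobayashi_dist \<Omega> x y = kobayashi_dist \<Omega> y x" by (rule kobayashi_dist_commute)
    assume xy: "x \<in> \<Omega>" "y \<in> \<Omega>"
    show "kobayashi_dist \<Omega> x y = 0 \<longleftrightarrow> x = y"
      using C(2)[OF xy] kobayashi_dist_refl[OF \<Omega>, of x] by auto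
    assume "z \<in> \<Omega>"
    with xy show "kobayashi_dist \<Omega> x z \<le> kobayashi_dist \<Omega> x y + kobayashi_dist \<Omega> y z"
      by (rule kobayashi_dist_triangle[OF \<Omega>])
  qed
qed

lemma bounded_imp_BSP:
  assumes \<Omega>: "is_domain \<Omega>" and bd: "bounded \<Omega>"
  shows "BSP \<Omega>"
  unfolding BSP_def
proof (intro ballI impI)
  fix p q assume pq: "p \<in> frontier \<Omega>" "q \<in> frontier \<Omega>" "p \<noteq> q"
  obtain C where C: "0 < C" "\<And>z w. z \<in> \<Omega> \<Longrightarrow> w \<in> \<Omega> \<Longrightarrow> norm (z - w) \<le> C * kobayashi_dist \<Omega> z w"
    using norm_diff_le_kobayashi_dist[OF assms] by blast
  \<comment> \<open>Points within \<open>e\<close> of \<open>p\<close> and of \<open>q\<close> are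
    still more than \<open>2 * e\<close> apart.\<close>
  define e where "e = dist p q / 4"
  have e: "0 < e" using pq by (simp add: e_def)
  have "eventually (\<lambda>u. ereal (e / C) \<le> (case u of (z, w) \<Rightarrow> ereal (kobayashi_dist \<Omega> z w))) (at (p, q) within \<Omega> \<times> \<Omega>)"
    unfolding eventually_at
  proof (intro exI[of _ e] conjI ballI impI e)
    fix u assume "u \<in> \<Omega> \<times> \<Omega>" "u \<noteq> (p, q) \<and> dist u (p, q) < e"
    then obtain z w where u: "u = (z, w)" "z \<in> \<Omega>" "w \<in> \<Omega>" "dist (z, w) (p, q) < e" by auto
    have "dist z p < e" "dist w q < e"
      using dist_fst_le[of "(z, w)" "(p, q)"] dist_snd_le[of "(z, w)" "(p, q)"] u(4) by auto
    moreover have "dist p q \<le> dist p z + dist z w + dist w q"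
      using dist_triangle[of p q z] dist_triangle[of z q w] by linarith
    ultimately have "e \<le> dist z w" 
      using e dist_commute[of p z] unfolding e_def by linarith
    also have "\<dots> \<le> C * kobayashi_dist \<Omega> z w" using C(2)[OF u(2,3)] by (simp add: dist_norm)
    finally have "e / C \<le> kobayashi_dist \<Omega> z w" using C(1) by (simp add: field_simps)
    then show "ereal (e / C) \<le> (case u of (z, w) \<Rightarrow> ereal (kobayashi_dist \<Omega> z w))" by (simp add: u)
  qed
  from Liminf_bounded[OF this]
  have "ereal (e / C) \<le> Liminf (at (p, q) within \<Omega> \<times> \<Omega>) (\<lambda>(z, w). ereal (kobayashi_dist \<Omega> z w))" .
  moreover have "0 < ereal (e / C)" using e C(1) by simp
  ultimately show "0 < Liminf (at (p, q) within \<Omega> \<times> \<Omega>) (\<lambda>(z, w). ereal (kobayashi_dist \<Omega> z w))"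
    by (rule order.strict_trans2[rotated])
qed

section \<open>Reparametrization to almost-geodesics\<close>

text \<open>coth tends to 1 exponentially; this is weakened to order 1 / (1 + s^2), whose primitive
  arctan is explicit and bounded. The slope 1/2 is what the closest-point argument delivers, and
  \<open>\<delta>\<close> covers the range where the linear bound says nothing.\<close>

lemma coth_bound:
  fixes \<delta> C :: real
  assumes \<delta>: "0 < \<delta>"
  shows "\<exists>A\<ge>0. \<forall>s. 1 / tanh (max \<delta> (\<bar>s\<bar> / 2 - C)) \<le> 1 + A / (1 + s\<^sup>2)"
proof -
  define b where "b = 1 - exp (- 2 * \<delta>)"
  have b: "0 < b" using \<delta> by (simp add: b_def)
  define A where "A = 4 * exp (2 * C) / b"
  have "1 / tanh (max \<delta> (\<bar>s\<bar> / 2 - C)) \<le> 1 + A / (1 + s\<^sup>2)" for s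
  proof -
    define D where "D = max \<delta> (\<bar>s\<bar> / 2 - C)"
    define E where "E = exp (- 2 * D)"
    have bE: "b \<le> 1 - E" by (simp add: b_def E_def D_def)
    then have E1: "0 < 1 - E" using b by linarith
    have E0: "0 < E" by (simp add: E_def)
    have s2: "0 < 1 + s\<^sup>2" by (simp add: add_pos_nonneg)
    have "1 + s\<^sup>2 \<le> 2 * exp \<bar>s\<bar>"
      using exp_lower_Taylor_quadratic[of "\<bar>s\<bar>"] by (simp add: algebra_simps)
    then have es: "exp (- \<bar>s\<bar>) \<le> 2 / (1 + s\<^sup>2)"
      using s2 by (simp add: exp_minus field_simps)
    have "E \<le> exp (2 * C + - \<bar>s\<bar>)" by (simp add: E_def D_def max_def)
    also have "\<dots> = exp (2 * C) * exp (- \<bar>s\<bar>)" by (rule exp_add)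
    also have "\<dots> \<le> exp (2 * C) * (2 / (1 + s\<^sup>2))" using es by (intro mult_left_mono) auto
    finally have E2: "E \<le> exp (2 * C) * (2 / (1 + s\<^sup>2))" .
    have "1 / tanh D = (1 + E) / (1 - E)" by (simp add: tanh_real_altdef E_def)
    also have "\<dots> = 1 + 2 * E / (1 - E)" using E1 by (simp add: field_simps)
    also have "2 * E / (1 - E) \<le> 2 * E / b" using bE b E0 E1 by (intro divide_left_mono) auto
    also have "\<dots> \<le> 2 * (exp (2 * C) * (2 / (1 + s\<^sup>2))) / b"
      using E2 b by (intro divide_right_mono mult_left_mono) auto
    also have "\<dots> = A / (1 + s\<^sup>2)" by (simp add: A_def)
    finally show ?thesis by (simp add: D_def)
  qed
  moreover have "0 \<le> A" using b by (simp add: A_def)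
  ultimately show ?thesis by blast
qed

lemma speed_le_imp_AE:
  assumes "speed_le \<Omega> m a b \<sigma>"
  shows "AE t in lebesgue_on {a..b}. \<exists>v. (\<sigma> has_vector_derivative v) (at t within {a..b}) \<and>
      kobayashi_royden \<Omega> (\<sigma> t) v \<le> m t"
proof -
  obtain N where N: "negligible N" "\<And>t. t \<in> {a<..<b} - N \<Longrightarrow>
      \<exists>v. (\<sigma> has_vector_derivative v) (at t) \<and> kobayashi_royden \<Omega> (\<sigma> t) v \<le> m t"
    using assms by (auto simp: speed_le_def)
  have "negligible (N \<union> {a, b})" using N(1) by simp
  then have "AE t in lebesgue. t \<notin> N \<union> {a, b}"
    by (intro AE_not_in) (simp add: negligible_iff_null_sets)
  then have "AE t in lebesgue. t \<in> {a..b} \<longrightarrow> (\<exists>v. (\<sigma> has_vector_derivative v) (at t within {a..b}) \<and>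
      kobayashi_royden \<Omega> (\<sigma> t) v \<le> m t)"
  proof (rule AE_mp, intro AE_I2 impI)
    fix t assume "t \<notin> N \<union> {a, b}" "t \<in> {a..b}"
    then have "t \<in> {a<..<b} - N" by auto
    from N(2)[OF this] show "\<exists>v. (\<sigma> has_vector_derivative v) (at t within {a..b}) \<and>
      kobayashi_royden \<Omega> (\<sigma> t) v \<le> m t"
      using has_vector_derivative_at_within by blast
  qed
  then show ?thesis by (simp add: AE_restrict_space_iff)
qed

lemma almost_geodesic_imp_speed_le:
  assumes "almost_geodesic \<Omega> l c {a..b} \<sigma>"
  shows "speed_le \<Omega> (\<lambda>_. l) a b \<sigma>"
proof -
  have "AE t in lebesgue_on {a..b}. \<exists>v. (\<sigma> has_vector_derivative v) (at t within {a..b}) \<and>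
      kobayashi_royden \<Omega> (\<sigma> t) v \<le> l"
    using assms by (simp add: almost_geodesic_def)
  then have "AE t in lebesgue. t \<in> {a..b} \<longrightarrow> (\<exists>v. (\<sigma> has_vector_derivative v) (at t within {a..b}) \<and>
      kobayashi_royden \<Omega> (\<sigma> t) v \<le> l)"
    by (simp add: AE_restrict_space_iff)
  then obtain N where N1: "N \<in> null_sets lebesgue" and "{t \<in> space lebesgue. \<not> (t \<in> {a..b} \<longrightarrow>
      (\<exists>v. (\<sigma> has_vector_derivative v) (at t within {a..b}) \<and> kobayashi_royden \<Omega> (\<sigma> t) v \<le> l))} \<subseteq> N"
    unfolding eventually_ae_filter by blast
  then have N2: "\<exists>v. (\<sigma> has_vector_derivative v) (at t within {a..b}) \<and> kobayashi_royden \<Omega> (\<sigma> t) v \<le> l"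
    if "t \<in> {a..b}" "t \<notin> N" for t
    using that by (auto simp: subset_iff)
  have "\<exists>v. (\<sigma> has_vector_derivative v) (at t) \<and> kobayashi_royden \<Omega> (\<sigma> t) v \<le> l" if "t \<in> {a<..<b} - N" for t
  proof -
    have "at t within {a..b} = at t" using that by (intro at_within_interior) (auto simp: interior_atLeastAtMost_real)
    moreover have "\<exists>v. (\<sigma> has_vector_derivative v) (at t within {a..b}) \<and>
      kobayashi_royden \<Omega> (\<sigma> t) v \<le> l" using that by (intro N2) auto
    ultimately show ?thesis using that by auto
  qed
  moreover have "negligible N" using N1 by (simp add: negligible_iff_null_sets)
  ultimately show ?thesis using assms unfolding speed_le_def almost_geodesic_def by blast
qed

text \<open>Only the lower estimate has to be supplied: integrating the speed gives the upper
  one.\<close>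

lemma almost_geodesicI:
  assumes U: "is_domain U" and sp: "speed_le U (\<lambda>_. m) a b \<tau>" and m: "1 \<le> m" and c: "0 \<le> c"
    and low: "\<And>s t. s \<in> {a..b} \<Longrightarrow> t \<in> {a..b} \<Longrightarrow> \<bar>s - t\<bar> / m - c \<le> kobayashi_dist U (\<tau> s) (\<tau> t)"
  shows "almost_geodesic U m c {a..b} \<tau>"
  unfolding almost_geodesic_def
proof (intro conjI ballI)
  fix s t assume st: "s \<in> {a..b}" "t \<in> {a..b}"
  show "1 / m * \<bar>s - t\<bar> - c \<le> kobayashi_dist U (\<tau> s) (\<tau> t)" using low[OF st] by simp
  show "kobayashi_dist U (\<tau> s) (\<tau> t) \<le> m * \<bar>s - t\<bar> + c"
    using kobayashi_dist_le_of_speed_le_abs[OF U sp _ st] m c by linarith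
qed (use sp speed_le_imp_AE[OF sp] in \<open>auto simp: speed_le_def is_interval_cc\<close>)

text \<open>The curve is slowed down by exactly its excess factor, and the total delay is bounded.
  The multiplicative constant stays \<open>m\<close>, so that for \<open>m = 1\<close> weak
  visibility still applies; only the additive constant grows.\<close>

lemma speed_le_reparametrize:
  assumes U: "is_domain U" and ab: "a \<le> b" and sp: "speed_le U (\<lambda>t. m * (1 + A / (1 + (t - t0)\<^sup>2))) a b \<sigma>"
    and A: "0 \<le> A" and m: "1 \<le> m" and c: "0 \<le> c"
    and low: "\<And>s t. s \<in> {a..b} \<Longrightarrow> t \<in> {a..b} \<Longrightarrow> \<bar>s - t\<bar> / m - c \<le> kobayashi_dist U (\<sigma> s) (\<sigma> t)"
  shows "\<exists>T \<tau>. 0 \<le> T \<and> almost_geodesic U m (c + A * pi) {0..T} \<tau> \<and> \<tau> ` {0..T} = \<sigma> ` {a..b} \<and>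
    \<tau> 0 = \<sigma> a \<and> \<tau> T = \<sigma> b"
proof -
  \<comment> \<open>the primitive of the excess factor; \<open>arctan\<close> is bounded, so \<open>\<theta>\<close> changes distances by at most \<open>A * pi\<close>\<close>
  define \<theta> where "\<theta> t = (t - a) + A * (arctan (t - t0) - arctan (a - t0))" for t
  define \<theta>' where "\<theta>' t = 1 + A / (1 + (t - t0)\<^sup>2)" for t
  have sq: "0 < 1 + (t - t0)\<^sup>2" for t by (simp add: add_pos_nonneg)
  have \<theta>'1: "1 \<le> \<theta>' t" for t using A sq[of t] by (simp add: \<theta>'_def)
  have \<theta>d: "(\<theta> has_real_derivative \<theta>' t) (at t)" for t
    unfolding \<theta>_def \<theta>'_def by (auto intro!: derivative_eq_intros simp: divide_inverse)
  have exp: "t - s \<le> \<theta> t - \<theta> s" if "s \<le> t" for s t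
  proof -
    have "arctan (s - t0) \<le> arctan (t - t0)" using that by (simp add: arctan_le_iff)
    then have "0 \<le> A * (arctan (t - t0) - arctan (s - t0))" using A by simp
    then show ?thesis by (simp add: \<theta>_def algebra_simps)
  qed
  have upp: "\<theta> t - \<theta> s \<le> t - s + A * pi" for s t
  proof -
    have "arctan (t - t0) - arctan (s - t0) \<le> pi"
      using arctan_ubound[of "t - t0"] arctan_lbound[of "s - t0"] by linarith
    then have "A * (arctan (t - t0) - arctan (s - t0)) \<le> A * pi" using A by (intro mult_left_mono)
    then show ?thesis by (simp add: \<theta>_def algebra_simps)
  qed
  have \<theta>a: "\<theta> a = 0" by (simp add: \<theta>_def)
  define T where "T = \<theta> b"
  have T: "0 \<le> T" using exp[OF ab] ab \<theta>a by (simp add: T_def)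
  have "continuous_on {a..b} \<theta>"
    using \<theta>d by (intro continuous_at_imp_continuous_on) (auto intro: DERIV_isCont)
  then have "\<exists>t. t \<in> {a..b} \<and> \<theta> t = x" if "x \<in> {0..T}" for x
    using IVT'[of \<theta> a x b] ab that unfolding \<theta>a T_def by auto
  then have "\<forall>x\<in>{0..T}. \<exists>t. t \<in> {a..b} \<and> \<theta> t = x" by blast
  \<comment> \<open>\<open>g\<close> inverts \<open>\<theta>\<close>. Since \<open>\<theta>\<close>
    does not shrink lengths, \<open>g\<close> is nondecreasing and 1-Lipschitz.\<close>
  from bchoice[OF this] obtain g where "\<forall>x\<in>{0..T}. g x \<in> {a..b} \<and> \<theta> (g x) = x" by blast
  then have g: "\<And>x. x \<in> {0..T} \<Longrightarrow> g x \<in> {a..b}" "\<And>x. x \<in> {0..T} \<Longrightarrow> \<theta> (g x) = x" by blast+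
  have gmono: "g x \<le> g y \<and> g y - g x \<le> y - x" if "x \<in> {0..T}" "y \<in> {0..T}" "x \<le> y" for x y
    using exp[of "g x" "g y"] exp[of "g y" "g x"] g(2)[OF that(1)] g(2)[OF that(2)] that(3) by linarith
  have \<theta>T: "\<theta> t \<in> {0..T}" if "t \<in> {a..b}" for t
    using exp[of a t] exp[of t b] that \<theta>a by (auto simp: T_def)
  have g\<theta>: "g (\<theta> t) = t" if "t \<in> {a..b}" for t
    using exp[of "g (\<theta> t)" t] exp[of t "g (\<theta> t)"] g(2)[OF \<theta>T[OF that]] by linarith
  define \<tau> where "\<tau> x = \<sigma> (g x)" for x
  have img: "\<tau> ` {0..T} = \<sigma> ` {a..b}"
  proof
    show "\<tau> ` {0..T} \<subseteq> \<sigma> ` {a..b}" using g(1) by (auto simp: \<tau>_def)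
    show "\<sigma> ` {a..b} \<subseteq> \<tau> ` {0..T}"
    proof
      fix y assume "y \<in> \<sigma> ` {a..b}"
      then obtain t where "t \<in> {a..b}" "y = \<sigma> t" by blast
      then show "y \<in> \<tau> ` {0..T}" using g\<theta> \<theta>T by (intro image_eqI[of _ _ "\<theta> t"]) (auto simp: \<tau>_def)
    qed
  qed
  have ends: "\<tau> 0 = \<sigma> a" "\<tau> T = \<sigma> b"
    using g\<theta>[of a] g\<theta>[of b] ab \<theta>a by (auto simp: \<tau>_def T_def)
  obtain N where N: "negligible N" "\<And>t. t \<in> {a<..<b} - N \<Longrightarrow>
      \<exists>v. (\<sigma> has_vector_derivative v) (at t) \<and> kobayashi_royden U (\<sigma> t) v \<le> m * \<theta>' t"
    using sp by (auto simp: speed_le_def \<theta>'_def)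
  \<comment> \<open>The exceptional set of the new curve is the image of \<open>N\<close> under
    \<open>\<theta>\<close>, a null set because \<open>\<theta>\<close> is differentiable.\<close>
  have "\<theta> differentiable_on N"
    unfolding differentiable_on_def real_differentiable_def
    using has_field_derivative_at_within[OF \<theta>d] by blast
  then have neg: "negligible (\<theta> ` N)"
    using N(1) by (intro negligible_differentiable_image_negligible) auto
  have op: "open U" using U by (simp add: is_domain_def)
  have "\<exists>v. (\<tau> has_vector_derivative v) (at x) \<and> kobayashi_royden U (\<tau> x) v \<le> m"
    if x: "x \<in> {0<..<T} - \<theta> ` N" for x
  proof -
    have x': "x \<in> {0..T}" using x by auto
    have gx: "g x \<in> {a<..<b} - N"
    proof -
      have "g x \<in> {a..b}" "\<theta> (g x) = x" using g x' by auto
      moreover have "g x \<noteq> a" "g x \<noteq> b" using calculation(2) \<theta>a x by (auto simp: T_def)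
      moreover have "g x \<notin> N" using calculation(2) x by (metis DiffD2 imageI)
      ultimately show ?thesis by auto
    qed
    obtain v where v: "(\<sigma> has_vector_derivative v) (at (g x))" "kobayashi_royden U (\<sigma> (g x)) v \<le> m * \<theta>' (g x)"
      using N(2)[OF gx] by blast
    have "1-lipschitz_on {0..T} g"
    proof (rule lipschitz_onI)
      fix y z assume "y \<in> {0..T}" "z \<in> {0..T}"
      then show "dist (g y) (g z) \<le> 1 * dist y z"
        using gmono[of y z] gmono[of z y] by (auto simp: dist_real_def abs_if)
    qed simp
    then have "continuous_on {0..T} g" by (rule lipschitz_on_continuous_on)
    then have "isCont g x"
      using x by (intro continuous_on_interior[of "{0..T}"]) (auto simp: interior_atLeastAtMost_real)
    then have gd: "(g has_real_derivative inverse (\<theta>' (g x))) (at x)"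
      using x \<theta>'1[of "g x"] g(2) by (intro DERIV_inverse_function[OF \<theta>d, of g x 0 T]) auto
    have "(\<tau> has_vector_derivative inverse (\<theta>' (g x)) *\<^sub>R v) (at x)"
      using vector_diff_chain_at[OF gd[unfolded has_real_derivative_iff_has_vector_derivative] v(1)]
      by (simp add: o_def \<tau>_def[abs_def])
    moreover have "kobayashi_royden U (\<tau> x) (inverse (\<theta>' (g x)) *\<^sub>R v) \<le> m"
    proof -
      have "\<sigma> (g x) \<in> U" using sp g(1)[OF x'] by (auto simp: speed_le_def)
      moreover have p: "0 < inverse (\<theta>' (g x))" using \<theta>'1[of "g x"] by simp
      ultimately have "kobayashi_royden U (\<tau> x) (inverse (\<theta>' (g x)) *\<^sub>R v) \<le> inverse (\<theta>' (g x)) * kobayashi_royden U (\<sigma> (g x)) v"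
        unfolding \<tau>_def by (intro kobayashi_royden_scaleR[OF op])
      also have "\<dots> \<le> inverse (\<theta>' (g x)) * (m * \<theta>' (g x))" using v(2) p by (intro mult_left_mono) auto
      also have "\<dots> = m" using \<theta>'1[of "g x"] by simp
      finally show ?thesis .
    qed
    ultimately show ?thesis by blast
  qed
  then have "\<exists>N. negligible N \<and> (\<forall>x\<in>{0<..<T} - N. \<exists>v. (\<tau> has_vector_derivative v) (at x) \<and>
      kobayashi_royden U (\<tau> x) v \<le> m)"
    using neg by blast
  moreover have "abs_continuous_on {0..T} \<tau>"
    unfolding \<tau>_def
  proof (rule abs_continuous_on_compose_mono[OF _ gmono])
    show "abs_continuous_on {a..b} \<sigma>" using sp by (simp add: speed_le_def)
    show "g ` {0..T} \<subseteq> {a..b}" using g(1) by (intro image_subsetI)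
  qed
  moreover have "\<tau> ` {0..T} \<subseteq> U" using img sp by (simp add: speed_le_def)
  ultimately have sp\<tau>: "speed_le U (\<lambda>_. m) 0 T \<tau>" unfolding speed_le_def by (intro conjI)
  have "\<bar>x - y\<bar> / m - (c + A * pi) \<le> kobayashi_dist U (\<tau> x) (\<tau> y)" if xy: "x \<in> {0..T}" "y \<in> {0..T}" for x y
  proof -
    have "\<bar>x - y\<bar> \<le> \<bar>g x - g y\<bar> + A * pi"
      using upp[of "g x" "g y"] upp[of "g y" "g x"] g(2)[OF xy(1)] g(2)[OF xy(2)] by linarith
    then have "\<bar>x - y\<bar> / m \<le> (\<bar>g x - g y\<bar> + A * pi) / m" using m by (intro divide_right_mono) auto
    also have "\<dots> = \<bar>g x - g y\<bar> / m + A * pi / m" by (rule add_divide_distrib)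
    also have "A * pi / m \<le> A * pi" using m A mult_left_mono[of 1 m "A * pi"] by (simp add: field_simps)
    finally show ?thesis using low[OF g(1)[OF xy(1)] g(1)[OF xy(2)]] by (simp add: \<tau>_def)
  qed
  then have "almost_geodesic U m (c + A * pi) {0..T} \<tau>"
    by (intro almost_geodesicI[OF U sp\<tau> m]) (use A c in simp)
  then show ?thesis using T img ends by blast
qed

section \<open>Localization near a boundary point\<close>

text \<open>Around a limit in \<Omega>, a closed ball would be a compact set that the sequence does
  not leave.\<close>

lemma notin_of_tendsto_of_leaves_compacts:
  fixes x :: "nat \<Rightarrow> 'a::heine_borel"
  assumes "open \<Omega>" and x: "x \<longlonglongrightarrow> q"
    and avoid: "\<And>K. compact K \<Longrightarrow> K \<subseteq> \<Omega> \<Longrightarrow> eventually (\<lambda>n. x n \<notin> K) sequentially"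
  shows "q \<notin> \<Omega>"
proof
  assume "q \<in> \<Omega>"
  then obtain e where e: "0 < e" "cball q e \<subseteq> \<Omega>"
    using assms(1) by (auto simp: open_contains_cball)
  have "eventually (\<lambda>n. dist (x n) q < e) sequentially" by (rule tendstoD[OF x e(1)])
  moreover have "eventually (\<lambda>n. x n \<notin> cball q e) sequentially"
    by (rule avoid[OF compact_cball e(2)])
  ultimately have "eventually (\<lambda>n. False) sequentially"
    by eventually_elim (simp add: dist_commute)
  then show False by simp
qed

text \<open>A point off \<open>closure (frontier U \<inter> \<Omega>)\<close> has such a radius. In
  the ball the frontier of \<open>U\<close> does not meet \<Omega>, so a connected piece of
  \<open>\<Omega> \<inter> cball p r\<close> lies entirely in \<open>U\<close> or entirely
  outside.\<close>

locale boundary_chart =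
  fixes \<Omega> U :: "(complex ^ 'd) set" and p :: "complex ^ 'd" and r :: real
  assumes domain: "is_domain \<Omega>" and hyperbolic: "kobayashi_hyperbolic \<Omega>" and BSP: "BSP \<Omega>"
    and chart: "is_domain U" "U \<subseteq> \<Omega>" and r_pos: "0 < r"
    and disjoint: "cball p r \<inter> closure (frontier U \<inter> \<Omega>) = {}"
begin

lemma open_domain: "open \<Omega>" "open U"
  using domain chart by (auto simp: is_domain_def)

lemma connected_subset_chart:
  assumes "connected S" "S \<subseteq> \<Omega> \<inter> cball p r" "S \<inter> U \<noteq> {}"
  shows "S \<subseteq> U"
proof (rule ccontr)
  assume "\<not> S \<subseteq> U"
  then have "S \<inter> frontier U \<noteq> {}" using assms by (intro connected_Int_frontier) auto
  then obtain x where "x \<in> S" "x \<in> frontier U" by blast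
  then have "x \<in> closure (frontier U \<inter> \<Omega>)" "x \<in> cball p r"
    using assms(2) closure_subset[of "frontier U \<inter> \<Omega>"] by blast+
  then show False using disjoint by blast
qed

text \<open>The crossing lemma is applied to \<open>U \<inter> ball p r\<close>. A frontier point of
  this set in \<Omega> and inside the ball would be a frontier point of \<open>U\<close>, which
  \<open>disjoint\<close> forbids; so a path cannot leave the chart without first leaving the
  ball.\<close>

lemma ex_crossing_point_sphere:
  assumes z: "z \<in> U \<inter> cball p r1" and r1: "r1 < r" and w: "w \<in> \<Omega> - U" and e: "0 < e"
  shows "\<exists>x \<in> \<Omega> - ball p r. kobayashi_dist \<Omega> z x < kobayashi_dist \<Omega> z w + e"
proof -
  have "dist p z < r" using z r1 by auto
  then obtain x where x: "x \<in> \<Omega> \<inter> frontier (U \<inter> ball p r)"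
    "kobayashi_dist \<Omega> z x + kobayashi_dist \<Omega> x w < kobayashi_dist \<Omega> z w + e"
    using ex_crossing_point[OF domain _ _ e, of z "U \<inter> ball p r" w] z w chart by auto
  have "x \<notin> ball p r"
  proof
    assume b: "x \<in> ball p r"
    have "x \<in> closure (U \<inter> ball p r)" using x(1) by (simp add: frontier_def)
    then have "x \<in> closure U" by (rule subsetD[OF closure_mono, rotated]) simp
    moreover have "x \<notin> frontier U"
    proof
      assume "x \<in> frontier U"
      then have "x \<in> closure (frontier U \<inter> \<Omega>)" using x(1) by (intro subsetD[OF closure_subset]) simp
      moreover have "x \<in> cball p r" using b by simp
      ultimately show False using disjoint by blast
    qed
    ultimately have "x \<in> U" using open_domain by (simp add: frontier_def interior_open)
    moreover have "x \<notin> U \<inter> ball p r"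
      using x(1) open_domain by (simp add: frontier_def interior_open open_Int)
    ultimately show False using b by blast
  qed
  moreover have "kobayashi_dist \<Omega> z x < kobayashi_dist \<Omega> z w + e"
    using x(2) kobayashi_dist_nonneg[OF domain, of x w] by linarith
  ultimately show ?thesis using x(1) by blast
qed

text \<open>This is where BSP enters: the way out of the chart leads across an annulus around
  \<open>p\<close>.\<close>

lemma chart_distance_pos:
  assumes "r1 < r"
  shows "\<exists>\<delta>>0. \<forall>z\<in>U \<inter> cball p r1. \<forall>w\<in>\<Omega> - U. \<delta> \<le> kobayashi_dist \<Omega> z w"
proof -
  obtain \<delta> where \<delta>: "0 < \<delta>" "\<And>z w. z \<in> \<Omega> \<inter> cball p r1 \<Longrightarrow> w \<in> \<Omega> - ball p r \<Longrightarrow> \<delta> \<le> kobayashi_dist \<Omega> z w"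
    using kobayashi_dist_bounded_below_annulus[OF domain hyperbolic BSP assms, of p] by blast
  have "\<delta> \<le> kobayashi_dist \<Omega> z w" if z: "z \<in> U \<inter> cball p r1" and w: "w \<in> \<Omega> - U" for z w
  proof (rule field_le_epsilon)
    fix e :: real assume "0 < e"
    from ex_crossing_point_sphere[OF z assms w this] obtain x where
      x: "x \<in> \<Omega> - ball p r" "kobayashi_dist \<Omega> z x < kobayashi_dist \<Omega> z w + e" by blast
    have "z \<in> \<Omega> \<inter> cball p r1" using z chart(2) by blast
    from \<delta>(2)[OF this x(1)] x(2) show "\<delta> \<le> kobayashi_dist \<Omega> z w + e" by linarith
  qed
  then show ?thesis using \<delta>(1) by blast
qed

text \<open>The bound \<open>D\<close> for the distance to \<open>\<Omega> - U\<close> may vary with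
  time: a constant serves ordinary visibility, a linearly growing one the case \<lambda> =
  1.\<close>

lemma speed_le_chart:
  assumes sp: "speed_le \<Omega> (\<lambda>_. l) a b \<sigma>" and img: "\<sigma> ` {a..b} \<subseteq> U"
    and D: "\<And>t. t \<in> {a..b} \<Longrightarrow> 0 < D t \<and> (\<forall>w\<in>\<Omega> - U. D t \<le> kobayashi_dist \<Omega> (\<sigma> t) w) \<and> l / tanh (D t) \<le> m t"
  shows "speed_le U m a b \<sigma>"
proof -
  obtain N where N: "negligible N" "\<And>t. t \<in> {a<..<b} - N \<Longrightarrow>
      \<exists>v. (\<sigma> has_vector_derivative v) (at t) \<and> kobayashi_royden \<Omega> (\<sigma> t) v \<le> l"
    using sp by (auto simp: speed_le_def)
  have "\<exists>v. (\<sigma> has_vector_derivative v) (at t) \<and> kobayashi_royden U (\<sigma> t) v \<le> m t"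
    if t: "t \<in> {a<..<b} - N" for t
  proof -
    obtain v where v: "(\<sigma> has_vector_derivative v) (at t)" "kobayashi_royden \<Omega> (\<sigma> t) v \<le> l"
      using N(2)[OF t] by blast
    have t': "t \<in> {a..b}" using t by auto
    have Dt: "0 < D t" "\<And>w. w \<in> \<Omega> - U \<Longrightarrow> D t \<le> kobayashi_dist \<Omega> (\<sigma> t) w" "l / tanh (D t) \<le> m t"
      using D[OF t'] by auto
    have "\<sigma> t \<in> U" using img t' by blast
    from kobayashi_royden_localization[OF open_domain(1) chart(2) this Dt(1,2)]
    have "kobayashi_royden U (\<sigma> t) v \<le> kobayashi_royden \<Omega> (\<sigma> t) v / tanh (D t)" .
    also have "\<dots> \<le> l / tanh (D t)" using v(2) Dt(1) by (intro divide_right_mono) auto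
    also have "\<dots> \<le> m t" by (rule Dt(3))
    finally show ?thesis using v(1) by blast
  qed
  then have "\<exists>N. negligible N \<and> (\<forall>t\<in>{a<..<b} - N. \<exists>v. (\<sigma> has_vector_derivative v) (at t) \<and>
      kobayashi_royden U (\<sigma> t) v \<le> m t)" using N(1) by blast
  then show ?thesis using sp img unfolding speed_le_def by (intro conjI) simp_all
qed

text \<open>Almost-geodesics of the chart with separated endpoints cannot leave every compact set: limits of
  the endpoints would be a pair of shared boundary points that is not visible.\<close>
lemma visible_contradiction:
  fixes \<tau> :: "nat \<Rightarrow> real \<Rightarrow> complex ^ 'd"
  assumes vis: "\<And>q q'. q \<in> shared_boundary U \<Omega> \<Longrightarrow> q' \<in> shared_boundary U \<Omega> \<Longrightarrow> q \<noteq> q' \<Longrightarrow>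
      lambda_visible_pair U l (Pt q) (Pt q')" and c: "0 < c"
    and ag: "\<And>n. 0 \<le> T n \<and> almost_geodesic U l c {0..T n} (\<tau> n)"
    and img: "\<And>n. \<tau> n ` {0..T n} \<subseteq> cball p r"
    and avoid: "\<And>K. compact K \<Longrightarrow> K \<subseteq> \<Omega> \<Longrightarrow> eventually (\<lambda>n. \<tau> n ` {0..T n} \<inter> K = {}) sequentially"
    and far: "\<And>n. \<eta> \<le> dist (\<tau> n 0) (\<tau> n (T n))" "0 < \<eta>"
  shows False
proof -
  have T: "0 \<in> {0..T n}" "T n \<in> {0..T n}" for n using ag[of n] by auto
  have inU: "\<tau> n t \<in> U" if "t \<in> {0..T n}" for n t
    using ag[of n] that by (auto simp: almost_geodesic_def)
  have "seq_compact (cball p r \<times> cball p r)"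
    by (intro compact_imp_seq_compact compact_Times compact_cball)
  moreover have "\<forall>n. (\<tau> n 0, \<tau> n (T n)) \<in> cball p r \<times> cball p r"
    using subsetD[OF img imageI[OF T(1)]] subsetD[OF img imageI[OF T(2)]] by simp
  ultimately obtain l' f where f: "strict_mono (f :: nat \<Rightarrow> nat)" and l': "l' \<in> cball p r \<times> cball p r"
    and lim: "((\<lambda>n. (\<tau> n 0, \<tau> n (T n))) \<circ> f) \<longlonglongrightarrow> l'"
    by (rule seq_compactE)
  define q q' where "q = fst l'" and "q' = snd l'"
  have q: "(\<lambda>n. \<tau> (f n) 0) \<longlonglongrightarrow> q" and q': "(\<lambda>n. \<tau> (f n) (T (f n))) \<longlonglongrightarrow> q'"
    using tendsto_fst[OF lim] tendsto_snd[OF lim] by (auto simp: q_def q'_def o_def)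
  have "(\<lambda>n. dist (\<tau> (f n) 0) (\<tau> (f n) (T (f n)))) \<longlonglongrightarrow> dist q q'" by (intro tendsto_dist q q')
  then have "\<eta> \<le> dist q q'"
    by (rule tendsto_lowerbound) (simp_all add: far(1))
  then have ne: "q \<noteq> q'" using far(2) by auto
  \<comment> \<open>The curves leave every compact set, so the limit is outside \<Omega> and thus on
    both frontiers; lying in the ball, it avoids the closure removed in
    \<open>shared_boundary\<close>.\<close>
  have shared: "y \<in> shared_boundary U \<Omega>"
    if y: "y \<in> cball p r" and u: "\<And>n. u n \<in> {0..T (f n)}" and lim: "(\<lambda>n. \<tau> (f n) (u n)) \<longlonglongrightarrow> y" for y u
  proof -
    have "y \<notin> \<Omega>"
    proof (rule notin_of_tendsto_of_leaves_compacts[OF open_domain(1) lim])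
      fix K assume "compact K" "K \<subseteq> \<Omega>"
      then have "eventually (\<lambda>n. \<tau> n ` {0..T n} \<inter> K = {}) sequentially" by (rule avoid)
      then have "eventually (\<lambda>n. \<tau> (f n) ` {0..T (f n)} \<inter> K = {}) sequentially"
        by (rule eventually_subseq[OF f])
      then show "eventually (\<lambda>n. \<tau> (f n) (u n) \<notin> K) sequentially"
        by (rule eventually_mono) (use u in blast)
    qed
    moreover have "y \<in> closure U"
      by (rule closed_sequentially[OF closed_closure _ lim]) (intro allI subsetD[OF closure_subset] inU u)
    moreover have "closure U \<subseteq> closure \<Omega>" using chart(2) by (rule closure_mono)
    ultimately have "y \<in> frontier U" "y \<in> frontier \<Omega>"
      using chart(2) open_domain by (auto simp: frontier_def interior_open)
    moreover have "y \<notin> closure (frontier U \<inter> \<Omega>)" using y disjoint by blast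
    ultimately show ?thesis by (simp add: shared_boundary_def)
  qed
  have "q \<in> shared_boundary U \<Omega>" 
    by (rule shared[OF _ T(1) q]) (use l' in \<open>simp add: q_def mem_Times_iff\<close>)
  moreover have "q' \<in> shared_boundary U \<Omega>" 
    by (rule shared[OF _ T(2) q']) (use l' in \<open>simp add: q'_def mem_Times_iff\<close>)
  ultimately have "lambda_visible_pair U l (Pt q) (Pt q')" using ne by (rule vis)
  then have "visible_pair_const U l c (Pt q) (Pt q')" using c by (simp add: lambda_visible_pair_def)
  then obtain V W K where V: "end_nhd U (Pt q) V" and W: "end_nhd U (Pt q') W"
    and K: "compact K" "K \<subseteq> U"
    and meet: "\<forall>T\<ge>0. \<forall>\<sigma>. almost_geodesic U l c {0..T} \<sigma> \<and> Pt (\<sigma> 0) \<in> V \<and> Pt (\<sigma> T) \<in> W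
      \<longrightarrow> \<sigma> ` {0..T} \<inter> K \<noteq> {}"
    unfolding visible_pair_const_def by (elim exE conjE)
  obtain e where e: "0 < e" "Pt ` (ball q e \<inter> closure U) \<subseteq> V" using V by (auto simp: end_nhd_def)
  obtain e' where e': "0 < e'" "Pt ` (ball q' e' \<inter> closure U) \<subseteq> W" using W by (auto simp: end_nhd_def)
  have "eventually (\<lambda>n. dist (\<tau> (f n) 0) q < e) sequentially" by (rule tendstoD[OF q e(1)])
  moreover have "eventually (\<lambda>n. dist (\<tau> (f n) (T (f n))) q' < e') sequentially" by (rule tendstoD[OF q' e'(1)])
  moreover have "eventually (\<lambda>n. \<tau> (f n) ` {0..T (f n)} \<inter> K = {}) sequentially"
    using K chart(2) by (intro eventually_subseq[OF f] avoid) auto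
  ultimately have "eventually (\<lambda>n. False) sequentially"
  proof eventually_elim
    case (elim n)
    have "\<tau> (f n) 0 \<in> ball q e \<inter> closure U"
      using elim(1) subsetD[OF closure_subset inU[OF T(1)[of "f n"]]] by (simp add: dist_commute)
    then have "Pt (\<tau> (f n) 0) \<in> V" by (intro subsetD[OF e(2)] imageI)
    moreover have "\<tau> (f n) (T (f n)) \<in> ball q' e' \<inter> closure U"
      using elim(2) subsetD[OF closure_subset inU[OF T(2)[of "f n"]]] by (simp add: dist_commute)
    then have "Pt (\<tau> (f n) (T (f n))) \<in> W" by (intro subsetD[OF e'(2)] imageI)
    ultimately show ?case using meet[rule_format, of "T (f n)" "\<tau> (f n)"] ag[of "f n"] elim(3) by simp
  qed
  then show False by simp
qed

text \<open>The same for curves whose speed in the chart exceeds \<open>m\<close> by an integrable amount; they become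
  almost-geodesics of the chart after a reparametrization.\<close>
lemma visible_contradiction_speed:
  fixes \<sigma> :: "nat \<Rightarrow> real \<Rightarrow> complex ^ 'd"
  assumes vis: "\<And>q q'. q \<in> shared_boundary U \<Omega> \<Longrightarrow> q' \<in> shared_boundary U \<Omega> \<Longrightarrow> q \<noteq> q' \<Longrightarrow>
      lambda_visible_pair U m (Pt q) (Pt q')" and m: "1 \<le> m" and c: "0 < c" and A: "0 \<le> A"
    and ab: "\<And>n. a n \<le> b n"
    and sp: "\<And>n. speed_le U (\<lambda>t. m * (1 + A / (1 + (t - t0 n)\<^sup>2))) (a n) (b n) (\<sigma> n)"
    and low: "\<And>n s t. s \<in> {a n..b n} \<Longrightarrow> t \<in> {a n..b n} \<Longrightarrow> \<bar>s - t\<bar> / m - c \<le> kobayashi_dist \<Omega> (\<sigma> n s) (\<sigma> n t)"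
    and img: "\<And>n. \<sigma> n ` {a n..b n} \<subseteq> cball p r"
    and avoid: "\<And>K. compact K \<Longrightarrow> K \<subseteq> \<Omega> \<Longrightarrow> eventually (\<lambda>n. \<sigma> n ` {a n..b n} \<inter> K = {}) sequentially"
    and far: "\<And>n. \<eta> \<le> dist (\<sigma> n (a n)) (\<sigma> n (b n))" "0 < \<eta>"
  shows False
proof -
  have "\<exists>T \<tau>. 0 \<le> T \<and> almost_geodesic U m (c + A * pi) {0..T} \<tau> \<and> \<tau> ` {0..T} = \<sigma> n ` {a n..b n} \<and>
    \<tau> 0 = \<sigma> n (a n) \<and> \<tau> T = \<sigma> n (b n)" for n
  proof (rule speed_le_reparametrize[OF chart(1) ab sp A m])
    fix s t assume st: "s \<in> {a n..b n}" "t \<in> {a n..b n}"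
    have "\<sigma> n s \<in> U" "\<sigma> n t \<in> U" using sp[of n] st by (auto simp: speed_le_def)
    \<comment> \<open>A lower bound for the distance of \<Omega> holds a fortiori for that of
      \<open>U\<close>.\<close>
    from kobayashi_dist_mono[OF chart this] low[OF st]
    show "\<bar>s - t\<bar> / m - c \<le> kobayashi_dist U (\<sigma> n s) (\<sigma> n t)" by linarith
  qed (use c in simp)
  then have "\<forall>n. \<exists>T \<tau>. 0 \<le> T \<and> almost_geodesic U m (c + A * pi) {0..T} \<tau> \<and> \<tau> ` {0..T} = \<sigma> n ` {a n..b n} \<and>
    \<tau> 0 = \<sigma> n (a n) \<and> \<tau> T = \<sigma> n (b n)" by blast
  from choice[OF this] obtain T where "\<forall>n. \<exists>\<tau>. 0 \<le> T n \<and> almost_geodesic U m (c + A * pi) {0..T n} \<tau> \<and>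
    \<tau> ` {0..T n} = \<sigma> n ` {a n..b n} \<and> \<tau> 0 = \<sigma> n (a n) \<and> \<tau> (T n) = \<sigma> n (b n)" by blast
  from choice[OF this] obtain \<tau> where \<tau>: "\<And>n. 0 \<le> T n \<and> almost_geodesic U m (c + A * pi) {0..T n} (\<tau> n)"
    "\<And>n. \<tau> n ` {0..T n} = \<sigma> n ` {a n..b n}" "\<And>n. \<tau> n 0 = \<sigma> n (a n)" "\<And>n. \<tau> n (T n) = \<sigma> n (b n)"
    by blast
  have "0 < c + A * pi" using c A by (simp add: add_pos_nonneg)
  show False
  proof (rule visible_contradiction[OF vis \<open>0 < c + A * pi\<close> \<tau>(1)])
    show "\<tau> n ` {0..T n} \<subseteq> cball p r" for n unfolding \<tau>(2) by (rule img)
    show "eventually (\<lambda>n. \<tau> n ` {0..T n} \<inter> K = {}) sequentially" if "compact K" "K \<subseteq> \<Omega>" for K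
      unfolding \<tau>(2) by (rule avoid[OF that])
    show "\<eta> \<le> dist (\<tau> n 0) (\<tau> n (T n))" for n unfolding \<tau>(3,4) by (rule far(1))
  qed (simp_all add: far(2))
qed

end

section \<open>Subarcs from near a point to a sphere around it, and escape inside a chart\<close>

lemma ex_first_exit:
  fixes \<sigma> :: "real \<Rightarrow> 'a::metric_space"
  assumes \<sigma>: "continuous_on {s..u} \<sigma>" and s: "dist p (\<sigma> s) \<le> \<rho>" and t: "t \<in> {s..u}" "\<rho> \<le> dist p (\<sigma> t)"
  shows "\<exists>b\<in>{s..u}. \<sigma> ` {s..b} \<subseteq> cball p \<rho> \<and> dist p (\<sigma> b) = \<rho>"
proof -
  \<comment> \<open>The least element of this compact set is the first arrival at the sphere; the
    intermediate value theorem excludes an earlier excursion beyond it.\<close>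
  define X where "X = {x \<in> {s..u}. dist p (\<sigma> x) = \<rho>}"
  have d: "continuous_on {s..u} (\<lambda>x. dist p (\<sigma> x))" using \<sigma> by (intro continuous_intros)
  have ivt: "\<exists>x\<in>{s..y}. dist p (\<sigma> x) = \<rho>" if "y \<in> {s..u}" "\<rho> \<le> dist p (\<sigma> y)" for y
  proof -
    have "continuous_on {s..y} (\<lambda>x. dist p (\<sigma> x))" using d by (rule continuous_on_subset) (use that in auto)
    from IVT'[OF s that(2) _ this] that(1) show ?thesis by auto
  qed
  obtain x where "x \<in> {s..t}" "dist p (\<sigma> x) = \<rho>" using ivt[OF t] by blast
  then have "x \<in> X" using t(1) by (simp add: X_def)
  then have "X \<noteq> {}" by blast
  moreover have "compact X"
  proof -
    have "X = {s..u} \<inter> (\<lambda>x. dist p (\<sigma> x)) -` {\<rho>}" by (auto simp: X_def)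
    moreover have "closed ({s..u} \<inter> (\<lambda>x. dist p (\<sigma> x)) -` {\<rho>})"
      by (rule continuous_closed_preimage[OF d]) auto
    ultimately have "closed X" "X \<subseteq> {s..u}" by auto
    then show ?thesis using compact_Int_closed[of "{s..u}" X] by (simp add: Int_absorb1)
  qed
  ultimately obtain b where b: "b \<in> X" "\<And>x. x \<in> X \<Longrightarrow> b \<le> x"
    using compact_attains_inf[of X] by blast
  have bu: "b \<in> {s..u}" "dist p (\<sigma> b) = \<rho>" using b(1) by (auto simp: X_def)
  have "\<sigma> y \<in> cball p \<rho>" if y: "y \<in> {s..b}" for y
  proof (rule ccontr)
    assume "\<sigma> y \<notin> cball p \<rho>"
    then have gt: "\<rho> < dist p (\<sigma> y)" by simp
    moreover have yu: "y \<in> {s..u}" using y bu by auto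
    ultimately obtain x where x: "x \<in> {s..y}" "dist p (\<sigma> x) = \<rho>" using ivt[of y] by auto
    have "x \<in> X" using x yu by (auto simp: X_def)
    then have "b \<le> x" by (rule b(2))
    then have "y = b" using x y by auto
    then show False using gt bu by simp
  qed
  then show ?thesis using bu by blast
qed

text \<open>If the far time \<open>u\<close> precedes \<open>s\<close>, the curve is run backwards.
  Starting within half the radius keeps the two ends apart, and \<open>s\<close> is retained because
  the curve will be known to lie in the chart at that time.\<close>

lemma ex_subarc_to_sphere:
  fixes \<sigma> :: "real \<Rightarrow> 'a::metric_space"
  assumes \<sigma>: "continuous_on {c..d} \<sigma>" and s: "s \<in> {c..d}" "dist p (\<sigma> s) \<le> \<rho> / 2"
    and u: "u \<in> {c..d}" "\<rho> \<le> dist p (\<sigma> u)" and \<rho>: "0 < \<rho>"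
  shows "\<exists>a b. a \<le> b \<and> {a..b} \<subseteq> {c..d} \<and> \<sigma> ` {a..b} \<subseteq> cball p \<rho> \<and> \<rho> / 2 \<le> dist (\<sigma> a) (\<sigma> b) \<and> s \<in> {a..b}"
proof (cases "s \<le> u")
  case True
  have "continuous_on {s..u} \<sigma>" using \<sigma> by (rule continuous_on_subset) (use s u in auto)
  then obtain b where b: "b \<in> {s..u}" "\<sigma> ` {s..b} \<subseteq> cball p \<rho>" "dist p (\<sigma> b) = \<rho>"
    using ex_first_exit[of s u \<sigma> p \<rho> u] s u True \<rho> by auto
  have "\<rho> / 2 \<le> dist (\<sigma> s) (\<sigma> b)" using dist_triangle[of p "\<sigma> b" "\<sigma> s"] b(3) s(2) by linarith
  then show ?thesis using b s u True by (intro exI[of _ s] exI[of _ b]) auto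
next
  case False
  have "continuous_on {-s..-u} (\<lambda>x. \<sigma> (- x))"
    using False s u by (intro continuous_on_compose2[OF \<sigma>] continuous_intros) auto
  then obtain b where b: "b \<in> {-s..-u}" "(\<lambda>x. \<sigma> (- x)) ` {-s..b} \<subseteq> cball p \<rho>" "dist p (\<sigma> (- b)) = \<rho>"
    using ex_first_exit[of "-s" "-u" "\<lambda>x. \<sigma> (- x)" p \<rho> "-u"] s u False \<rho> by auto
  have "\<sigma> t \<in> cball p \<rho>" if "t \<in> {-b..s}" for t
  proof -
    have "- t \<in> {-s..b}" using that by auto
    from subsetD[OF b(2) imageI[OF this]] show ?thesis by simp
  qed
  then have "\<sigma> ` {-b..s} \<subseteq> cball p \<rho>" by blast
  moreover have "\<rho> / 2 \<le> dist (\<sigma> (- b)) (\<sigma> s)"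
    using dist_triangle[of p "\<sigma> (- b)" "\<sigma> s"] b(3) s(2) dist_commute[of "\<sigma> s" "\<sigma> (- b)"] by linarith
  ultimately show ?thesis using b(1) s u False by (intro exI[of _ "- b"] exI[of _ s]) auto
qed

text \<open>It replaces an attained minimum; the slack 1 disappears in additive constants.\<close>

lemma ex_near_minimum:
  fixes f :: "'a \<Rightarrow> real"
  assumes "S \<noteq> {}" "\<And>x. x \<in> S \<Longrightarrow> 0 \<le> f x"
  shows "\<exists>x\<in>S. \<forall>y\<in>S. f x \<le> f y + 1"
proof -
  have bdd: "bdd_below (f ` S)" using assms(2) by (intro bdd_belowI[of _ 0]) blast
  obtain x where x: "x \<in> S" "f x < Inf (f ` S) + 1"
    using cInf_lessD[of "f ` S" "Inf (f ` S) + 1"] assms(1) by auto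
  have "f x \<le> f y + 1" if "y \<in> S" for y
    using cInf_lower[OF imageI[OF that] bdd] x(2) by linarith
  then show ?thesis using x(1) by blast
qed

context boundary_chart
begin

text \<open>If the paths realising the distance from points near \<open>p\<close> to the complement of the chart stayed
  far from \<open>o'\<close>, then they would contradict visibility in the chart.\<close>
lemma chart_distance_ge:
  assumes vis: "\<And>q q'. q \<in> shared_boundary U \<Omega> \<Longrightarrow> q' \<in> shared_boundary U \<Omega> \<Longrightarrow> q \<noteq> q' \<Longrightarrow>
      lambda_visible_pair U 1 (Pt q) (Pt q')" and o': "o' \<in> \<Omega>"
  shows "\<exists>C. \<forall>z\<in>U \<inter> cball p (r/4). \<forall>w\<in>\<Omega> - U. kobayashi_dist \<Omega> z o' - C \<le> kobayashi_dist \<Omega> z w"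
proof (rule ccontr)
  assume neg: "\<not> ?thesis"
  obtain \<delta> where \<delta>: "0 < \<delta>" "\<And>z w. z \<in> U \<inter> cball p (r/2) \<Longrightarrow> w \<in> \<Omega> - U \<Longrightarrow> \<delta> \<le> kobayashi_dist \<Omega> z w"
    using chart_distance_pos[of "r/2"] r_pos by auto
  \<comment> \<open>The 2 is the slack 1 of the near-closest exit point \<open>w'\<close> plus the
    slack 1 of the path leading to it.\<close>
  obtain A where A: "0 \<le> A" "\<And>s. 1 / tanh (max \<delta> (\<bar>s\<bar> / 2 - 2)) \<le> 1 + A / (1 + s\<^sup>2)"
    using coth_bound[OF \<delta>(1), of 2] by blast
  \<comment> \<open>The excess of speed is centred at the time \<open>l\<close> of arrival outside
    \<open>U\<close>, which comes after the subarc \<open>{0..b}\<close> has ended on the sphere of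
    radius \<open>r/2\<close>.\<close>
  define Q where "Q n \<gamma> l b \<longleftrightarrow> 0 \<le> b \<and> speed_le U (\<lambda>t. 1 * (1 + A / (1 + (t - l)\<^sup>2))) 0 b \<gamma> \<and>
      (\<forall>s\<in>{0..b}. \<forall>t\<in>{0..b}. \<bar>s - t\<bar> / 1 - 1 \<le> kobayashi_dist \<Omega> (\<gamma> s) (\<gamma> t)) \<and>
      \<gamma> ` {0..b} \<subseteq> cball p r \<and> (\<forall>t\<in>{0..b}. real n - 2 < kobayashi_dist \<Omega> o' (\<gamma> t)) \<and>
      r / 4 \<le> dist (\<gamma> 0) (\<gamma> b)" for n \<gamma> l b
  have "\<exists>\<gamma> l b. Q n \<gamma> l b" for n
  proof -
    obtain z w where z: "z \<in> U \<inter> cball p (r/4)" and w: "w \<in> \<Omega> - U"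
      and zw: "kobayashi_dist \<Omega> z w < kobayashi_dist \<Omega> z o' - real n"
      using neg unfolding not_le[symmetric] by blast
    have z\<Omega>: "z \<in> \<Omega>" using z chart(2) by blast
    obtain w' where w': "w' \<in> \<Omega> - U" "\<And>y. y \<in> \<Omega> - U \<Longrightarrow> kobayashi_dist \<Omega> z w' \<le> kobayashi_dist \<Omega> z y + 1"
      using ex_near_minimum[of "\<Omega> - U" "kobayashi_dist \<Omega> z"] w kobayashi_dist_nonneg[OF domain] by blast
    obtain \<gamma> l where l: "0 \<le> l" "l < kobayashi_dist \<Omega> z w' + 1" and sp: "speed_le \<Omega> (\<lambda>_. 1) 0 l \<gamma>"
      and ends: "\<gamma> 0 = z" "\<gamma> l = w'"
      and low: "\<forall>s\<in>{0..l}. \<forall>t\<in>{0..l}. \<bar>s - t\<bar> - 1 \<le> kobayashi_dist \<Omega> (\<gamma> s) (\<gamma> t)"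
      by (rule ex_near_minimal_path[OF domain z\<Omega> DiffD1[OF w'(1)] zero_less_one]) blast
    have cont: "continuous_on {0..l} \<gamma>" and in\<Omega>: "\<gamma> ` {0..l} \<subseteq> \<Omega>"
      using sp by (auto simp: speed_le_def intro: abs_continuous_on_imp_continuous_on)
    \<comment> \<open>A path confined to the half ball would remain in \<open>U\<close>, yet it ends
      at \<open>w'\<close> outside.\<close>
    have "\<exists>t\<in>{0..l}. r/2 \<le> dist p (\<gamma> t)"
    proof (rule ccontr)
      assume near: "\<not> (\<exists>t\<in>{0..l}. r/2 \<le> dist p (\<gamma> t))"
      have "\<gamma> x \<in> \<Omega> \<inter> cball p r" if "x \<in> {0..l}" for x
      proof -
        have "\<not> r/2 \<le> dist p (\<gamma> x)" using near that by blast
        moreover have "\<gamma> x \<in> \<Omega>" using in\<Omega> that by blast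
        ultimately show ?thesis using r_pos by simp
      qed
      then have "\<gamma> ` {0..l} \<subseteq> \<Omega> \<inter> cball p r" by (rule image_subsetI)
      moreover have "connected (\<gamma> ` {0..l})" using cont by (intro connected_continuous_image) auto
      moreover have "\<gamma> 0 \<in> \<gamma> ` {0..l}" using l by auto
      then have "\<gamma> ` {0..l} \<inter> U \<noteq> {}" using z ends by blast
      ultimately have "\<gamma> ` {0..l} \<subseteq> U" by (intro connected_subset_chart)
      moreover have "\<gamma> l \<in> \<gamma> ` {0..l}" using l by auto
      ultimately show False using ends w'(1) by blast
    qed
    then obtain t where t: "t \<in> {0..l}" "r/2 \<le> dist p (\<gamma> t)" by blast
    have zp: "dist p (\<gamma> 0) \<le> r/4" using z ends by simp
    then obtain b where b: "b \<in> {0..l}" "\<gamma> ` {0..b} \<subseteq> cball p (r/2)" "dist p (\<gamma> b) = r/2"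
      using ex_first_exit[OF cont _ t] r_pos by auto
    have b0: "0 \<le> b" "{0..b} \<subseteq> {0..l}" using b(1) by auto
    have sub: "cball p (r/2) \<subseteq> cball p r" using r_pos by (intro subset_cball) simp
    have inU: "\<gamma> ` {0..b} \<subseteq> U"
    proof (rule connected_subset_chart)
      show "connected (\<gamma> ` {0..b})"
        using continuous_on_subset[OF cont b0(2)] by (intro connected_continuous_image) auto
      show "\<gamma> ` {0..b} \<subseteq> \<Omega> \<inter> cball p r"
        using order_trans[OF b(2) sub] order_trans[OF image_mono[OF b0(2)] in\<Omega>] by (rule Int_greatest[rotated])
      have "\<gamma> 0 \<in> \<gamma> ` {0..b}" using b0 by auto
      then show "\<gamma> ` {0..b} \<inter> U \<noteq> {}" using z ends by blast
    qed
    have kt: "kobayashi_dist \<Omega> z (\<gamma> t) \<le> t" if "t \<in> {0..l}" for t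
      using kobayashi_dist_le_of_speed_le_abs[OF domain sp, of 0 t] that l ends by auto
    have "speed_le U (\<lambda>t. 1 * (1 + A / (1 + (t - l)\<^sup>2))) 0 b \<gamma>"
    proof (rule speed_le_chart[where l = 1 and D = "\<lambda>t. max \<delta> (\<bar>t - l\<bar> / 2 - 2)"])
      show "speed_le \<Omega> (\<lambda>_. 1) 0 b \<gamma>" using b(1) by (intro speed_le_subinterval[OF sp]) auto
      fix t assume t: "t \<in> {0..b}"
      have tl: "t \<in> {0..l}" using t b0 by blast
      then have "t \<le> l" "\<bar>t - l\<bar> = l - t" by auto
      have \<gamma>t: "\<gamma> t \<in> U \<inter> cball p (r/2)" using t inU b(2) by blast
      have "max \<delta> (\<bar>t - l\<bar> / 2 - 2) \<le> kobayashi_dist \<Omega> (\<gamma> t) w" if w: "w \<in> \<Omega> - U" for w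
      proof -
        have "kobayashi_dist \<Omega> z w \<le> kobayashi_dist \<Omega> z (\<gamma> t) + kobayashi_dist \<Omega> (\<gamma> t) w"
          using \<gamma>t w chart(2) z\<Omega> by (intro kobayashi_dist_triangle[OF domain]) auto
        \<comment> \<open>Minimality of the path alone: up to the slack, it cannot be nearer to
          \<open>\<Omega> - U\<close> than its remaining time.\<close>
        then have "\<bar>t - l\<bar> - 2 \<le> kobayashi_dist \<Omega> (\<gamma> t) w"
          using kt[OF tl] w'(2)[OF w] l(2) \<open>\<bar>t - l\<bar> = l - t\<close> \<open>t \<le> l\<close> by linarith
        \<comment> \<open>The slope 1 obtained here is halved to match
          \<open>coth_bound\<close>.\<close>
        moreover have half: "x / 2 - 2 \<le> y" if "x - 2 \<le> y" "0 \<le> x" for x y :: real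
          using that by linarith
        ultimately have "\<bar>t - l\<bar> / 2 - 2 \<le> kobayashi_dist \<Omega> (\<gamma> t) w"
          by (intro half) simp_all
        then show ?thesis using \<delta>(2)[OF \<gamma>t w] by simp
      qed
      then show "0 < max \<delta> (\<bar>t - l\<bar> / 2 - 2) \<and> (\<forall>w\<in>\<Omega> - U. max \<delta> (\<bar>t - l\<bar> / 2 - 2) \<le> kobayashi_dist \<Omega> (\<gamma> t) w) \<and>
        1 / tanh (max \<delta> (\<bar>t - l\<bar> / 2 - 2)) \<le> 1 * (1 + A / (1 + (t - l)\<^sup>2))"
        using \<delta>(1) A(2)[of "t - l"] by auto
    qed (rule inU)
    \<comment> \<open>By the two slacks and the failing inequality, the path is shorter than
      \<open>kobayashi_dist \<Omega> z o' - n + 2\<close>, so none of its points comes within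
      \<open>n - 2\<close> of \<open>o'\<close>. Since this distance is bounded on compact sets, the
      paths escape.\<close>
    moreover have "real n - 2 < kobayashi_dist \<Omega> o' (\<gamma> t)" if t: "t \<in> {0..b}" for t
    proof -
      have tl: "t \<in> {0..l}" using t b0 by blast
      have "kobayashi_dist \<Omega> z o' \<le> kobayashi_dist \<Omega> z (\<gamma> t) + kobayashi_dist \<Omega> (\<gamma> t) o'"
        using in\<Omega> tl z\<Omega> o' by (intro kobayashi_dist_triangle[OF domain]) auto
      then show ?thesis
        using kt[OF tl] tl l(2) w'(2)[OF w] zw by (simp add: kobayashi_dist_commute[of \<Omega> o'])
    qed
    moreover have "\<gamma> ` {0..b} \<subseteq> cball p r" using b(2) sub by (rule order_trans)
    moreover have "r / 4 \<le> dist (\<gamma> 0) (\<gamma> b)"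
      using dist_triangle[of p "\<gamma> b" "\<gamma> 0"] b(3) zp by linarith
    ultimately show ?thesis using b0 low unfolding Q_def by (intro exI[of _ \<gamma>] exI[of _ l] exI[of _ b]) auto
  qed
  then obtain \<gamma> l b where Q: "\<And>n. Q n (\<gamma> n) (l n) (b n)" by metis
  show False
  proof (rule visible_contradiction_speed[OF vis order_refl zero_less_one A(1), where a = "\<lambda>_. 0" and b = b and \<sigma> = \<gamma> and ?t0.0 = l and \<eta> = "r/4"])
    fix K assume K: "compact K" "K \<subseteq> \<Omega>"
    have "compact (kobayashi_dist \<Omega> o' ` K)"
      by (rule compact_continuous_image[OF continuous_on_subset[OF continuous_on_kobayashi_dist[OF domain o'] K(2)] K(1)])
    then have "bounded (kobayashi_dist \<Omega> o' ` K)" by (rule compact_imp_bounded)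
    then obtain M where "\<forall>y\<in>kobayashi_dist \<Omega> o' ` K. norm y \<le> M" unfolding bounded_iff by blast
    then have M: "kobayashi_dist \<Omega> o' x \<le> M" if "x \<in> K" for x using that by fastforce
    obtain n0 :: nat where n0: "M + 2 \<le> real n0" using real_arch_simple by blast
    show "eventually (\<lambda>n. \<gamma> n ` {0..b n} \<inter> K = {}) sequentially"
      unfolding eventually_sequentially
    proof (intro exI[of _ n0] allI impI)
      fix n assume n: "n0 \<le> n"
      show "\<gamma> n ` {0..b n} \<inter> K = {}"
      proof (rule ccontr)
        assume "\<gamma> n ` {0..b n} \<inter> K \<noteq> {}"
        then obtain t where t: "t \<in> {0..b n}" "\<gamma> n t \<in> K" by blast
        have "real n - 2 < kobayashi_dist \<Omega> o' (\<gamma> n t)" using Q[of n] t(1) by (simp add: Q_def)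
        then show False using M[OF t(2)] n0 n by linarith
      qed
    qed
  qed (use Q r_pos in \<open>simp_all add: Q_def\<close>)
qed

lemma weak_visibility_contradiction:
  fixes \<sigma> :: "nat \<Rightarrow> real \<Rightarrow> complex ^ 'd"
  assumes vis: "\<And>q q'. q \<in> shared_boundary U \<Omega> \<Longrightarrow> q' \<in> shared_boundary U \<Omega> \<Longrightarrow> q \<noteq> q' \<Longrightarrow>
      lambda_visible_pair U 1 (Pt q) (Pt q')" and c: "0 < c"
    and ab: "\<And>n. a n \<le> b n" and sp: "\<And>n. speed_le \<Omega> (\<lambda>_. 1) (a n) (b n) (\<sigma> n)"
    and low: "\<And>n s t. s \<in> {a n..b n} \<Longrightarrow> t \<in> {a n..b n} \<Longrightarrow> \<bar>s - t\<bar> - c \<le> kobayashi_dist \<Omega> (\<sigma> n s) (\<sigma> n t)"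
    and img: "\<And>n. \<sigma> n ` {a n..b n} \<subseteq> U \<inter> cball p (r/4)"
    and avoid: "\<And>K. compact K \<Longrightarrow> K \<subseteq> \<Omega> \<Longrightarrow> eventually (\<lambda>n. \<sigma> n ` {a n..b n} \<inter> K = {}) sequentially"
    and far: "\<And>n. \<eta> \<le> dist (\<sigma> n (a n)) (\<sigma> n (b n))" "0 < \<eta>"
  shows False
proof -
  obtain o' where o': "o' \<in> \<Omega>" using domain by (auto simp: is_domain_def)
  obtain C where C: "\<And>z w. z \<in> U \<inter> cball p (r/4) \<Longrightarrow> w \<in> \<Omega> - U \<Longrightarrow>
      kobayashi_dist \<Omega> z o' - C \<le> kobayashi_dist \<Omega> z w"
    using chart_distance_ge[OF vis o'] by blast
  obtain \<delta> where \<delta>: "0 < \<delta>" "\<And>z w. z \<in> U \<inter> cball p (r/4) \<Longrightarrow> w \<in> \<Omega> - U \<Longrightarrow> \<delta> \<le> kobayashi_dist \<Omega> z w"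
    using chart_distance_pos[of "r/4"] r_pos by auto
  \<comment> \<open>By the triangle inequality through \<open>o'\<close> and the choice of
    \<open>t0\<close>, the time elapsed since \<open>t0\<close> is at most \<open>c + 1\<close> plus
    twice the distance to \<open>o'\<close>. Solving for that distance produces the slope 1/2;
    \<open>C\<close> is the loss in \<open>chart_distance_ge\<close>.\<close>
  define C' where "C' = (c + 1) / 2 + C"
  obtain A where A: "0 \<le> A" "\<And>s. 1 / tanh (max \<delta> (\<bar>s\<bar> / 2 - C')) \<le> 1 + A / (1 + s\<^sup>2)"
    using coth_bound[OF \<delta>(1), of C'] by blast
  have "\<exists>t0\<in>{a n..b n}. \<forall>t\<in>{a n..b n}. kobayashi_dist \<Omega> (\<sigma> n t0) o' \<le> kobayashi_dist \<Omega> (\<sigma> n t) o' + 1" for n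
    using ab[of n] by (intro ex_near_minimum kobayashi_dist_nonneg[OF domain]) auto
  then obtain t0 where t0: "\<And>n. t0 n \<in> {a n..b n}"
    "\<And>n t. t \<in> {a n..b n} \<Longrightarrow> kobayashi_dist \<Omega> (\<sigma> n (t0 n)) o' \<le> kobayashi_dist \<Omega> (\<sigma> n t) o' + 1"
    by metis
  have \<sigma>U: "\<sigma> n t \<in> U \<inter> cball p (r/4)" if "t \<in> {a n..b n}" for n t using img that by blast
  have spU: "speed_le U (\<lambda>t. 1 * (1 + A / (1 + (t - t0 n)\<^sup>2))) (a n) (b n) (\<sigma> n)" for n
  proof (rule speed_le_chart[where l = 1 and D = "\<lambda>t. max \<delta> (\<bar>t - t0 n\<bar> / 2 - C')"])
    fix t assume t: "t \<in> {a n..b n}"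
    have "max \<delta> (\<bar>t - t0 n\<bar> / 2 - C') \<le> kobayashi_dist \<Omega> (\<sigma> n t) w" if w: "w \<in> \<Omega> - U" for w
    proof -
      have "kobayashi_dist \<Omega> (\<sigma> n t) (\<sigma> n (t0 n)) \<le> kobayashi_dist \<Omega> (\<sigma> n t) o' + kobayashi_dist \<Omega> o' (\<sigma> n (t0 n))"
        using \<sigma>U[OF t] \<sigma>U[OF t0(1)] chart(2) o' by (intro kobayashi_dist_triangle[OF domain]) auto
      then have *: "\<bar>t - t0 n\<bar> \<le> c + 1 + 2 * kobayashi_dist \<Omega> (\<sigma> n t) o'"
        using low[OF t t0(1)] t0(2)[OF t] kobayashi_dist_commute[of \<Omega> o' "\<sigma> n (t0 n)"] by simp
      have "x / 2 - C' \<le> y - C" if "x \<le> c + 1 + 2 * y" for x y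
        using that by (simp add: C'_def field_simps)
      from this[OF *] have "\<bar>t - t0 n\<bar> / 2 - C' \<le> kobayashi_dist \<Omega> (\<sigma> n t) w"
        using C[OF \<sigma>U[OF t] w] by (rule order_trans)
      then show ?thesis using \<delta>(2)[OF \<sigma>U[OF t] w] by simp
    qed
    then show "0 < max \<delta> (\<bar>t - t0 n\<bar> / 2 - C') \<and> (\<forall>w\<in>\<Omega> - U. max \<delta> (\<bar>t - t0 n\<bar> / 2 - C') \<le> kobayashi_dist \<Omega> (\<sigma> n t) w) \<and>
        1 / tanh (max \<delta> (\<bar>t - t0 n\<bar> / 2 - C')) \<le> 1 * (1 + A / (1 + (t - t0 n)\<^sup>2))"
      using \<delta>(1) A(2)[of "t - t0 n"] by auto
  qed (use sp img in auto)
  have "cball p (r/4) \<subseteq> cball p r" using r_pos by (intro subset_cball) simp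
  then have img': "\<sigma> n ` {a n..b n} \<subseteq> cball p r" for n using img[of n] by blast
  have low': "\<bar>s - t\<bar> / 1 - c \<le> kobayashi_dist \<Omega> (\<sigma> n s) (\<sigma> n t)" if "s \<in> {a n..b n}" "t \<in> {a n..b n}" for n s t
    using low[OF that] by simp
  show False
    by (rule visible_contradiction_speed[OF vis order_refl c A(1) ab spU low' img' avoid far])
qed

text \<open>With visibility for every multiplicative constant, the fixed lower bound
  \<open>\<delta>\<close> is enough: its coth goes into \<open>m\<close>, and no excess is left, so
  0 is taken for \<open>A\<close>.\<close>

lemma visibility_contradiction:
  fixes \<sigma> :: "nat \<Rightarrow> real \<Rightarrow> complex ^ 'd"
  assumes vis: "\<And>q q' m. q \<in> shared_boundary U \<Omega> \<Longrightarrow> q' \<in> shared_boundary U \<Omega> \<Longrightarrow> q \<noteq> q' \<Longrightarrow>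
      1 \<le> m \<Longrightarrow> lambda_visible_pair U m (Pt q) (Pt q')" and l: "1 \<le> l" and c: "0 < c"
    and ab: "\<And>n. a n \<le> b n" and sp: "\<And>n. speed_le \<Omega> (\<lambda>_. l) (a n) (b n) (\<sigma> n)"
    and low: "\<And>n s t. s \<in> {a n..b n} \<Longrightarrow> t \<in> {a n..b n} \<Longrightarrow> \<bar>s - t\<bar> / l - c \<le> kobayashi_dist \<Omega> (\<sigma> n s) (\<sigma> n t)"
    and img: "\<And>n. \<sigma> n ` {a n..b n} \<subseteq> U \<inter> cball p (r/4)"
    and avoid: "\<And>K. compact K \<Longrightarrow> K \<subseteq> \<Omega> \<Longrightarrow> eventually (\<lambda>n. \<sigma> n ` {a n..b n} \<inter> K = {}) sequentially"
    and far: "\<And>n. \<eta> \<le> dist (\<sigma> n (a n)) (\<sigma> n (b n))" "0 < \<eta>"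
  shows False
proof -
  obtain \<delta> where \<delta>: "0 < \<delta>" "\<And>z w. z \<in> U \<inter> cball p (r/4) \<Longrightarrow> w \<in> \<Omega> - U \<Longrightarrow> \<delta> \<le> kobayashi_dist \<Omega> z w"
    using chart_distance_pos[of "r/4"] r_pos by auto
  define m where "m = l / tanh \<delta>"
  have th: "0 < tanh \<delta>" "tanh \<delta> < 1" using \<delta>(1) by (auto simp: tanh_real_lt_1)
  have lm: "l \<le> m" using th l by (simp add: m_def pos_le_divide_eq)
  then have m: "1 \<le> m" using l by simp
  have spU: "speed_le U (\<lambda>t. m * (1 + 0 / (1 + (t - 0)\<^sup>2))) (a n) (b n) (\<sigma> n)" for n
  proof (rule speed_le_chart[where l = l and D = "\<lambda>_. \<delta>"])
    fix t assume "t \<in> {a n..b n}"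
    then have "\<sigma> n t \<in> U \<inter> cball p (r/4)" using img by blast
    then show "0 < \<delta> \<and> (\<forall>w\<in>\<Omega> - U. \<delta> \<le> kobayashi_dist \<Omega> (\<sigma> n t) w) \<and> l / tanh \<delta> \<le> m * (1 + 0 / (1 + (t - 0)\<^sup>2))"
      using \<delta> by (simp add: m_def)
  qed (use sp img in auto)
  have "cball p (r/4) \<subseteq> cball p r" using r_pos by (intro subset_cball) simp
  then have img': "\<sigma> n ` {a n..b n} \<subseteq> cball p r" for n using img[of n] by blast
  have low': "\<bar>s - t\<bar> / m - c \<le> kobayashi_dist \<Omega> (\<sigma> n s) (\<sigma> n t)" if "s \<in> {a n..b n}" "t \<in> {a n..b n}" for n s t
  proof -
    have "\<bar>s - t\<bar> / m \<le> \<bar>s - t\<bar> / l" using lm l by (intro divide_left_mono) auto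
    then show ?thesis using low[OF that] by linarith
  qed
  show False
    by (rule visible_contradiction_speed[OF vis[OF _ _ _ m] m c order_refl ab spU low' img' avoid far])
qed

lemma ex_subarcs_in_chart:
  fixes \<sigma> :: "nat \<Rightarrow> real \<Rightarrow> complex ^ 'd"
  assumes cont: "\<And>n. continuous_on {0..T n} (\<sigma> n)" and img: "\<And>n. \<sigma> n ` {0..T n} \<subseteq> \<Omega>"
    and s: "\<And>n. s n \<in> {0..T n}" "\<And>n. \<sigma> n (s n) \<in> U" "(\<lambda>n. \<sigma> n (s n)) \<longlonglongrightarrow> p"
    and u: "\<And>n. u n \<in> {0..T n}" "\<And>n. e \<le> dist p (\<sigma> n (u n))" and e: "0 < e"
  shows "\<exists>N a b \<eta>. 0 < \<eta> \<and> (\<forall>n. a n \<le> b n \<and> {a n..b n} \<subseteq> {0..T (n + N)} \<and>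
     \<sigma> (n + N) ` {a n..b n} \<subseteq> U \<inter> cball p (r/4) \<and> \<eta> \<le> dist (\<sigma> (n + N) (a n)) (\<sigma> (n + N) (b n)))"
proof -
  \<comment> \<open>At most \<open>r/4\<close> for the chart estimates, at most \<open>e\<close> so
    that the curves really reach the sphere.\<close>
  define \<rho> where "\<rho> = min (r/4) e"
  have \<rho>: "0 < \<rho>" "\<rho> \<le> e" "\<rho> \<le> r/4" using r_pos e by (auto simp: \<rho>_def)
  \<comment> \<open>The curves are close to \<open>p\<close> only eventually, which accounts for the
    shift of indices.\<close>
  obtain N where N: "\<And>n. N \<le> n \<Longrightarrow> dist (\<sigma> n (s n)) p < \<rho> / 2"
    using tendstoD[OF s(3), of "\<rho> / 2"] \<rho>(1) unfolding eventually_sequentially by auto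
  define Q where "Q n a b \<longleftrightarrow> a \<le> b \<and> {a..b} \<subseteq> {0..T (n + N)} \<and>
      \<sigma> (n + N) ` {a..b} \<subseteq> U \<inter> cball p (r/4) \<and>
      \<rho> / 2 \<le> dist (\<sigma> (n + N) a) (\<sigma> (n + N) b)" for n a b
  have "\<exists>a b. Q n a b" for n
  proof -
    let ?n = "n + N"
    have near: "dist p (\<sigma> ?n (s ?n)) \<le> \<rho> / 2" using N[of ?n] by (simp add: dist_commute)
    have far: "\<rho> \<le> dist p (\<sigma> ?n (u ?n))" using u(2)[of ?n] \<rho>(2) by linarith
    obtain a b where ab: "a \<le> b" "{a..b} \<subseteq> {0..T ?n}" "\<sigma> ?n ` {a..b} \<subseteq> cball p \<rho>"
      "\<rho> / 2 \<le> dist (\<sigma> ?n a) (\<sigma> ?n b)" "s ?n \<in> {a..b}"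
      using ex_subarc_to_sphere[OF cont s(1) near u(1) far \<rho>(1)] by blast
    have sub: "cball p \<rho> \<subseteq> cball p (r/4)" "cball p \<rho> \<subseteq> cball p r"
      using \<rho>(3) r_pos by (intro subset_cball; simp)+
    have "\<sigma> ?n ` {a..b} \<subseteq> U"
    proof (rule connected_subset_chart)
      show "connected (\<sigma> ?n ` {a..b})"
        using continuous_on_subset[OF cont ab(2)] by (intro connected_continuous_image) auto
      show "\<sigma> ?n ` {a..b} \<subseteq> \<Omega> \<inter> cball p r"
        by (intro Int_greatest order_trans[OF image_mono[OF ab(2)] img] order_trans[OF ab(3) sub(2)])
      show "\<sigma> ?n ` {a..b} \<inter> U \<noteq> {}" using s(2)[of ?n] imageI[OF ab(5), of "\<sigma> ?n"] by blast
    qed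
    then have "\<sigma> ?n ` {a..b} \<subseteq> U \<inter> cball p (r/4)"
      by (rule Int_greatest[OF _ order_trans[OF ab(3) sub(1)]])
    then have "Q n a b" unfolding Q_def using ab(1,2,4) by simp
    then show ?thesis by blast
  qed
  then obtain a b where "\<And>n. Q n (a n) (b n)" by metis
  then show ?thesis
    using \<rho>(1) by (intro exI[of _ N] exI[of _ a] exI[of _ b] exI[of _ "\<rho> / 2"]) (simp add: Q_def)
qed

end

section \<open>Ends and the global statement\<close>

text \<open>The failure of visibility is used for the n-th pair of neighbourhoods together with the
  n-th set of a compact exhaustion of \<Omega>; these sets eventually swallow every compact
  subset.\<close>

lemma ex_escaping_almost_geodesics:
  assumes \<Omega>: "open \<Omega>" and nv: "\<not> visible_pair_const \<Omega> l c \<zeta> \<eta>"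
    and V: "\<And>n. end_nhd \<Omega> \<zeta> (V n)" and W: "\<And>n. end_nhd \<Omega> \<eta> (W n)"
    and VW: "\<And>n. end_closure \<Omega> (V n) \<inter> end_closure \<Omega> (W n) = {}"
  shows "\<exists>\<sigma> T. (\<forall>n::nat. 0 \<le> T n \<and> almost_geodesic \<Omega> l c {0..T n} (\<sigma> n) \<and> Pt (\<sigma> n 0) \<in> V n \<and> Pt (\<sigma> n (T n)) \<in> W n) \<and>
    (\<forall>K. compact K \<longrightarrow> K \<subseteq> \<Omega> \<longrightarrow> eventually (\<lambda>n. \<sigma> n ` {0..T n} \<inter> K = {}) sequentially)"
proof -
  obtain C where C': "\<forall>n. compact (C n) \<and> C n \<subseteq> \<Omega>"
      "\<forall>K. compact K \<longrightarrow> K \<subseteq> \<Omega> \<longrightarrow> (\<exists>N::nat. \<forall>n\<ge>N. K \<subseteq> C n)"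
    by (rule open_Union_compact_subsets[OF \<Omega>]) blast
  then have C: "compact (C n)" "C n \<subseteq> \<Omega>" for n by blast+
  define Q where "Q n T \<sigma> \<longleftrightarrow> 0 \<le> T \<and> almost_geodesic \<Omega> l c {0..T} \<sigma> \<and> Pt (\<sigma> 0) \<in> V n \<and> Pt (\<sigma> T) \<in> W n \<and>
      \<sigma> ` {0..T} \<inter> C n = {}" for n T \<sigma>
  have "\<exists>T \<sigma>. Q n T \<sigma>" for n
  proof (rule ccontr)
    assume "\<not> (\<exists>T \<sigma>. Q n T \<sigma>)"
    then have "\<forall>T\<ge>0. \<forall>\<sigma>. almost_geodesic \<Omega> l c {0..T} \<sigma> \<and> Pt (\<sigma> 0) \<in> V n \<and> Pt (\<sigma> T) \<in> W n \<longrightarrow> \<sigma> ` {0..T} \<inter> C n \<noteq> {}"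
      unfolding Q_def by blast
    then have "visible_pair_const \<Omega> l c \<zeta> \<eta>"
      unfolding visible_pair_const_def
      by (intro exI[of _ "V n"] exI[of _ "W n"] exI[of _ "C n"] conjI V W VW C(1,2))
    then show False using nv by contradiction
  qed
  then obtain T \<sigma> where Q: "\<And>n. Q n (T n) (\<sigma> n)" by metis
  have "eventually (\<lambda>n. \<sigma> n ` {0..T n} \<inter> K = {}) sequentially" if K: "compact K" "K \<subseteq> \<Omega>" for K
  proof -
    obtain N where N: "\<forall>n\<ge>N. K \<subseteq> C n" using C'(2) K by blast
    have "\<sigma> n ` {0..T n} \<inter> K = {}" if "N \<le> n" for n
    proof -
      have "K \<subseteq> C n" using N that by blast
      moreover have "\<sigma> n ` {0..T n} \<inter> C n = {}" using Q[of n] by (simp add: Q_def)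
      ultimately show ?thesis by blast
    qed
    then show ?thesis unfolding eventually_sequentially by blast
  qed
  moreover have "0 \<le> T n \<and> almost_geodesic \<Omega> l c {0..T n} (\<sigma> n) \<and> Pt (\<sigma> n 0) \<in> V n \<and> Pt (\<sigma> n (T n)) \<in> W n" for n
    using Q[of n] by (simp add: Q_def)
  ultimately show ?thesis by (intro exI[of _ \<sigma>] exI[of _ T]) blast
qed

section \<open>Neighbourhoods and closures in the end compactification\<close>

lemma endsD:
  assumes "F \<in> ends \<Omega>"
  shows "F j \<in> components (closure \<Omega> - exhaustion \<Omega> j)" "F (Suc j) \<subseteq> F j"
  using assms by (auto simp: ends_def split: if_splits)

lemma ends_mono:
  assumes "F \<in> ends \<Omega>" "i \<le> j"
  shows "F j \<subseteq> F i"
  using assms(2) by (induction rule: dec_induct) (use endsD(2)[OF assms(1)] in blast)+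

lemma ends_mem:
  assumes "F \<in> ends \<Omega>" "y \<in> F j"
  shows "y \<in> closure \<Omega>" "real j < norm y"
proof -
  have "y \<in> closure \<Omega> - exhaustion \<Omega> j" using in_components_subset[OF endsD(1)[OF assms(1)]] assms(2) by blast
  then show "y \<in> closure \<Omega>" "real j < norm y" by (auto simp: exhaustion_def)
qed

lemma end_nhd_ball:
  assumes "p \<in> closure \<Omega>" "0 < e"
  shows "end_nhd \<Omega> (Pt p) (Pt ` (ball p e \<inter> closure \<Omega>))"
  using assms by (auto simp: end_nhd_def end_compactification_def)

lemma end_nhd_end_hat:
  assumes "F \<in> ends \<Omega>"
  shows "end_nhd \<Omega> (End F) (end_hat \<Omega> F j)"
  using assms ends_mem(1)[OF assms] by (auto simp: end_nhd_def end_compactification_def end_hat_def)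

lemma Pt_in_end_closureD:
  assumes "Pt x \<in> end_closure \<Omega> V" "0 < e"
  shows "\<exists>y. Pt y \<in> V \<and> dist x y < e"
proof -
  have "x \<in> closure \<Omega>" using assms(1) by (auto simp: end_closure_def end_compactification_def)
  from end_nhd_ball[OF this assms(2)] assms(1) show ?thesis by (force simp: end_closure_def)
qed

lemma End_in_end_closureD:
  assumes "End F \<in> end_closure \<Omega> V"
  shows "F \<in> ends \<Omega>" "end_hat \<Omega> F j \<inter> V \<noteq> {}"
proof -
  show F: "F \<in> ends \<Omega>" using assms by (auto simp: end_closure_def end_compactification_def)
  from end_nhd_end_hat[OF F] assms show "end_hat \<Omega> F j \<inter> V \<noteq> {}" by (auto simp: end_closure_def)
qed

text \<open>No end adheres to a bounded set, because \<open>F j\<close> lies outside the ball of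
  radius \<open>j\<close>.\<close>

lemma end_closure_ball:
  assumes "\<xi> \<in> end_closure \<Omega> (Pt ` (ball p e \<inter> closure \<Omega>))"
  shows "\<exists>x. \<xi> = Pt x \<and> dist p x \<le> e"
proof (cases \<xi>)
  case (Pt x)
  have "dist p x \<le> e"
  proof (rule field_le_epsilon)
    fix d :: real assume "0 < d"
    then obtain y where "dist p y < e" "dist x y < d"
      using Pt_in_end_closureD[of x \<Omega> _ d] assms Pt by fastforce
    then show "dist p x \<le> e + d" using dist_triangle[of p x y] dist_commute[of x y] by linarith
  qed
  then show ?thesis using Pt by simp
next
  case (End F)
  obtain j :: nat where j: "norm p + e \<le> real j" using real_arch_simple by blast
  obtain y where y: "y \<in> F j" "dist p y < e"
    using End_in_end_closureD(2)[OF assms[unfolded End], of j] by (auto simp: end_hat_def)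
  have "real j < norm y" by (rule ends_mem(2)[OF End_in_end_closureD(1)[OF assms[unfolded End]] y(1)])
  moreover have "norm y \<le> norm p + dist p y"
    using norm_triangle_ineq2[of y p] by (simp add: dist_norm norm_minus_commute)
  ultimately show ?thesis using y(2) j by linarith
qed

lemma ex_neighbourhoods_of_point:
  assumes p: "p \<in> closure \<Omega>" and \<xi>: "\<xi> \<in> end_compactification \<Omega>" "\<xi> \<noteq> Pt p"
  shows "\<exists>V W e. 0 < e \<and> (\<forall>n::nat. end_nhd \<Omega> (Pt p) (V n) \<and> end_nhd \<Omega> \<xi> (W n) \<and>
    end_closure \<Omega> (V n) \<inter> end_closure \<Omega> (W n) = {} \<and>
    (\<forall>y. Pt y \<in> V n \<longrightarrow> dist p y < 1 / real (Suc n)) \<and> (\<forall>y. Pt y \<in> W n \<longrightarrow> e \<le> dist p y))"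
proof (cases \<xi>)
  case (Pt q)
  \<comment> \<open>A third of the distance leaves a gap between the closed balls of radius
    \<open>e\<close>, which contain the closures.\<close>
  define e where "e = dist p q / 3"
  have e: "0 < e" "dist p q = 3 * e" using \<xi> Pt by (auto simp: e_def)
  have q: "q \<in> closure \<Omega>" using \<xi> Pt by (auto simp: end_compactification_def)
  define V where "V n = Pt ` (ball p (min e (1 / real (Suc n))) \<inter> closure \<Omega>)" for n
  define W where "W = Pt ` (ball q e \<inter> closure \<Omega>)"
  have "end_closure \<Omega> (V n) \<inter> end_closure \<Omega> W = {}" for n
  proof (rule ccontr)
    assume "end_closure \<Omega> (V n) \<inter> end_closure \<Omega> W \<noteq> {}"
    then obtain x where "dist p x \<le> min e (1 / real (Suc n))" "dist q x \<le> e"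
      using end_closure_ball[of _ \<Omega> p] end_closure_ball[of _ \<Omega> q] unfolding V_def W_def by blast
    then show False using e dist_triangle[of p q x] dist_commute[of x q] by simp
  qed
  moreover have "e \<le> dist p y" if "Pt y \<in> W" for y
  proof -
    have "dist q y < e" using that by (auto simp: W_def)
    then show ?thesis using e dist_triangle[of p q y] dist_commute[of y q] by linarith
  qed
  moreover have "end_nhd \<Omega> (Pt p) (V n)" "end_nhd \<Omega> \<xi> W" for n
    unfolding V_def W_def Pt using e(1) by (intro end_nhd_ball p q; simp)+
  moreover have "dist p y < 1 / real (Suc n)" if "Pt y \<in> V n" for n y
    using that by (auto simp: V_def)
  ultimately show ?thesis using e(1) by (intro exI[of _ V] exI[of _ "\<lambda>_. W"] exI[of _ e]) blast
next
  case (End F)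
  have F: "F \<in> ends \<Omega>" using \<xi> End by (auto simp: end_compactification_def)
  \<comment> \<open>The margin 2 consists of 1 for the ball around \<open>p\<close> and 1 for
    passing to the closure of the hat.\<close>
  obtain j :: nat where j: "norm p + 2 \<le> real j" using real_arch_simple by blast
  define V where "V n = Pt ` (ball p (1 / real (Suc n)) \<inter> closure \<Omega>)" for n
  define W where "W = end_hat \<Omega> F j"
  have far: "2 < dist p y" if "Pt y \<in> W" for y
  proof -
    have "y \<in> F j" using that by (auto simp: W_def end_hat_def)
    then have "real j < norm y" by (rule ends_mem(2)[OF F])
    moreover have "norm y \<le> norm p + dist p y"
      using norm_triangle_ineq2[of y p] by (simp add: dist_norm norm_minus_commute)
    ultimately show ?thesis using j by linarith
  qed
  have "end_closure \<Omega> (V n) \<inter> end_closure \<Omega> W = {}" for n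
  proof (rule ccontr)
    assume "end_closure \<Omega> (V n) \<inter> end_closure \<Omega> W \<noteq> {}"
    then obtain x where x: "dist p x \<le> 1 / real (Suc n)" "Pt x \<in> end_closure \<Omega> W"
      using end_closure_ball[of _ \<Omega> p] unfolding V_def by blast
    obtain y where y: "Pt y \<in> W" "dist x y < 1" using Pt_in_end_closureD[OF x(2), of 1] by auto
    have "1 / real (Suc n) \<le> 1" by simp
    then show False using x(1) y(2) far[OF y(1)] dist_triangle[of p y x] by linarith
  qed
  moreover have "end_nhd \<Omega> (Pt p) (V n)" "end_nhd \<Omega> \<xi> W" for n
    unfolding V_def W_def End using F by (auto intro: end_nhd_ball[OF p] end_nhd_end_hat)
  moreover have "dist p y < 1 / real (Suc n)" if "Pt y \<in> V n" for n y
    using that by (auto simp: V_def)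
  moreover have "2 \<le> dist p y" if "Pt y \<in> W" for y using far[OF that] by simp
  ultimately show ?thesis by (intro exI[of _ V] exI[of _ "\<lambda>_. W"] exI[of _ 2]) auto
qed

text \<open>The index shift is needed: the closure of \<open>F j\<close> may meet \<open>exhaustion \<Omega> j\<close>.\<close>
lemma end_closure_end_hat_Pt:
  assumes F: "F \<in> ends \<Omega>" and x: "Pt x \<in> end_closure \<Omega> (end_hat \<Omega> F (Suc j))"
  shows "x \<in> F j"
proof -
  have "\<exists>y\<in>F (Suc j). dist y x < e" if "0 < e" for e
    using Pt_in_end_closureD[OF x that] by (auto simp: end_hat_def dist_commute)
  then have x': "x \<in> closure (F (Suc j))" by (auto simp: closure_approachable)
  have ne: "F (Suc j) \<noteq> {}" and con: "connected (F (Suc j))"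
    using in_components_nonempty[OF endsD(1)[OF F]] in_components_connected[OF endsD(1)[OF F]] by auto
  have "closure (F (Suc j)) \<subseteq> closure \<Omega> - exhaustion \<Omega> j"
  proof
    fix y assume y: "y \<in> closure (F (Suc j))"
    have "F (Suc j) \<subseteq> closure \<Omega> \<inter> - ball 0 (real (Suc j))"
    proof
      fix x assume "x \<in> F (Suc j)"
      from ends_mem[OF F this] show "x \<in> closure \<Omega> \<inter> - ball 0 (real (Suc j))" by simp
    qed
    then have "closure (F (Suc j)) \<subseteq> closure \<Omega> \<inter> - ball 0 (real (Suc j))"
      by (intro closure_minimal closed_Int closed_closure) auto
    with y have "y \<in> closure \<Omega>" "real (Suc j) \<le> norm y" by (auto simp: not_less)
    then show "y \<in> closure \<Omega> - exhaustion \<Omega> j" by (simp add: exhaustion_def)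
  qed
  moreover have "F j \<inter> closure (F (Suc j)) \<noteq> {}"
    using ne endsD(2)[OF F, of j] closure_subset[of "F (Suc j)"] by blast
  ultimately have "closure (F (Suc j)) \<subseteq> F j"
    by (intro components_maximal[OF endsD(1)[OF F] connected_imp_connected_closure[OF con]])
  then show ?thesis using x' by blast
qed

text \<open>A common point of the two hats lies in components of level \<open>j\<close> of both
  ends, and components that meet coincide; a common end agrees with both at level
  \<open>j\<close>.\<close>

lemma end_closure_end_hat_End:
  assumes F: "F \<in> ends \<Omega>" and H: "End H \<in> end_closure \<Omega> (end_hat \<Omega> F (Suc j))"
  shows "H j = F j"
proof -
  have Hends: "H \<in> ends \<Omega>" using End_in_end_closureD(1)[OF H] .
  obtain \<xi> where \<xi>: "\<xi> \<in> end_hat \<Omega> H j" "\<xi> \<in> end_hat \<Omega> F (Suc j)"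
    using End_in_end_closureD(2)[OF H, of j] by blast
  show ?thesis
  proof (cases \<xi>)
    case (Pt y)
    then have "y \<in> H j" "y \<in> F j" using \<xi> endsD(2)[OF F, of j] by (auto simp: end_hat_def)
    then show ?thesis
      using components_nonoverlap[OF endsD(1)[OF Hends] endsD(1)[OF F], of j] by blast
  next
    case (End G)
    then show ?thesis using \<xi> by (auto simp: end_hat_def)
  qed
qed

lemma end_closures_disjoint:
  assumes F: "F \<in> ends \<Omega>" and G: "G \<in> ends \<Omega>" and ne: "F j \<noteq> G j"
  shows "end_closure \<Omega> (end_hat \<Omega> F (Suc j)) \<inter> end_closure \<Omega> (end_hat \<Omega> G (Suc j)) = {}"
proof (rule ccontr)
  assume "end_closure \<Omega> (end_hat \<Omega> F (Suc j)) \<inter> end_closure \<Omega> (end_hat \<Omega> G (Suc j)) \<noteq> {}"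
  then obtain \<xi> where \<xi>: "\<xi> \<in> end_closure \<Omega> (end_hat \<Omega> F (Suc j))" "\<xi> \<in> end_closure \<Omega> (end_hat \<Omega> G (Suc j))"
    by blast
  show False
  proof (cases \<xi>)
    case (Pt x)
    have "x \<in> F j" "x \<in> G j"
      using end_closure_end_hat_Pt[OF F] end_closure_end_hat_Pt[OF G] \<xi> Pt by blast+
    then show False using ne components_nonoverlap[OF endsD(1)[OF F] endsD(1)[OF G]] by blast
  next
    case (End H)
    then show False using end_closure_end_hat_End[OF F] end_closure_end_hat_End[OF G] \<xi> ne by metis
  qed
qed

lemma ends_neq_mono:
  assumes F: "F \<in> ends \<Omega>" and G: "G \<in> ends \<Omega>" and ne: "F i \<noteq> G i" and ij: "i \<le> j"
  shows "F j \<noteq> G j"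
proof
  assume eq: "F j = G j"
  obtain x where "x \<in> F j" using in_components_nonempty[OF endsD(1)[OF F]] by blast
  then have "x \<in> F i" "x \<in> G i" using ends_mono[OF F ij] ends_mono[OF G ij] eq by auto
  then show False using ne components_nonoverlap[OF endsD(1)[OF F] endsD(1)[OF G]] by blast
qed

text \<open>The common outcome of non-visibility for boundary points and ends: at the times
  \<open>s\<close> the curves approach \<open>p\<close>, at the times \<open>u\<close> they keep
  away from it. For two ends the times \<open>s\<close> are found in the interior of the curves'
  journey rather than prescribed as end points.\<close>

definition escapes_near ::
  "(complex ^ 'd) set \<Rightarrow> real \<Rightarrow> real \<Rightarrow> complex ^ 'd \<Rightarrow> (nat \<Rightarrow> real \<Rightarrow> complex ^ 'd) \<Rightarrow> (nat \<Rightarrow> real) \<Rightarrow>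
   (nat \<Rightarrow> real) \<Rightarrow> (nat \<Rightarrow> real) \<Rightarrow> real \<Rightarrow> bool"
  where "escapes_near \<Omega> l c p \<sigma> T s u e \<longleftrightarrow> p \<in> frontier \<Omega> \<and> 0 < e \<and>
    (\<forall>n. almost_geodesic \<Omega> l c {0..T n} (\<sigma> n) \<and> s n \<in> {0..T n} \<and> u n \<in> {0..T n} \<and> e \<le> dist p (\<sigma> n (u n))) \<and>
    (\<lambda>n. \<sigma> n (s n)) \<longlonglongrightarrow> p \<and>
    (\<forall>K. compact K \<longrightarrow> K \<subseteq> \<Omega> \<longrightarrow> eventually (\<lambda>n. \<sigma> n ` {0..T n} \<inter> K = {}) sequentially)"

lemma tendsto_of_dist_lt_inverse:
  assumes "\<And>n. dist p (x n) < 1 / real (Suc n)"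
  shows "x \<longlonglongrightarrow> p"
proof (rule metric_tendsto_imp_tendsto)
  show "(\<lambda>n. inverse (real (Suc n))) \<longlonglongrightarrow> 0" by (rule LIMSEQ_inverse_real_of_nat)
  show "eventually (\<lambda>n. dist (x n) p \<le> dist (inverse (real (Suc n))) 0) sequentially"
    using assms by (intro always_eventually allI) (simp add: dist_commute inverse_eq_divide less_imp_le)
qed

text \<open>If one of the two is a boundary point, it serves as \<open>p\<close>. For two ends, a
  curve between different components of \<open>closure \<Omega> - exhaustion \<Omega> i\<close> must
  enter the compact \<open>exhaustion \<Omega> i\<close>, where an accumulation point is
  found.\<close>

lemma not_visible_imp_escapes_near:
  assumes \<Omega>: "is_domain \<Omega>" and \<zeta>: "\<zeta> \<in> end_boundary \<Omega>" and \<eta>: "\<eta> \<in> end_boundary \<Omega>" and ne: "\<zeta> \<noteq> \<eta>"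
    and nv: "\<not> visible_pair_const \<Omega> l c \<zeta> \<eta>"
  shows "\<exists>p \<sigma> T s u e. escapes_near \<Omega> l c p \<sigma> T s u e"
proof -
  have op: "open \<Omega>" using \<Omega> by (simp add: is_domain_def)
  have fr: "p \<in> frontier \<Omega>" if "Pt p \<in> end_boundary \<Omega>" for p
    using that op by (auto simp: end_boundary_def end_compactification_def frontier_def interior_open)
  have comp: "\<zeta> \<in> end_compactification \<Omega>" "\<eta> \<in> end_compactification \<Omega>"
    using \<zeta> \<eta> by (auto simp: end_boundary_def)
  consider (left) p where "\<zeta> = Pt p" | (right) p where "\<eta> = Pt p" | (ends) F G where "\<zeta> = End F" "\<eta> = End G"
    by (cases \<zeta>; cases \<eta>) auto
  then show ?thesis
  proof cases
    case left
    have p: "p \<in> frontier \<Omega>" using fr \<zeta> left by blast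
    then have pc: "p \<in> closure \<Omega>" by (simp add: frontier_def)
    have "\<eta> \<noteq> Pt p" using ne left by simp
    from ex_neighbourhoods_of_point[OF pc comp(2) this] obtain V W e where e: "0 < e"
      and VW: "\<forall>n::nat. end_nhd \<Omega> (Pt p) (V n) \<and> end_nhd \<Omega> \<eta> (W n) \<and> end_closure \<Omega> (V n) \<inter> end_closure \<Omega> (W n) = {} \<and>
        (\<forall>y. Pt y \<in> V n \<longrightarrow> dist p y < 1 / real (Suc n)) \<and> (\<forall>y. Pt y \<in> W n \<longrightarrow> e \<le> dist p y)"
      by (elim exE conjE)
    have "\<exists>\<sigma> T. (\<forall>n::nat. 0 \<le> T n \<and> almost_geodesic \<Omega> l c {0..T n} (\<sigma> n) \<and> Pt (\<sigma> n 0) \<in> V n \<and> Pt (\<sigma> n (T n)) \<in> W n) \<and>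
      (\<forall>K. compact K \<longrightarrow> K \<subseteq> \<Omega> \<longrightarrow> eventually (\<lambda>n. \<sigma> n ` {0..T n} \<inter> K = {}) sequentially)"
      by (rule ex_escaping_almost_geodesics[OF op nv]) (use VW left in auto)
    then obtain \<sigma> T where ag: "\<forall>n. 0 \<le> T n \<and> almost_geodesic \<Omega> l c {0..T n} (\<sigma> n) \<and> Pt (\<sigma> n 0) \<in> V n \<and> Pt (\<sigma> n (T n)) \<in> W n"
      and avoid: "\<forall>K. compact K \<longrightarrow> K \<subseteq> \<Omega> \<longrightarrow> eventually (\<lambda>n. \<sigma> n ` {0..T n} \<inter> K = {}) sequentially"
      by (elim exE conjE)
    have "(\<lambda>n. \<sigma> n 0) \<longlonglongrightarrow> p" using VW ag by (intro tendsto_of_dist_lt_inverse) blast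
    moreover have "e \<le> dist p (\<sigma> n (T n))" for n using VW ag by blast
    ultimately have "escapes_near \<Omega> l c p \<sigma> T (\<lambda>_. 0) T e"
      using p e ag avoid unfolding escapes_near_def by simp
    then show ?thesis by blast
  next
    case right
    have p: "p \<in> frontier \<Omega>" using fr \<eta> right by blast
    then have pc: "p \<in> closure \<Omega>" by (simp add: frontier_def)
    have "\<zeta> \<noteq> Pt p" using ne right by simp
    from ex_neighbourhoods_of_point[OF pc comp(1) this] obtain V W e where e: "0 < e"
      and VW: "\<forall>n::nat. end_nhd \<Omega> (Pt p) (V n) \<and> end_nhd \<Omega> \<zeta> (W n) \<and> end_closure \<Omega> (V n) \<inter> end_closure \<Omega> (W n) = {} \<and>
        (\<forall>y. Pt y \<in> V n \<longrightarrow> dist p y < 1 / real (Suc n)) \<and> (\<forall>y. Pt y \<in> W n \<longrightarrow> e \<le> dist p y)"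
      by (elim exE conjE)
    have "\<exists>\<sigma> T. (\<forall>n::nat. 0 \<le> T n \<and> almost_geodesic \<Omega> l c {0..T n} (\<sigma> n) \<and> Pt (\<sigma> n 0) \<in> W n \<and> Pt (\<sigma> n (T n)) \<in> V n) \<and>
      (\<forall>K. compact K \<longrightarrow> K \<subseteq> \<Omega> \<longrightarrow> eventually (\<lambda>n. \<sigma> n ` {0..T n} \<inter> K = {}) sequentially)"
      by (rule ex_escaping_almost_geodesics[OF op nv]) (use VW right in \<open>auto simp: Int_commute\<close>)
    then obtain \<sigma> T where ag: "\<forall>n. 0 \<le> T n \<and> almost_geodesic \<Omega> l c {0..T n} (\<sigma> n) \<and> Pt (\<sigma> n 0) \<in> W n \<and> Pt (\<sigma> n (T n)) \<in> V n"
      and avoid: "\<forall>K. compact K \<longrightarrow> K \<subseteq> \<Omega> \<longrightarrow> eventually (\<lambda>n. \<sigma> n ` {0..T n} \<inter> K = {}) sequentially"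
      by (elim exE conjE)
    have "(\<lambda>n. \<sigma> n (T n)) \<longlonglongrightarrow> p" using VW ag by (intro tendsto_of_dist_lt_inverse) blast
    moreover have "e \<le> dist p (\<sigma> n 0)" for n using VW ag by blast
    ultimately have "escapes_near \<Omega> l c p \<sigma> T T (\<lambda>_. 0) e"
      using p e ag avoid unfolding escapes_near_def by simp
    then show ?thesis by blast
  next
    case ends
    have F: "F \<in> ends \<Omega>" and G: "G \<in> ends \<Omega>"
      using comp ends by (auto simp: end_compactification_def)
    obtain i where i: "F i \<noteq> G i" using ne ends by fastforce
    \<comment> \<open>The two ends differ at every level from \<open>i\<close> on; the successor
      makes the closures of the hats disjoint as well.\<close>
    have "\<exists>\<sigma> T. (\<forall>n::nat. 0 \<le> T n \<and> almost_geodesic \<Omega> l c {0..T n} (\<sigma> n) \<and>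
        Pt (\<sigma> n 0) \<in> end_hat \<Omega> F (Suc (i + n)) \<and> Pt (\<sigma> n (T n)) \<in> end_hat \<Omega> G (Suc (i + n))) \<and>
      (\<forall>K. compact K \<longrightarrow> K \<subseteq> \<Omega> \<longrightarrow> eventually (\<lambda>n. \<sigma> n ` {0..T n} \<inter> K = {}) sequentially)"
      by (rule ex_escaping_almost_geodesics[OF op nv], unfold ends)
        (intro end_nhd_end_hat F G end_closures_disjoint ends_neq_mono[OF F G i]; simp)+
    then obtain \<sigma> T where ag: "\<forall>n. 0 \<le> T n \<and> almost_geodesic \<Omega> l c {0..T n} (\<sigma> n) \<and>
        Pt (\<sigma> n 0) \<in> end_hat \<Omega> F (Suc (i + n)) \<and> Pt (\<sigma> n (T n)) \<in> end_hat \<Omega> G (Suc (i + n))"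
      and avoid: "\<forall>K. compact K \<longrightarrow> K \<subseteq> \<Omega> \<longrightarrow> eventually (\<lambda>n. \<sigma> n ` {0..T n} \<inter> K = {}) sequentially"
      by (elim exE conjE)
    have T: "0 \<le> T n" for n using ag by blast
    have in\<Omega>: "\<sigma> n ` {0..T n} \<subseteq> \<Omega>" for n using ag by (simp add: almost_geodesic_def)
    have cont: "continuous_on {0..T n} (\<sigma> n)" for n
      using ag by (intro abs_continuous_on_imp_continuous_on) (simp add: almost_geodesic_def)
    have \<sigma>0: "\<sigma> n 0 \<in> F (Suc (i + n))" and \<sigma>T: "\<sigma> n (T n) \<in> G (Suc (i + n))" for n
      using ag by (auto simp: end_hat_def)
    have "\<exists>s\<in>{0..T n}. norm (\<sigma> n s) \<le> real i" for n
    proof (rule ccontr)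
      assume neg: "\<not> (\<exists>s\<in>{0..T n}. norm (\<sigma> n s) \<le> real i)"
      have sub: "\<sigma> n ` {0..T n} \<subseteq> closure \<Omega> - exhaustion \<Omega> i"
      proof
        fix y assume "y \<in> \<sigma> n ` {0..T n}"
        then have "y \<in> \<Omega>" "\<not> norm y \<le> real i" using in\<Omega> neg by blast+
        then show "y \<in> closure \<Omega> - exhaustion \<Omega> i"
          using closure_subset[of \<Omega>] by (auto simp: exhaustion_def)
      qed
      have con: "connected (\<sigma> n ` {0..T n})" using cont by (intro connected_continuous_image) auto
      have "\<sigma> n 0 \<in> F i" using ends_mono[OF F, of i "Suc (i + n)"] \<sigma>0[of n] by auto
      moreover have im: "\<sigma> n 0 \<in> \<sigma> n ` {0..T n}" "\<sigma> n (T n) \<in> \<sigma> n ` {0..T n}" using T by auto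
      ultimately have "F i \<inter> \<sigma> n ` {0..T n} \<noteq> {}" by blast
      from components_maximal[OF endsD(1)[OF F] con sub this] im(2) have "\<sigma> n (T n) \<in> F i" by blast
      moreover have "\<sigma> n (T n) \<in> G i" using ends_mono[OF G, of i "Suc (i + n)"] \<sigma>T[of n] by auto
      ultimately show False using i components_nonoverlap[OF endsD(1)[OF F] endsD(1)[OF G]] by blast
    qed
    then have "\<forall>n. \<exists>s. s \<in> {0..T n} \<and> norm (\<sigma> n s) \<le> real i" by blast
    from choice[OF this] obtain s where s: "\<forall>n. s n \<in> {0..T n} \<and> norm (\<sigma> n (s n)) \<le> real i" by blast
    have "seq_compact (cball 0 (real i) :: (complex ^ 'a) set)" by (intro compact_imp_seq_compact compact_cball)
    moreover have "\<forall>n. \<sigma> n (s n) \<in> cball 0 (real i)" using s by simp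
    ultimately obtain p f where f: "strict_mono (f :: nat \<Rightarrow> nat)" and lim: "((\<lambda>n. \<sigma> n (s n)) \<circ> f) \<longlonglongrightarrow> p"
      by (rule seq_compactE)
    \<comment> \<open>As \<open>f n\<close> is at least \<open>n\<close>, dropping \<open>N\<close>
      terms puts the initial points outside the ball of radius \<open>norm p + 1\<close> around the
      origin.\<close>
    obtain N :: nat where N: "norm p + 1 \<le> real N" using real_arch_simple by blast
    define g where "g n = f (n + N)" for n
    have g: "strict_mono g" using f by (simp add: g_def strict_mono_def)
    have limg: "(\<lambda>n. \<sigma> (g n) (s (g n))) \<longlonglongrightarrow> p"
      using LIMSEQ_ignore_initial_segment[OF lim, of N] by (simp add: g_def o_def)
    have avoidg: "eventually (\<lambda>n. \<sigma> (g n) ` {0..T (g n)} \<inter> K = {}) sequentially" if "compact K" "K \<subseteq> \<Omega>" for K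
      using avoid that by (intro eventually_subseq[OF g, of "\<lambda>n. \<sigma> n ` {0..T n} \<inter> K = {}"]) blast
    have "p \<notin> \<Omega>"
    proof (rule notin_of_tendsto_of_leaves_compacts[OF op limg])
      fix K assume "compact K" "K \<subseteq> \<Omega>"
      from avoidg[OF this] show "eventually (\<lambda>n. \<sigma> (g n) (s (g n)) \<notin> K) sequentially"
        by (rule eventually_mono) (use s in blast)
    qed
    moreover have "p \<in> closure \<Omega>"
    proof (rule closed_sequentially[OF closed_closure _ limg])
      show "\<sigma> (g n) (s (g n)) \<in> closure \<Omega>" for n
        using s in\<Omega>[of "g n"] closure_subset[of \<Omega>] by blast
    qed
    ultimately have p: "p \<in> frontier \<Omega>" using op by (simp add: frontier_def interior_open)
    have far: "1 \<le> dist p (\<sigma> (g n) 0)" for n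
    proof -
      have "n + N \<le> g n" unfolding g_def by (rule seq_suble[OF f])
      then have "real N \<le> real (Suc (i + g n))" by simp
      also have "\<dots> < norm (\<sigma> (g n) 0)" by (rule ends_mem(2)[OF F \<sigma>0])
      finally have "real N < norm (\<sigma> (g n) 0)" .
      moreover have "norm (\<sigma> (g n) 0) \<le> norm p + dist p (\<sigma> (g n) 0)"
        using norm_triangle_ineq2[of "\<sigma> (g n) 0" p] by (simp add: dist_norm norm_minus_commute)
      ultimately show ?thesis using N by linarith
    qed
    have "escapes_near \<Omega> l c p (\<lambda>n. \<sigma> (g n)) (\<lambda>n. T (g n)) (\<lambda>n. s (g n)) (\<lambda>_. 0) 1"
      unfolding escapes_near_def using p far s ag T limg avoidg by simp
    then show ?thesis by blast
  qed
qed

text \<open>Membership of \<open>p\<close> in the shared boundary yields the radius of a chart, and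
  the subarcs inherit speed bound, lower estimate and escape from the full curves. The outcome fits
  both contradiction lemmas of the locale.\<close>

lemma escapes_near_subarcs:
  fixes \<Omega> :: "(complex ^ 'd) set" and k :: "nat \<Rightarrow> nat"
  assumes \<Omega>: "is_domain \<Omega>" "kobayashi_hyperbolic \<Omega>" "BSP \<Omega>" and esc: "escapes_near \<Omega> l c p \<sigma> T s u e"
    and U: "is_domain U" "U \<subseteq> \<Omega>" and k: "strict_mono k" and p: "p \<in> shared_boundary U \<Omega>"
    and inU: "\<And>n. \<sigma> (k n) (s (k n)) \<in> U"
  shows "\<exists>r (\<sigma>' :: nat \<Rightarrow> real \<Rightarrow> complex ^ 'd) a b \<eta>. boundary_chart \<Omega> U p r \<and> 0 < \<eta> \<and>
    (\<forall>n. a n \<le> b n \<and> speed_le \<Omega> (\<lambda>_. l) (a n) (b n) (\<sigma>' n) \<and>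
      (\<forall>s\<in>{a n..b n}. \<forall>t\<in>{a n..b n}. \<bar>s - t\<bar> / l - c \<le> kobayashi_dist \<Omega> (\<sigma>' n s) (\<sigma>' n t)) \<and>
      \<sigma>' n ` {a n..b n} \<subseteq> U \<inter> cball p (r/4) \<and> \<eta> \<le> dist (\<sigma>' n (a n)) (\<sigma>' n (b n))) \<and>
    (\<forall>K. compact K \<longrightarrow> K \<subseteq> \<Omega> \<longrightarrow> eventually (\<lambda>n. \<sigma>' n ` {a n..b n} \<inter> K = {}) sequentially)"
proof -
  have e: "0 < e" and esc': "\<And>n. almost_geodesic \<Omega> l c {0..T n} (\<sigma> n)" "\<And>n. s n \<in> {0..T n}"
      "\<And>n. u n \<in> {0..T n}" "\<And>n. e \<le> dist p (\<sigma> n (u n))" "(\<lambda>n. \<sigma> n (s n)) \<longlonglongrightarrow> p"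
    and avoid: "\<And>K. compact K \<Longrightarrow> K \<subseteq> \<Omega> \<Longrightarrow> eventually (\<lambda>n. \<sigma> n ` {0..T n} \<inter> K = {}) sequentially"
    using esc unfolding escapes_near_def by auto
  have "p \<in> - closure (frontier U \<inter> \<Omega>)" using p by (simp add: shared_boundary_def)
  then obtain r where r: "0 < r" "cball p r \<subseteq> - closure (frontier U \<inter> \<Omega>)"
    using open_contains_cball[of "- closure (frontier U \<inter> \<Omega>)"] by (auto simp: open_Compl)
  interpret boundary_chart \<Omega> U p r
    by unfold_locales (use \<Omega> U r in auto)
  have "\<exists>N a b \<eta>. 0 < \<eta> \<and> (\<forall>n. a n \<le> b n \<and> {a n..b n} \<subseteq> {0..(T \<circ> k) (n + N)} \<and>
     (\<sigma> \<circ> k) (n + N) ` {a n..b n} \<subseteq> U \<inter> cball p (r/4) \<and> \<eta> \<le> dist ((\<sigma> \<circ> k) (n + N) (a n)) ((\<sigma> \<circ> k) (n + N) (b n)))"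
  proof (rule ex_subarcs_in_chart[where s = "s \<circ> k" and u = "u \<circ> k" and e = e])
    show "continuous_on {0..(T \<circ> k) n} ((\<sigma> \<circ> k) n)" for n
      using esc'(1)[of "k n"] by (intro abs_continuous_on_imp_continuous_on) (simp add: almost_geodesic_def)
    show "(\<sigma> \<circ> k) n ` {0..(T \<circ> k) n} \<subseteq> \<Omega>" for n
      using esc'(1)[of "k n"] by (simp add: almost_geodesic_def)
    show "(\<lambda>n. (\<sigma> \<circ> k) n ((s \<circ> k) n)) \<longlonglongrightarrow> p"
      using LIMSEQ_subseq_LIMSEQ[OF esc'(5) k] by (simp add: o_def)
  qed (use esc'(2-4) e inU in simp_all)
  then obtain N a b \<eta> where \<eta>: "0 < \<eta>" and arcs: "\<And>n. a n \<le> b n \<and> {a n..b n} \<subseteq> {0..T (k (n + N))} \<and>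
     \<sigma> (k (n + N)) ` {a n..b n} \<subseteq> U \<inter> cball p (r/4) \<and> \<eta> \<le> dist (\<sigma> (k (n + N)) (a n)) (\<sigma> (k (n + N)) (b n))"
    unfolding o_def by blast
  have sub: "strict_mono (\<lambda>n. k (n + N))" using k by (simp add: strict_mono_def)
  have "speed_le \<Omega> (\<lambda>_. l) (a n) (b n) (\<sigma> (k (n + N)))" for n
  proof (rule speed_le_subinterval[OF almost_geodesic_imp_speed_le[OF esc'(1)]])
    have "a n \<in> {0..T (k (n + N))}" "b n \<in> {0..T (k (n + N))}" using arcs[of n] by auto
    then show "0 \<le> a n" "b n \<le> T (k (n + N))" by auto
  qed
  moreover have "\<bar>s - t\<bar> / l - c \<le> kobayashi_dist \<Omega> (\<sigma> (k (n + N)) s) (\<sigma> (k (n + N)) t)"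
    if "s \<in> {a n..b n}" "t \<in> {a n..b n}" for n s t
  proof -
    have "s \<in> {0..T (k (n + N))}" "t \<in> {0..T (k (n + N))}" using arcs[of n] that by blast+
    then show ?thesis using esc'(1)[of "k (n + N)"] by (simp add: almost_geodesic_def)
  qed
  moreover have "eventually (\<lambda>n. \<sigma> (k (n + N)) ` {a n..b n} \<inter> K = {}) sequentially" if K: "compact K" "K \<subseteq> \<Omega>" for K
  proof (rule eventually_mono[OF eventually_subseq[OF sub avoid[OF K]]])
    fix n assume "\<sigma> (k (n + N)) ` {0..T (k (n + N))} \<inter> K = {}"
    moreover have "{a n..b n} \<subseteq> {0..T (k (n + N))}" using arcs by blast
    ultimately show "\<sigma> (k (n + N)) ` {a n..b n} \<inter> K = {}" by blast
  qed
  ultimately show ?thesis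
    using boundary_chart_axioms \<eta> arcs
    by (intro exI[of _ r] exI[of _ "\<lambda>n. \<sigma> (k (n + N))"] exI[of _ a] exI[of _ b] exI[of _ \<eta>]) simp
qed

section \<open>The two implications between global and local visibility\<close>

lemma shared_boundary_self: "open \<Omega> \<Longrightarrow> shared_boundary \<Omega> \<Omega> = frontier \<Omega>"
proof -
  assume "open \<Omega>"
  then have "frontier \<Omega> \<inter> \<Omega> = {}" by (auto simp: frontier_def interior_open)
  then show ?thesis by (simp add: shared_boundary_def)
qed

lemma frontier_in_end_boundary:
  assumes "open \<Omega>" "q \<in> frontier \<Omega>"
  shows "Pt q \<in> end_boundary \<Omega>"
  using assms by (auto simp: end_boundary_def end_compactification_def frontier_def interior_open)

text \<open>The domain is its own chart, with the identity as subsequence: its shared boundary is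
  the whole frontier.\<close>

lemma visibility_domain_imp_local:
  assumes \<Omega>: "is_domain \<Omega>" and vis: "visibility_domain \<Omega>"
  shows "local_visibility_domain \<Omega>"
  unfolding local_visibility_domain_def
proof (intro ballI allI impI)
  fix p and x :: "nat \<Rightarrow> complex ^ 'a"
  assume p: "p \<in> frontier \<Omega>" and x: "(\<forall>n. x n \<in> \<Omega>) \<and> x \<longlonglongrightarrow> p"
  have op: "open \<Omega>" using \<Omega> by (simp add: is_domain_def)
  show "\<exists>U (r::nat \<Rightarrow> nat). is_domain U \<and> U \<subseteq> \<Omega> \<and> strict_mono r \<and>
           p \<in> shared_boundary U \<Omega> \<and> (\<forall>n. x (r n) \<in> U) \<and>
           (\<forall>q \<in> shared_boundary U \<Omega>. \<forall>q' \<in> shared_boundary U \<Omega>. q \<noteq> q' \<longrightarrow> visible_pair U (Pt q) (Pt q'))"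
    using vis p x frontier_in_end_boundary[OF op] \<Omega>
    by (intro exI[of _ \<Omega>] exI[of _ id])
      (simp add: shared_boundary_self[OF op] visibility_domain_def strict_mono_def)
qed

lemma weak_visibility_domain_imp_local:
  assumes \<Omega>: "is_domain \<Omega>" and vis: "weak_visibility_domain \<Omega>"
  shows "local_weak_visibility_domain \<Omega>"
  unfolding local_weak_visibility_domain_def
proof (intro ballI allI impI)
  fix p and x :: "nat \<Rightarrow> complex ^ 'a"
  assume p: "p \<in> frontier \<Omega>" and x: "(\<forall>n. x n \<in> \<Omega>) \<and> x \<longlonglongrightarrow> p"
  have op: "open \<Omega>" using \<Omega> by (simp add: is_domain_def)
  show "\<exists>U (r::nat \<Rightarrow> nat). is_domain U \<and> U \<subseteq> \<Omega> \<and> strict_mono r \<and>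
           p \<in> shared_boundary U \<Omega> \<and> (\<forall>n. x (r n) \<in> U) \<and>
           (\<forall>q \<in> shared_boundary U \<Omega>. \<forall>q' \<in> shared_boundary U \<Omega>. q \<noteq> q' \<longrightarrow> weakly_visible_pair U (Pt q) (Pt q'))"
    using vis p x frontier_in_end_boundary[OF op] \<Omega>
    by (intro exI[of _ \<Omega>] exI[of _ id])
      (simp add: shared_boundary_self[OF op] weak_visibility_domain_def strict_mono_def)
qed

lemma escapes_near_in:
  assumes "escapes_near \<Omega> l c p \<sigma> T s u e"
  shows "p \<in> frontier \<Omega>" "(\<forall>n. \<sigma> n (s n) \<in> \<Omega>) \<and> (\<lambda>n. \<sigma> n (s n)) \<longlonglongrightarrow> p"
  using assms unfolding escapes_near_def almost_geodesic_def by blast+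

lemma local_visibility_domain_imp_global:
  fixes \<Omega> :: "(complex ^ 'd) set"
  assumes \<Omega>: "is_domain \<Omega>" "kobayashi_hyperbolic \<Omega>" "BSP \<Omega>" and loc: "local_visibility_domain \<Omega>"
  shows "visibility_domain \<Omega>"
  unfolding visibility_domain_def visible_pair_def lambda_visible_pair_def
proof (intro ballI allI impI)
  fix \<zeta> \<eta> and l c :: real
  assume *: "\<zeta> \<in> end_boundary \<Omega>" "\<eta> \<in> end_boundary \<Omega>" "\<zeta> \<noteq> \<eta>" and l: "1 \<le> l" and c: "0 < c"
  show "visible_pair_const \<Omega> l c \<zeta> \<eta>"
  proof (rule ccontr)
    assume "\<not> visible_pair_const \<Omega> l c \<zeta> \<eta>"
    from not_visible_imp_escapes_near[OF \<Omega>(1) * this] obtain p \<sigma> T s u e where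
      esc: "escapes_near \<Omega> l c p \<sigma> T s u e" by (elim exE)
    \<comment> \<open>The chart offered by local visibility depends on the sequence. It is taken for
      the points of the curves at the times \<open>s\<close>, so that these curves meet the
      chart.\<close>
    from loc[unfolded local_visibility_domain_def, rule_format, OF escapes_near_in(1)[OF esc],
        of "\<lambda>n. \<sigma> n (s n)"] escapes_near_in(2)[OF esc]
    obtain U k where U: "is_domain U" "U \<subseteq> \<Omega>" "strict_mono (k :: nat \<Rightarrow> nat)" "p \<in> shared_boundary U \<Omega>"
      "\<And>n. \<sigma> (k n) (s (k n)) \<in> U" and vis: "\<And>q q'. q \<in> shared_boundary U \<Omega> \<Longrightarrow> q' \<in> shared_boundary U \<Omega> \<Longrightarrow> q \<noteq> q' \<Longrightarrow>
        visible_pair U (Pt q) (Pt q')" by blast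
    from escapes_near_subarcs[OF \<Omega> esc U(1-5)] obtain r \<sigma>' a b \<eta>' where
      bc: "boundary_chart \<Omega> U p r" and \<eta>': "0 < \<eta>'"
      and arcs: "\<forall>n. a n \<le> b n \<and> speed_le \<Omega> (\<lambda>_. l) (a n) (b n) (\<sigma>' n) \<and>
      (\<forall>s\<in>{a n..b n}. \<forall>t\<in>{a n..b n}. \<bar>s - t\<bar> / l - c \<le> kobayashi_dist \<Omega> (\<sigma>' n s) (\<sigma>' n t)) \<and>
      \<sigma>' n ` {a n..b n} \<subseteq> U \<inter> cball p (r/4) \<and> \<eta>' \<le> dist (\<sigma>' n (a n)) (\<sigma>' n (b n))"
      and avoid: "\<forall>K. compact K \<longrightarrow> K \<subseteq> \<Omega> \<longrightarrow> eventually (\<lambda>n. \<sigma>' n ` {a n..b n} \<inter> K = {}) sequentially"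
      by (elim exE conjE)
    interpret boundary_chart \<Omega> U p r by (rule bc)
    show False
      by (rule visibility_contradiction[OF _ l c, of a b \<sigma>' \<eta>'])
        (use vis arcs avoid \<eta>' in \<open>simp_all add: visible_pair_def\<close>)
  qed
qed

lemma local_weak_visibility_domain_imp_global:
  fixes \<Omega> :: "(complex ^ 'd) set"
  assumes \<Omega>: "is_domain \<Omega>" "kobayashi_hyperbolic \<Omega>" "BSP \<Omega>" and loc: "local_weak_visibility_domain \<Omega>"
  shows "weak_visibility_domain \<Omega>"
  unfolding weak_visibility_domain_def weakly_visible_pair_def lambda_visible_pair_def
proof (intro ballI allI impI)
  fix \<zeta> \<eta> and c :: real
  assume *: "\<zeta> \<in> end_boundary \<Omega>" "\<eta> \<in> end_boundary \<Omega>" "\<zeta> \<noteq> \<eta>" and c: "0 < c"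
  show "visible_pair_const \<Omega> 1 c \<zeta> \<eta>"
  proof (rule ccontr)
    assume "\<not> visible_pair_const \<Omega> 1 c \<zeta> \<eta>"
    from not_visible_imp_escapes_near[OF \<Omega>(1) * this] obtain p \<sigma> T s u e where
      esc: "escapes_near \<Omega> 1 c p \<sigma> T s u e" by (elim exE)
    from loc[unfolded local_weak_visibility_domain_def, rule_format, OF escapes_near_in(1)[OF esc],
        of "\<lambda>n. \<sigma> n (s n)"] escapes_near_in(2)[OF esc]
    obtain U k where U: "is_domain U" "U \<subseteq> \<Omega>" "strict_mono (k :: nat \<Rightarrow> nat)" "p \<in> shared_boundary U \<Omega>"
      "\<And>n. \<sigma> (k n) (s (k n)) \<in> U" and vis: "\<And>q q'. q \<in> shared_boundary U \<Omega> \<Longrightarrow> q' \<in> shared_boundary U \<Omega> \<Longrightarrow> q \<noteq> q' \<Longrightarrow>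
        weakly_visible_pair U (Pt q) (Pt q')" by blast
    from escapes_near_subarcs[OF \<Omega> esc U(1-5)] obtain r \<sigma>' a b \<eta>' where
      bc: "boundary_chart \<Omega> U p r" and \<eta>': "0 < \<eta>'"
      and arcs: "\<forall>n. a n \<le> b n \<and> speed_le \<Omega> (\<lambda>_. 1) (a n) (b n) (\<sigma>' n) \<and>
      (\<forall>s\<in>{a n..b n}. \<forall>t\<in>{a n..b n}. \<bar>s - t\<bar> / 1 - c \<le> kobayashi_dist \<Omega> (\<sigma>' n s) (\<sigma>' n t)) \<and>
      \<sigma>' n ` {a n..b n} \<subseteq> U \<inter> cball p (r/4) \<and> \<eta>' \<le> dist (\<sigma>' n (a n)) (\<sigma>' n (b n))"
      and avoid: "\<forall>K. compact K \<longrightarrow> K \<subseteq> \<Omega> \<longrightarrow> eventually (\<lambda>n. \<sigma>' n ` {a n..b n} \<inter> K = {}) sequentially"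
      by (elim exE conjE)
    interpret boundary_chart \<Omega> U p r by (rule bc)
    show False
      by (rule weak_visibility_contradiction[OF _ c, of a b \<sigma>' \<eta>'])
        (use vis arcs avoid \<eta>' in \<open>simp_all add: weakly_visible_pair_def\<close>)
  qed
qed

theorem theorem1p9:
  fixes \<Omega> :: "(complex ^ 'd) set"
  assumes "is_domain \<Omega>"
  shows "(bounded \<Omega> \<longrightarrow> kobayashi_hyperbolic \<Omega> \<and> BSP \<Omega>) \<and>
         (kobayashi_hyperbolic \<Omega> \<and> BSP \<Omega> \<longrightarrow>
            (visibility_domain \<Omega> \<longleftrightarrow> local_visibility_domain \<Omega>) \<and>
            (weak_visibility_domain \<Omega> \<longleftrightarrow> local_weak_visibility_domain \<Omega>))"
  using assms bounded_imp_kobayashi_hyperbolic bounded_imp_BSP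
    visibility_domain_imp_local local_visibility_domain_imp_global
    weak_visibility_domain_imp_local local_weak_visibility_domain_imp_global by blast

end
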